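(* Let $x$ be a critical point of the functional $\mathcal F(x)=\int_0^T L(t,x,\dot x)\,dt$, where $L\in C^2([0,T]\times\mathbf R^{n}\times\mathbf R^n,\mathbf R)$ satisfies the Legendre convexity condition, and let $\gamma$ be the fundamental solution of the associated linear Hamiltonian system along $x$. Let $\Lambda_s$ be a Lagrangian subspace of $(\mathbf C^{2n},-\omega)$ and $\Lambda_e$ a Lagrangian subspace of $(\mathbf C^{2n},\omega)$, and consider the separated boundary condition $\Lambda_s\oplus\Lambda_e$ (i.e. $z(0)\in\Lambda_s$, $z(T)\in\Lambda_e$). Then $$m^-(\Lambda_s\oplus\Lambda_e)=\sum_{0<t_0<T}\dim\big(\gamma(t_0)\Lambda_s\cap\Lambda_D^n\big)+i\big(\gamma(T)\Lambda_s,\Lambda_e,\Lambda_D^n\big),$$ where the triple index $i$ is computed in $(\mathbf C^{2n},\omega)$.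
   Context: **Lagrangian system.** The Legendre condition is $(D^2_{vv}L(t,u,v)w,w)>0$ for all $t\in[0,T]$, $u,v\in\mathbf R^n$, $w\in\mathbf R^n\setminus\{0\}$. A critical (stationary) point is a solution $x$ of $\frac{d}{dt}\frac{\partial L}{\partial\dot x}(t,x,\dot x)-\frac{\partial L}{\partial x}(t,x,\dot x)=0$ on $[0,T]$ ($x\in C^1$ and $t\mapsto \frac{\partial L}{\partial \dot x}(t,x(t),\dot x(t))$ is $C^1$). Along $x$ put $P(t)=\frac{\partial^2L}{\partial\dot x^2}$, $Q(t)=\frac{\partial^2L}{\partial x\partial\dot x}$ (entries $Q_{ij}=\partial^2L/\partial\dot x_i\partial x_j$), $R(t)=\frac{\partial^2L}{\partial x^2}$; these are continuous in $t$, $P$ is symmetric positive definite, $R$ is symmetric. The linearization is given by $\mathcal A\xi=-\frac{d}{dt}(P\dot \xi+Q\xi)+Q^T\dot \xi+R\xi$. **Symplectic notation.** $\langle\cdot,\cdot\rangle$ is the standard Hermitian inner product (linear in the first argument), $J=\begin{bmatrix}0&-I_n\\ I_n&0\end{bmatrix}$, $\omega(a,b)=\langle Ja,b\rangle$ on $\mathbf C^{2n}$. A complex subspace of a complex symplectic space is Lagrangian if the symplectic form vanishes on it and it has half the dimension. $\Lambda^n_D=\mathbf C^n\oplus\{0\}\subset\mathbf C^{2n}$. **Morse index.** For a function $\xi$ put $y=P\dot\xi+Q\xi$ and $z=(y,\xi)^T\in\mathbf C^{2n}$. For a Lagrangian subspace $\Lambda_0$ of $(\mathbf C^{2n}\oplus\mathbf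 C^{2n},-\omega\oplus\omega)$, $\mathcal A$ is a self-adjoint operator on $L^2([0,T],\mathbf C^n)$ with domain $\{\xi\in W^{1,2}([0,T],\mathbf C^n): P\dot\xi+Q\xi\in W^{1,2},\ (z(0),z(T))\in\Lambda_0\}$; $m^-(\Lambda_0)$ denotes its number of negative eigenvalues, counted with multiplicity. **Fundamental solution.** $\gamma$ solves $\dot\gamma=J\mathcal B\gamma$, $\gamma(0)=I_{2n}$, with $\mathcal B=\begin{bmatrix}P^{-1}&-P^{-1}Q\\ -Q^TP^{-1}&Q^TP^{-1}Q-R\end{bmatrix}$. **Triple index.** For Lagrangian subspaces $\alpha,\beta,\kappa$ of a complex symplectic space $(V,\omega_V)$, let $\mathfrak Q(\alpha,\beta;\kappa)$ be the Hermitian form on $\alpha\cap(\beta+\kappa)$ given by $\mathfrak Q(x_1,x_2)=\omega_V(y_1,z_2)$, where $x_j=y_j+z_j$, $y_j\in\beta$, $z_j\in\kappa$. Then $i(\alpha,\beta,\kappa)=m^+(\mathfrak Q(\alpha,\beta;\kappa))+\dim(\alpha\cap\kappa)-\dim(\alpha\cap\beta\cap\kappa)$, where $m^+$ is the maximal dimension of a positive definite subspace. *)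

theory Defs
  imports "HOL-Analysis.Analysis" "HOL-Library.Extended_Nat" "HOL-Library.Function_Algebras"
begin

section \<open>The Lagrangian and its critical points\<close>

text \<open>Derivatives are taken within the set; on \<open>{0..T} \<times> UNIV \<times> UNIV\<close> this means one-sided
  time derivatives at the two end points.\<close>

definition C1_on :: "'a::real_normed_vector set \<Rightarrow> ('a \<Rightarrow> 'b::real_normed_vector) \<Rightarrow> bool" where
  "C1_on S f \<longleftrightarrow> (\<exists>f' :: 'a \<Rightarrow> 'a \<Rightarrow>\<^sub>L 'b.
     (\<forall>z\<in>S. (f has_derivative blinfun_apply (f' z)) (at z within S)) \<and> continuous_on S f')"

definition C2_on :: "'a::real_normed_vector set \<Rightarrow> ('a \<Rightarrow> 'b::real_normed_vector) \<Rightarrow> bool" where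
  "C2_on S f \<longleftrightarrow> (\<exists>f' :: 'a \<Rightarrow> 'a \<Rightarrow>\<^sub>L 'b.
     (\<forall>z\<in>S. (f has_derivative blinfun_apply (f' z)) (at z within S)) \<and> C1_on S f')"

type_synonym 'n lagrangian_fun = "real \<Rightarrow> real^'n \<Rightarrow> real^'n \<Rightarrow> real"

definition partial_u :: "'n::finite \<Rightarrow> 'n lagrangian_fun \<Rightarrow> 'n lagrangian_fun" where
  "partial_u i F = (\<lambda>t u v. deriv (\<lambda>s. F t (u + s *\<^sub>R axis i 1) v) 0)"

definition partial_v :: "'n::finite \<Rightarrow> 'n lagrangian_fun \<Rightarrow> 'n lagrangian_fun" where
  "partial_v i F = (\<lambda>t u v. deriv (\<lambda>s. F t u (v + s *\<^sub>R axis i 1)) 0)"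

definition grad_u :: "'n::finite lagrangian_fun \<Rightarrow> real \<Rightarrow> real^'n \<Rightarrow> real^'n \<Rightarrow> real^'n" where
  "grad_u L t u v = (\<chi> i. partial_u i L t u v)"

definition grad_v :: "'n::finite lagrangian_fun \<Rightarrow> real \<Rightarrow> real^'n \<Rightarrow> real^'n \<Rightarrow> real^'n" where
  "grad_v L t u v = (\<chi> i. partial_v i L t u v)"

definition hess_vv :: "'n::finite lagrangian_fun \<Rightarrow> real \<Rightarrow> real^'n \<Rightarrow> real^'n \<Rightarrow> real^'n^'n" where
  "hess_vv L t u v = (\<chi> i j. partial_v i (partial_v j L) t u v)"

text \<open>The row index is the velocity index.\<close>

definition hess_vu :: "'n::finite lagrangian_fun \<Rightarrow> real \<Rightarrow> real^'n \<Rightarrow> real^'n \<Rightarrow> real^'n^'n" where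
  "hess_vu L t u v = (\<chi> i j. partial_v i (partial_u j L) t u v)"

definition hess_uu :: "'n::finite lagrangian_fun \<Rightarrow> real \<Rightarrow> real^'n \<Rightarrow> real^'n \<Rightarrow> real^'n^'n" where
  "hess_uu L t u v = (\<chi> i j. partial_u i (partial_u j L) t u v)"

definition legendre_condition :: "real \<Rightarrow> 'n::finite lagrangian_fun \<Rightarrow> bool" where
  "legendre_condition T L \<longleftrightarrow>
     (\<forall>t\<in>{0..T}. \<forall>u v w. w \<noteq> 0 \<longrightarrow> (hess_vv L t u v *v w) \<bullet> w > 0)"

definition velocity :: "real \<Rightarrow> (real \<Rightarrow> real^'n::finite) \<Rightarrow> real \<Rightarrow> real^'n" where
  "velocity T x t = vector_derivative x (at t within {0..T})"

definition critical_point :: "real \<Rightarrow> 'n::finite lagrangian_fun \<Rightarrow> (real \<Rightarrow> real^'n) \<Rightarrow> bool" where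
  "critical_point T L x \<longleftrightarrow>
     C1_on {0..T} x \<and>
     C1_on {0..T} (\<lambda>t. grad_v L t (x t) (velocity T x t)) \<and>
     (\<forall>t\<in>{0..T}. ((\<lambda>s. grad_v L s (x s) (velocity T x s))
        has_vector_derivative grad_u L t (x t) (velocity T x t)) (at t within {0..T}))"

definition complexify :: "real^'n^'m \<Rightarrow> complex^'n^'m" where
  "complexify M = (\<chi> i j. complex_of_real (M $ i $ j))"

definition P_along :: "real \<Rightarrow> 'n::finite lagrangian_fun \<Rightarrow> (real \<Rightarrow> real^'n) \<Rightarrow> real \<Rightarrow> complex^'n^'n" where
  "P_along T L x t = complexify (hess_vv L t (x t) (velocity T x t))"

definition Q_along :: "real \<Rightarrow> 'n::finite lagrangian_fun \<Rightarrow> (real \<Rightarrow> real^'n) \<Rightarrow> real \<Rightarrow> complex^'n^'n" where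
  "Q_along T L x t = complexify (hess_vu L t (x t) (velocity T x t))"

definition R_along :: "real \<Rightarrow> 'n::finite lagrangian_fun \<Rightarrow> (real \<Rightarrow> real^'n) \<Rightarrow> real \<Rightarrow> complex^'n^'n" where
  "R_along T L x t = complexify (hess_uu L t (x t) (velocity T x t))"


section \<open>Complex symplectic linear algebra\<close>

text \<open>Vectors of \<open>\<complex>\<^sup>2\<^sup>n\<close> are indexed by \<open>'n + 'n\<close>: in \<open>z = (y, \<xi>)\<close> the entries of \<open>y\<close> carry the
  indices \<open>Inl i\<close> and those of \<open>\<xi>\<close> the indices \<open>Inr i\<close>.\<close>

definition block_vec :: "'a^'n \<Rightarrow> 'a^'n \<Rightarrow> 'a^('n + 'n)" where
  "block_vec y \<xi> = (\<chi> k. case k of Inl i \<Rightarrow> y $ i | Inr i \<Rightarrow> \<xi> $ i)"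

definition block_mat :: "'a^'n^'n \<Rightarrow> 'a^'n^'n \<Rightarrow> 'a^'n^'n \<Rightarrow> 'a^'n^'n \<Rightarrow> 'a^('n + 'n)^('n + 'n)" where
  "block_mat A B C D = (\<chi> k. case k of Inl i \<Rightarrow> block_vec (A $ i) (B $ i)
                                    | Inr i \<Rightarrow> block_vec (C $ i) (D $ i))"

definition J_mat :: "complex^('n::finite + 'n)^('n + 'n)" where
  "J_mat = block_mat 0 (- mat 1) (mat 1) 0"

definition herm_inner :: "complex^'m::finite \<Rightarrow> complex^'m \<Rightarrow> complex" where
  "herm_inner a b = (\<Sum>i\<in>UNIV. a $ i * cnj (b $ i))"

definition \<omega> :: "complex^('n::finite + 'n) \<Rightarrow> complex^('n + 'n) \<Rightarrow> complex" where
  "\<omega> a b = herm_inner (J_mat *v a) b"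

definition lagrangian_subspace ::
    "(complex^'m::finite \<Rightarrow> complex^'m \<Rightarrow> complex) \<Rightarrow> (complex^'m) set \<Rightarrow> bool" where
  "lagrangian_subspace w \<Lambda> \<longleftrightarrow>
     vec.subspace \<Lambda> \<and> (\<forall>a\<in>\<Lambda>. \<forall>b\<in>\<Lambda>. w a b = 0) \<and> 2 * vec.dim \<Lambda> = CARD('m)"

definition \<Lambda>\<^sub>D :: "(complex^('n::finite + 'n)) set" where
  "\<Lambda>\<^sub>D = {block_vec y 0 | y. True}"

definition B_mat :: "complex^'n^'n \<Rightarrow> complex^'n^'n \<Rightarrow> complex^'n^'n \<Rightarrow> complex^('n::finite + 'n)^('n + 'n)" where
  "B_mat P Q R =
     block_mat (matrix_inv P) (- (matrix_inv P ** Q))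
               (- (transpose Q ** matrix_inv P)) (transpose Q ** matrix_inv P ** Q - R)"

definition fundamental_solution ::
    "real \<Rightarrow> (real \<Rightarrow> complex^('n + 'n)^('n::finite + 'n)) \<Rightarrow> (real \<Rightarrow> complex^('n + 'n)^('n + 'n)) \<Rightarrow> bool" where
  "fundamental_solution T B \<gamma> \<longleftrightarrow>
     \<gamma> 0 = mat 1 \<and>
     (\<forall>t\<in>{0..T}. (\<gamma> has_vector_derivative (J_mat ** B t ** \<gamma> t)) (at t within {0..T}))"

definition subspace_sum :: "(complex^'m::finite) set \<Rightarrow> (complex^'m) set \<Rightarrow> (complex^'m) set" where
  "subspace_sum \<beta> \<kappa> = {y + z | y z. y \<in> \<beta> \<and> z \<in> \<kappa>}"

text \<open>The value does not depend on the decompositions when \<open>\<beta>\<close> and \<open>\<kappa>\<close> are isotropic.\<close>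

definition Q_form ::
    "(complex^'m::finite \<Rightarrow> complex^'m \<Rightarrow> complex) \<Rightarrow> (complex^'m) set \<Rightarrow> (complex^'m) set
     \<Rightarrow> complex^'m \<Rightarrow> complex^'m \<Rightarrow> complex" where
  "Q_form w \<beta> \<kappa> x\<^sub>1 x\<^sub>2 = (THE c. \<exists>y\<^sub>1\<in>\<beta>. \<exists>z\<^sub>1\<in>\<kappa>. \<exists>y\<^sub>2\<in>\<beta>. \<exists>z\<^sub>2\<in>\<kappa>.
     x\<^sub>1 = y\<^sub>1 + z\<^sub>1 \<and> x\<^sub>2 = y\<^sub>2 + z\<^sub>2 \<and> c = w y\<^sub>1 z\<^sub>2)"

text \<open>A Hermitian form is real on the diagonal, so positivity is tested on the real part.\<close>

definition m_plus :: "(complex^'m::finite \<Rightarrow> complex^'m \<Rightarrow> complex) \<Rightarrow> (complex^'m) set \<Rightarrow> nat" where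
  "m_plus q U = Max {vec.dim W | W. vec.subspace W \<and> W \<subseteq> U \<and> (\<forall>x\<in>W. x \<noteq> 0 \<longrightarrow> Re (q x x) > 0)}"

text \<open>The subtraction does not truncate, since \<open>\<alpha> \<inter> \<beta> \<inter> \<kappa> \<subseteq> \<alpha> \<inter> \<kappa>\<close>.\<close>

definition triple_index ::
    "(complex^'m::finite \<Rightarrow> complex^'m \<Rightarrow> complex) \<Rightarrow>
     (complex^'m) set \<Rightarrow> (complex^'m) set \<Rightarrow> (complex^'m) set \<Rightarrow> nat" where
  "triple_index w \<alpha> \<beta> \<kappa> =
     m_plus (Q_form w \<beta> \<kappa>) (\<alpha> \<inter> subspace_sum \<beta> \<kappa>) + vec.dim (\<alpha> \<inter> \<kappa>) - vec.dim (\<alpha> \<inter> \<beta> \<inter> \<kappa>)"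


section \<open>The operator and its Morse index\<close>

definition L2_on :: "real \<Rightarrow> (real \<Rightarrow> complex^'n::finite) \<Rightarrow> bool" where
  "L2_on T g \<longleftrightarrow> g \<in> borel_measurable (lebesgue_on {0..T}) \<and>
     integrable (lebesgue_on {0..T}) (\<lambda>t. (norm (g t))\<^sup>2)"

text \<open>\<open>f\<close> is the absolutely continuous representative of an element of \<open>W\<^sup>1\<^sup>,\<^sup>2([0,T])\<close> and \<open>g\<close> is
  its weak derivative (determined almost everywhere).\<close>

definition W12_deriv :: "real \<Rightarrow> (real \<Rightarrow> complex^'n::finite) \<Rightarrow> (real \<Rightarrow> complex^'n) \<Rightarrow> bool" where
  "W12_deriv T f g \<longleftrightarrow> L2_on T g \<and> (\<forall>t\<in>{0..T}. (g has_integral (f t - f 0)) {0..t})"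

text \<open>The graph of the operator: \<open>\<xi>\<close> lies in the domain determined by \<open>\<Lambda>\<^sub>0\<close> and
  \<open>\<eta> = - (P \<xi>' + Q \<xi>)' + Q\<^sup>T \<xi>' + R \<xi>\<close> almost everywhere.  As \<open>\<xi>'\<close> is only defined almost everywhere,
  \<open>y\<close> is the continuous representative of \<open>P \<xi>' + Q \<xi>\<close>, and it gives the boundary values.\<close>

definition operator_graph ::
    "real \<Rightarrow> (real \<Rightarrow> complex^'n^'n) \<Rightarrow> (real \<Rightarrow> complex^'n^'n) \<Rightarrow> (real \<Rightarrow> complex^'n^'n) \<Rightarrow>
     ((complex^('n::finite + 'n)) \<times> (complex^('n + 'n))) set \<Rightarrow>
     (real \<Rightarrow> complex^'n) \<Rightarrow> (real \<Rightarrow> complex^'n) \<Rightarrow> bool" where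
  "operator_graph T P Q R \<Lambda>\<^sub>0 \<xi> \<eta> \<longleftrightarrow> (\<exists>\<xi>' y y'.
     W12_deriv T \<xi> \<xi>' \<and> W12_deriv T y y' \<and>
     (AE t in lebesgue_on {0..T}. y t = P t *v \<xi>' t + Q t *v \<xi> t) \<and>
     (block_vec (y 0) (\<xi> 0), block_vec (y T) (\<xi> T)) \<in> \<Lambda>\<^sub>0 \<and>
     (AE t in lebesgue_on {0..T}. \<eta> t = - y' t + transpose (Q t) *v \<xi>' t + R t *v \<xi> t))"

text \<open>An element of \<open>L\<^sup>2\<close> in the domain is represented by its continuous representative on \<open>{0..T}\<close>,
  extended by zero, so that distinct functions are distinct elements of \<open>L\<^sup>2\<close> and the dimension
  below is that of the eigenspace in \<open>L\<^sup>2\<close>.\<close>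

definition eigenspace ::
    "real \<Rightarrow> (real \<Rightarrow> complex^'n^'n) \<Rightarrow> (real \<Rightarrow> complex^'n^'n) \<Rightarrow> (real \<Rightarrow> complex^'n^'n) \<Rightarrow>
     ((complex^('n::finite + 'n)) \<times> (complex^('n + 'n))) set \<Rightarrow> real \<Rightarrow> (real \<Rightarrow> complex^'n) set" where
  "eigenspace T P Q R \<Lambda>\<^sub>0 \<mu> =
     {\<xi>. (\<forall>t. t \<notin> {0..T} \<longrightarrow> \<xi> t = 0) \<and>
         operator_graph T P Q R \<Lambda>\<^sub>0 \<xi> (\<lambda>t. complex_of_real \<mu> *s \<xi> t)}"

global_interpretation cfun: vector_space "\<lambda>c (f :: real \<Rightarrow> complex^'n::finite) t. c *s f t"
  by unfold_locales (auto simp: fun_eq_iff plus_fun_def vec_eq_iff algebra_simps)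

definition cfun_dim :: "(real \<Rightarrow> complex^'n::finite) set \<Rightarrow> enat" where
  "cfun_dim E = (if \<exists>B. finite B \<and> E \<subseteq> cfun.span B then enat (cfun.dim E) else \<infinity>)"

text \<open>The (possibly infinite) sum of the multiplicities over all negative eigenvalues; a \<open>\<mu>\<close> that
  is not an eigenvalue contributes \<open>0\<close>.\<close>

definition morse_index ::
    "real \<Rightarrow> (real \<Rightarrow> complex^'n^'n) \<Rightarrow> (real \<Rightarrow> complex^'n^'n) \<Rightarrow> (real \<Rightarrow> complex^'n^'n) \<Rightarrow>
     ((complex^('n::finite + 'n)) \<times> (complex^('n + 'n))) set \<Rightarrow> enat" where
  "morse_index T P Q R \<Lambda>\<^sub>0 =
     (SUP F \<in> {F. finite F \<and> F \<subseteq> {..<0}}. \<Sum>\<mu>\<in>F. cfun_dim (eigenspace T P Q R \<Lambda>\<^sub>0 \<mu>))"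

end

theory Submission
  imports Defs
begin

text \<open>
  Replace \<open>R\<close> by \<open>R - \<mu>\<close> and let \<open>N(\<mu>)\<close> be the right-hand side of the formula for the resulting
  Hamiltonian flow \<open>\<gamma>\<^sub>\<mu>\<close>. In a chart of the Lagrangian Grassmannian that is transversal to a subspace
  \<open>{y = s x}\<close>, the path \<open>t \<mapsto> \<gamma>\<^sub>\<mu>(t) \<Lambda>\<^sub>s\<close> becomes a path of Hermitian forms. By the Legendre condition its
  derivative is positive on the radical, so the crossings with \<open>\<Lambda>\<^sub>D\<close> in a short time interval are
  counted by the increase of the positive index. An identity for the inertia of a difference of two
  Hermitian forms turns the triple index into chart indices as well. Consequently, up to a locally
  constant summand, \<open>N(\<mu>)\<close> is the positive index of a Hermitian form that compares \<open>\<gamma>\<^sub>\<mu>(T) \<Lambda>\<^sub>s\<close> with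
  \<open>\<Lambda>\<^sub>e\<close>. This form is increasing in \<open>\<mu>\<close> and its radical is the eigenspace for \<open>\<mu>\<close>, so \<open>N\<close> jumps exactly by
  the multiplicities of the eigenvalues. Since \<open>N(\<mu>) = 0\<close> for very negative \<open>\<mu>\<close> by an energy estimate,
  \<open>N(0)\<close> is the sum of the multiplicities of all negative eigenvalues. No spectral theorem is needed.
\<close>

section \<open>Inertia of Hermitian forms\<close>

text \<open>The obstacle is that no single chart need contain the whole path of Lagrangian
  subspaces, and that at a crossing with \<open>\<Lambda>\<^sub>D\<close> neither the crossing count
  nor a chart index is stable in \<mu>. Only their combination is: over a short time interval the
  count equals the increase of a chart index, and charts are exchanged only at times without a
  crossing at the given \<mu>, where indices are locally constant. All forms are pulled back to
  \<open>\<Lambda>\<^sub>s\<close>, so that the underlying space stays fixed while the Lagrangian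
  moves and perturbation of forms applies. An isotropic subspace meets {y = s x} nontrivially for
  finitely many real s only, hence one s serves two Lagrangians at once. A positive crossing raises
  the positive index immediately after the crossing and not before it; jumps are therefore
  attributed to the left end of half-open intervals. A crossing at time 0 contributes a constant,
  since all flows start at the identity, and one at T is left to the triple index. Monotonicity in
  \<mu>, symplecticity and uniqueness of solutions all rest on one identity, the derivative of
  \<omega> along two solutions with different spectral parameters.\<close>

definition sesq :: "(complex^'m::finite \<Rightarrow> complex^'m \<Rightarrow> complex) \<Rightarrow> bool" where
  "sesq q \<longleftrightarrow> (\<forall>x y z. q (x + y) z = q x z + q y z) \<and> (\<forall>c x y. q (c *s x) y = c * q x y) \<and>
     (\<forall>x y z. q x (y + z) = q x y + q x z) \<and> (\<forall>c x y. q x (c *s y) = cnj c * q x y)"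

definition herm_on :: "(complex^'m::finite) set \<Rightarrow> (complex^'m \<Rightarrow> complex^'m \<Rightarrow> complex) \<Rightarrow> bool" where
  "herm_on U q \<longleftrightarrow> (\<forall>x\<in>U. \<forall>y\<in>U. q y x = cnj (q x y))"

definition perp :: "(complex^'m::finite \<Rightarrow> complex^'m \<Rightarrow> complex) \<Rightarrow> (complex^'m) set \<Rightarrow> (complex^'m) set \<Rightarrow> (complex^'m) set" where
  "perp q U W = {x\<in>U. \<forall>w\<in>W. q x w = 0}"

lemma sesqD:
  assumes "sesq q"
  shows "q (x + y) z = q x z + q y z" "q (c *s x) y = c * q x y"
    "q x (y + z) = q x y + q x z" "q x (c *s y) = cnj c * q x y"
    "q 0 x = 0" "q x 0 = 0" "q (- x) y = - q x y" "q x (- y) = - q x y"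
    "q (x - y) z = q x z - q y z" "q x (y - z) = q x y - q x z"
proof -
  show 1: "q (x + y) z = q x z + q y z" "q (c *s x) y = c * q x y"
    "q x (y + z) = q x y + q x z" "q x (c *s y) = cnj c * q x y" for x y z c
    using assms unfolding sesq_def by blast+
  show "q 0 x = 0" using 1(2)[of 0 0 x] by simp
  show "q x 0 = 0" using 1(4)[of x 0 0] by simp
  show m1: "q (- x) y = - q x y" for x y
    using 1(2)[of "-1" x y] by simp
  show m2: "q x (- y) = - q x y" for x y
    using 1(4)[of x "-1" y] by simp
  show "q (x - y) z = q x z - q y z" using 1(1)[of x "-y" z] m1 by simp
  show "q x (y - z) = q x y - q x z" using 1(3)[of x y "-z"] m2 by simp
qed

lemma sesq_uminus: "sesq q \<Longrightarrow> sesq (\<lambda>x y. - q x y)"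
  unfolding sesq_def by auto

lemma herm_on_uminus: "herm_on U q \<Longrightarrow> herm_on U (\<lambda>x y. - q x y)"
  unfolding herm_on_def by (metis complex_cnj_minus)

lemma herm_on_subset: "herm_on U q \<Longrightarrow> V \<subseteq> U \<Longrightarrow> herm_on V q"
  unfolding herm_on_def by blast

lemma herm_onD: "herm_on U q \<Longrightarrow> x \<in> U \<Longrightarrow> y \<in> U \<Longrightarrow> q y x = cnj (q x y)"
  unfolding herm_on_def by blast

lemma perp_uminus: "perp (\<lambda>x y. - q x y) U W = perp q U W"
  unfolding perp_def by simp

lemma subspace_perp: "sesq q \<Longrightarrow> vec.subspace U \<Longrightarrow> vec.subspace (perp q U W)"
  unfolding vec.subspace_def perp_def by (auto simp: sesqD)

lemma perp_subset: "perp q U W \<subseteq> U"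
  unfolding perp_def by auto

lemma perpD: "x \<in> perp q U W \<Longrightarrow> x \<in> U" "x \<in> perp q U W \<Longrightarrow> w \<in> W \<Longrightarrow> q x w = 0"
  unfolding perp_def by auto

lemma perp_sym:
  assumes "herm_on U q" "W \<subseteq> U" "x \<in> perp q U W" "w \<in> W"
  shows "q w x = 0"
  using herm_onD[OF assms(1), of x w] perpD[OF assms(3)] assms(2,4) by (metis complex_cnj_zero subsetD)

section \<open>Sums and complements of subspaces\<close>

lemma subspace_subspace_sum:
  "vec.subspace U \<Longrightarrow> vec.subspace W \<Longrightarrow> vec.subspace (subspace_sum U W)"
  unfolding subspace_sum_def by (rule vec.subspace_sums)

lemma subspace_sum_upper: assumes "vec.subspace U" "vec.subspace W"
  shows "U \<subseteq> subspace_sum U W" "W \<subseteq> subspace_sum U W"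
  using vec.subspace_0[OF assms(1)] vec.subspace_0[OF assms(2)]
  unfolding subspace_sum_def by force+

lemma subspace_sum_least:
  "vec.subspace X \<Longrightarrow> U \<subseteq> X \<Longrightarrow> W \<subseteq> X \<Longrightarrow> subspace_sum U W \<subseteq> X"
  unfolding subspace_sum_def by (auto intro!: vec.subspace_add)

lemma dim_subspace_sum:
  "vec.subspace U \<Longrightarrow> vec.subspace W \<Longrightarrow> vec.dim (subspace_sum U W) + vec.dim (U \<inter> W) = vec.dim U + vec.dim W"
  unfolding subspace_sum_def by (rule vec.dim_sums_Int)

lemma dim_subspace_sum_direct:
  assumes "vec.subspace U" "vec.subspace W" "U \<inter> W \<subseteq> {0}"
  shows "vec.dim (subspace_sum U W) = vec.dim U + vec.dim W"
proof -
  have "vec.dim (U \<inter> W) = 0" using assms(3) by simp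
  then show ?thesis using dim_subspace_sum[OF assms(1,2)] by linarith
qed

lemma subspace_eqI_dim:
  assumes "vec.subspace V" "vec.subspace U" "V \<subseteq> U" "vec.dim U \<le> vec.dim V"
  shows "V = U"
  using vec.subspace_dim_equal assms by blast

lemma complement_exists:
  fixes U W :: "(complex^'m::finite) set"
  assumes U: "vec.subspace U" and W: "vec.subspace W" and "W \<subseteq> U"
  shows "\<exists>C. vec.subspace C \<and> C \<subseteq> U \<and> W \<inter> C = {0} \<and> subspace_sum W C = U \<and>
    vec.dim W + vec.dim C = vec.dim U"
proof -
  obtain B where B: "B \<subseteq> W" "vec.independent B" "W \<subseteq> vec.span B" "card B = vec.dim W"
    using vec.basis_exists by blast
  obtain B' where B': "B \<subseteq> B'" "B' \<subseteq> U" "vec.independent B'" "U \<subseteq> vec.span B'"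
    using vec.maximal_independent_subset_extend[of B U] B assms(3) by blast
  have fin: "finite B'" using B'(3) vec.finiteI_independent by blast
  define C where "C = vec.span (B' - B)"
  have C: "vec.subspace C" "C \<subseteq> U"
    unfolding C_def using vec.span_minimal[OF _ U, of "B' - B"] B' by auto
  have dC: "vec.dim C = card (B' - B)"
    unfolding C_def using vec.independent_mono[OF B'(3)] by (simp add: vec.dim_eq_card_independent)
  have dU: "vec.dim U = card B'"
    using vec.basis_card_eq_dim[OF B'(2,4,3)] by simp
  have card: "card B' = card B + card (B' - B)"
    using fin B'(1) by (metis card_Diff_subset card_mono finite_subset le_add_diff_inverse)
  have "B' \<subseteq> subspace_sum W C"
  proof
    fix b assume "b \<in> B'"
    then have "b \<in> W \<or> b \<in> C" unfolding C_def using B(1) vec.span_base by blast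
    then show "b \<in> subspace_sum W C" using subspace_sum_upper[OF W C(1)] by blast
  qed
  then have "U \<subseteq> subspace_sum W C"
    using B'(4) vec.span_minimal subspace_subspace_sum[OF W C(1)] by blast
  then have s: "subspace_sum W C = U" using subspace_sum_least[OF U assms(3) C(2)] by blast
  have d: "vec.dim W + vec.dim C = vec.dim U" using dC dU card B(4) by simp
  have "vec.dim (W \<inter> C) = 0" using dim_subspace_sum[OF W C(1)] s d by simp
  then have "W \<inter> C = {0}" using vec.subspace_0[OF W] vec.subspace_0[OF C(1)] by auto
  with C s d show ?thesis by blast
qed

section \<open>Orthogonal complements with respect to a possibly degenerate form\<close>

lemma dim_functional_kernel:
  fixes V :: "(complex^'m::finite) set"
  assumes q: "sesq q" and V: "vec.subspace V"
  shows "vec.dim V \<le> vec.dim {x\<in>V. q x w = 0} + 1"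
proof (cases "\<exists>x\<in>V. q x w \<noteq> 0")
  case False
  then have "{x\<in>V. q x w = 0} = V" by auto
  then show ?thesis by simp
next
  case True
  then obtain x where x: "x \<in> V" "q x w \<noteq> 0" by blast
  let ?K = "{x\<in>V. q x w = 0}"
  have "V \<subseteq> vec.span (insert x ?K)"
  proof
    fix v assume v: "v \<in> V"
    define c where "c = q v w / q x w"
    have "v - c *s x \<in> ?K"
      using v x V by (auto simp: sesqD[OF q] c_def vec.subspace_diff vec.subspace_scale)
    then have "v - c *s x \<in> vec.span (insert x ?K)" by (auto intro: vec.span_base)
    moreover have "c *s x \<in> vec.span (insert x ?K)" by (intro vec.span_scale vec.span_base) auto
    ultimately show "v \<in> vec.span (insert x ?K)" using vec.span_add by fastforce
  qed
  then have "vec.dim V \<le> vec.dim (insert x ?K)" by (rule vec.dim_mono)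
  also have "\<dots> \<le> vec.dim ?K + 1" by (simp add: vec.dim_insert)
  finally show ?thesis .
qed

text \<open>Each basis vector of \<open>W\<close> imposes one linear condition, and one condition
  lowers the dimension by at most one.\<close>

lemma dim_perp_ge:
  fixes U W :: "(complex^'m::finite) set"
  assumes q: "sesq q" and U: "vec.subspace U"
  shows "vec.dim U \<le> vec.dim (perp q U W) + vec.dim W"
proof -
  obtain B where B: "B \<subseteq> W" "vec.independent B" "W \<subseteq> vec.span B" "card B = vec.dim W"
    using vec.basis_exists by blast
  have fin: "finite B" using B(2) vec.finiteI_independent by blast
  have "vec.dim U \<le> vec.dim (perp q U B) + card B" using fin
  proof (induction B)
    case empty
    then show ?case by (simp add: perp_def)
  next
    case (insert w F)
    have "perp q U (insert w F) = {x \<in> perp q U F. q x w = 0}" unfolding perp_def by auto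
    then show ?case
      using insert dim_functional_kernel[OF q subspace_perp[OF q U, of F], of w] by simp
  qed
  moreover have "perp q U B = perp q U W"
  proof -
    have "q x w = 0" if "x \<in> perp q U B" "w \<in> W" for x w
    proof -
      have "vec.subspace {w. q x w = 0}" unfolding vec.subspace_def by (auto simp: sesqD[OF q])
      then have "vec.span B \<subseteq> {w. q x w = 0}"
        using that(1) by (intro vec.span_minimal) (auto simp: perp_def)
      then show ?thesis using that(2) B(3) by auto
    qed
    then show ?thesis using B(1) unfolding perp_def by blast
  qed
  ultimately show ?thesis using B(4) by simp
qed

text \<open>Both inequalities come from \<open>dim_perp_ge\<close>. Vectors of \<open>W\<close> in
  the radical impose no condition, so a complement of them in \<open>W\<close> suffices for the
  lower bound. For the upper bound the roles are exchanged: vectors of \<open>W\<close> orthogonal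
  to a complement of \<open>perp q U W\<close> are orthogonal to all of \<open>U\<close>.\<close>

lemma dim_perp:
  fixes U W :: "(complex^'m::finite) set"
  assumes q: "sesq q" and h: "herm_on U q" and U: "vec.subspace U" and W: "vec.subspace W" "W \<subseteq> U"
  shows "vec.dim (perp q U W) + vec.dim W = vec.dim U + vec.dim (W \<inter> perp q U U)"
proof -
  let ?R = "perp q U U" and ?V = "perp q U W"
  have R: "vec.subspace ?R" and V: "vec.subspace ?V" using subspace_perp[OF q U] by auto
  obtain W' where W': "vec.subspace W'" "W' \<subseteq> W" "subspace_sum (W \<inter> ?R) W' = W"
    "vec.dim (W \<inter> ?R) + vec.dim W' = vec.dim W"
    using complement_exists[OF W(1) vec.subspace_inter[OF W(1) R] Int_lower1] by blast
  have R0: "q x r = 0" if "x \<in> U" "r \<in> ?R" for x r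
    by (rule perp_sym[OF h subset_refl that(2,1)])
  have "perp q U W' \<subseteq> ?V"
  proof
    fix x assume x: "x \<in> perp q U W'"
    have "q x w = 0" if w: "w \<in> W" for w
    proof -
      obtain r w' where rw: "w = r + w'" "r \<in> ?R" "w' \<in> W'"
        using w W'(3) unfolding subspace_sum_def by blast
      then show ?thesis using R0[OF perpD(1)[OF x] rw(2)] perpD(2)[OF x rw(3)] sesqD(3)[OF q] by simp
    qed
    then show "x \<in> ?V" using perpD(1)[OF x] unfolding perp_def by blast
  qed
  then have 1: "vec.dim U \<le> vec.dim ?V + vec.dim W'"
    using dim_perp_ge[OF q U, of W'] vec.dim_subset[of "perp q U W'" ?V] by linarith
  obtain C where C: "vec.subspace C" "C \<subseteq> U" "subspace_sum ?V C = U" "vec.dim ?V + vec.dim C = vec.dim U"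
    using complement_exists[OF U V perp_subset] by blast
  have "perp q W C \<subseteq> W \<inter> ?R"
  proof
    fix w assume w: "w \<in> perp q W C"
    have "q w x = 0" if x: "x \<in> U" for x
    proof -
      obtain v c where vc: "x = v + c" "v \<in> ?V" "c \<in> C"
        using x C(3) unfolding subspace_sum_def by blast
      have "q w v = 0" using perp_sym[OF h W(2) vc(2) perpD(1)[OF w]] .
      moreover have "q w c = 0" using perpD(2)[OF w vc(3)] .
      ultimately show ?thesis by (simp add: vc sesqD[OF q])
    qed
    then show "w \<in> W \<inter> ?R" using w W(2) unfolding perp_def by auto
  qed
  then have "vec.dim W \<le> vec.dim (W \<inter> ?R) + vec.dim C"
    using dim_perp_ge[OF q W(1), of C] vec.dim_subset[of "perp q W C" "W \<inter> ?R"] by linarith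
  then show ?thesis using 1 W'(4) C(4) by linarith
qed

section \<open>The positive index and the law of inertia\<close>

lemma m_plus_set:
  "finite {vec.dim W | W. vec.subspace W \<and> W \<subseteq> U \<and> (\<forall>x\<in>W. x \<noteq> 0 \<longrightarrow> Re (q x x) > 0)}"
proof (rule finite_subset)
  show "{vec.dim W | W. vec.subspace W \<and> W \<subseteq> U \<and> (\<forall>x\<in>W. x \<noteq> 0 \<longrightarrow> Re (q x x) > 0)}
    \<subseteq> {..vec.dim U}"
    using vec.dim_subset by auto
qed simp

lemma m_plus_ge:
  "vec.subspace W \<Longrightarrow> W \<subseteq> U \<Longrightarrow> (\<And>x. x \<in> W \<Longrightarrow> x \<noteq> 0 \<Longrightarrow> Re (q x x) > 0) \<Longrightarrow> vec.dim W \<le> m_plus q U"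
  unfolding m_plus_def by (rule Max_ge[OF m_plus_set]) auto

lemma m_plus_attained:
  assumes "vec.subspace U"
  shows "\<exists>W. vec.subspace W \<and> W \<subseteq> U \<and> (\<forall>x\<in>W. x \<noteq> 0 \<longrightarrow> Re (q x x) > 0) \<and> vec.dim W = m_plus q U"
proof -
  have "vec.dim {0 :: complex^'a} \<in> {vec.dim W | W. vec.subspace W \<and> W \<subseteq> U \<and> (\<forall>x\<in>W. x \<noteq> 0 \<longrightarrow> Re (q x x) > 0)}"
    using vec.subspace_0[OF assms] by (intro CollectI exI[of _ "{0}"]) (auto simp: vec.subspace_single_0)
  then have "m_plus q U \<in> {vec.dim W | W. vec.subspace W \<and> W \<subseteq> U \<and> (\<forall>x\<in>W. x \<noteq> 0 \<longrightarrow> Re (q x x) > 0)}"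
    unfolding m_plus_def using Max_in[OF m_plus_set] by blast
  then show ?thesis by auto
qed

text \<open>A subspace on which the form is negative definite meets one on which it is nonnegative
  only in 0. Any semidefinite witness thus bounds the opposite index.\<close>

lemma m_plus_uminus_le:
  fixes U :: "(complex^'m::finite) set"
  assumes U: "vec.subspace U" and V: "vec.subspace V" "V \<subseteq> U"
    and nn: "\<And>x. x \<in> V \<Longrightarrow> Re (q x x) \<ge> 0"
  shows "m_plus (\<lambda>x y. - q x y) U + vec.dim V \<le> vec.dim U"
proof -
  obtain W where W: "vec.subspace W" "W \<subseteq> U" "\<And>x. x \<in> W \<Longrightarrow> x \<noteq> 0 \<Longrightarrow> Re (- q x x) > 0"
    "vec.dim W = m_plus (\<lambda>x y. - q x y) U"
    using m_plus_attained[OF U, of "\<lambda>x y. - q x y"] by blast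
  have "W \<inter> V \<subseteq> {0}" using W(3) nn by force
  then have "vec.dim (subspace_sum W V) = vec.dim W + vec.dim V"
    by (rule dim_subspace_sum_direct[OF W(1) V(1)])
  moreover have "vec.dim (subspace_sum W V) \<le> vec.dim U"
    by (rule vec.dim_subset[OF subspace_sum_least[OF U W(2) V(2)]])
  ultimately show ?thesis using W(4) by simp
qed

text \<open>The degenerate case of the Cauchy-Schwarz inequality: when \<open>q x x\<close>
  vanishes, the value at a multiple of \<open>x\<close> plus \<open>y\<close> is affine in the
  multiple, and a nonzero slope would violate semidefiniteness.\<close>

lemma semidefinite_null:
  fixes N :: "(complex^'m::finite) set"
  assumes q: "sesq q" and h: "herm_on N q" and N: "vec.subspace N"
    and nn: "\<And>x. x \<in> N \<Longrightarrow> Re (q x x) \<ge> 0"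
    and x: "x \<in> N" "Re (q x x) = 0" and y: "y \<in> N"
  shows "q x y = 0"
proof (rule ccontr)
  assume ne: "q x y \<noteq> 0"
  define c where "c = q x y"
  \<comment> \<open>This value makes the real part of \<open>q z z\<close> equal to -1.\<close>
  define t where "t = - (Re (q y y) + 1) / (2 * (cmod c)^2)"
  define z where "z = (of_real t * cnj c) *s x + y"
  have z: "z \<in> N" unfolding z_def using N x(1) y by (intro vec.subspace_add vec.subspace_scale)
  have "q x x = cnj (q x x)" using herm_onD[OF h x(1) x(1)] .
  then have q0: "q x x = 0" using x(2) by (simp add: complex_eq_iff)
  have yx: "q y x = cnj c" using herm_onD[OF h x(1) y] c_def by simp
  have cc: "cnj c * c = of_real ((cmod c)^2)" "c * cnj c = of_real ((cmod c)^2)"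
    using complex_norm_square[of c] by (simp_all add: mult.commute)
  have "q z z = of_real t * (cnj c * c) + of_real t * (c * cnj c) + q y y"
    unfolding z_def by (simp add: sesqD[OF q] q0 yx c_def[symmetric] algebra_simps)
  then have "q z z = of_real (2 * t * (cmod c)^2) + q y y" unfolding cc by simp
  then have "Re (q z z) = 2 * t * (cmod c)^2 + Re (q y y)" by simp
  moreover have "2 * t * (cmod c)^2 = - (Re (q y y) + 1)" using ne by (simp add: t_def c_def)
  ultimately show False using nn[OF z] by simp
qed

text \<open>Sylvester's law with the radical counted. For a positive definite \<open>W\<close> of
  maximal dimension, maximality makes the form nonpositive on \<open>perp q U W\<close>. There a
  null vector lies in the radical by \<open>semidefinite_null\<close>, so a complement of the
  radical is negative definite.\<close>

theorem inertia:
  fixes U :: "(complex^'m::finite) set"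
  assumes q: "sesq q" and h: "herm_on U q" and U: "vec.subspace U"
  shows "m_plus q U + m_plus (\<lambda>x y. - q x y) U + vec.dim (perp q U U) = vec.dim U"
proof -
  let ?R = "perp q U U"
  have R: "vec.subspace ?R" by (rule subspace_perp[OF q U])
  obtain W where W: "vec.subspace W" "W \<subseteq> U" "\<And>x. x \<in> W \<Longrightarrow> x \<noteq> 0 \<Longrightarrow> Re (q x x) > 0"
    "vec.dim W = m_plus q U"
    using m_plus_attained[OF U] by blast
  let ?N = "perp q U W"
  have N: "vec.subspace ?N" "?N \<subseteq> U" using subspace_perp[OF q U] perp_subset[of q U W] by auto
  have WN: "W \<inter> ?N \<subseteq> {0}" using W(3) unfolding perp_def by force
  have RN: "?R \<subseteq> ?N" using W(2) unfolding perp_def by auto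
  have WR: "W \<inter> ?R \<subseteq> {0}" using WN RN by blast
  then have "vec.dim (W \<inter> ?R) = 0" by simp
  then have dN: "vec.dim ?N + vec.dim W = vec.dim U"
    using dim_perp[OF q h U W(1,2)] by simp
  have npos: "Re (q x x) \<le> 0" if x: "x \<in> ?N" for x
  proof (rule ccontr)
    assume p: "\<not> Re (q x x) \<le> 0"
    then have x0: "x \<noteq> 0" using sesqD(5)[OF q, of 0] by auto
    let ?W = "subspace_sum W (vec.span {x})"
    have sx: "vec.subspace (vec.span {x})" "vec.span {x} \<subseteq> ?N"
      using vec.span_minimal[of "{x}" ?N] x N by auto
    have "vec.dim ?W = vec.dim W + 1"
      using dim_subspace_sum_direct[OF W(1) sx(1)] sx(2) WN x0 by auto
    moreover have "vec.dim ?W \<le> m_plus q U"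
    proof (rule m_plus_ge)
      show "vec.subspace ?W" by (rule subspace_subspace_sum[OF W(1) sx(1)])
      show "?W \<subseteq> U" using subspace_sum_least[OF U W(2)] sx(2) N(2) by blast
      fix z assume z: "z \<in> ?W" "z \<noteq> 0"
      then obtain w c where zw: "z = w + c *s x" "w \<in> W"
        unfolding subspace_sum_def by (auto simp: vec.span_singleton)
      have xw: "q x w = 0" using x zw(2) unfolding perp_def by auto
      have wx: "q w x = 0" by (rule perp_sym[OF h W(2) x zw(2)])
      have "q z z = q w w + (c * cnj c) * q x x"
        by (simp add: zw sesqD[OF q] xw wx)
      then have e: "Re (q z z) = Re (q w w) + (cmod c)^2 * Re (q x x)"
        by (simp add: complex_norm_square[symmetric])
      show "0 < Re (q z z)"
      proof (cases "w = 0")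
        case True
        then have "c \<noteq> 0" using z zw by auto
        then show ?thesis using e True p sesqD(5)[OF q] by simp
      next
        case False
        then show ?thesis using e W(3)[OF zw(2)] p by (simp add: add_pos_nonneg)
      qed
    qed
    ultimately show False using W(4) by simp
  qed
  obtain N' where N': "vec.subspace N'" "N' \<subseteq> ?N" "?R \<inter> N' = {0}" "vec.dim ?R + vec.dim N' = vec.dim ?N"
    "subspace_sum ?R N' = ?N"
    using complement_exists[OF N(1) R RN] by blast
  have "vec.dim N' \<le> m_plus (\<lambda>x y. - q x y) U"
  proof (rule m_plus_ge[OF N'(1)])
    show "N' \<subseteq> U" using N'(2) N(2) by blast
    fix x assume x: "x \<in> N'" "x \<noteq> 0"
    then have xN: "x \<in> ?N" using N'(2) by blast
    show "0 < Re (- q x x)"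
    proof (rule ccontr)
      assume "\<not> 0 < Re (- q x x)"
      then have 0: "Re (- q x x) = 0" using npos[OF xN] by simp
      have qy: "q x y = 0" if "y \<in> ?N" for y
        using semidefinite_null[OF sesq_uminus[OF q] herm_on_uminus[OF herm_on_subset[OF h N(2)]] N(1) _ xN 0 that]
          npos by auto
      have qw: "q x w = 0" if "w \<in> W" for w using xN that unfolding perp_def by auto
      have sum: "subspace_sum W ?N = U"
        using subspace_eqI_dim[OF subspace_subspace_sum[OF W(1) N(1)] U subspace_sum_least[OF U W(2) N(2)]]
          dim_subspace_sum_direct[OF W(1) N(1) WN] dN by simp
      have "q x u = 0" if u: "u \<in> U" for u
      proof -
        have "u \<in> subspace_sum W ?N" using u sum by simp
        then obtain w y where "u = w + y" "w \<in> W" "y \<in> ?N" unfolding subspace_sum_def by blast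
        then show ?thesis using qw qy sesqD(3)[OF q] by simp
      qed
      then have "x \<in> ?R" using xN N(2) unfolding perp_def by auto
      then show False using x N'(3) by blast
    qed
  qed
  \<comment> \<open>The form is nonnegative on \<open>W\<close> plus the radical, which gives the
    opposite bound for the negative index.\<close>
  moreover have "m_plus (\<lambda>x y. - q x y) U + vec.dim (subspace_sum W ?R) \<le> vec.dim U"
  proof (rule m_plus_uminus_le[OF U subspace_subspace_sum[OF W(1) R] subspace_sum_least[OF U W(2) perp_subset]])
    fix z assume "z \<in> subspace_sum W ?R"
    then obtain w r where zw: "z = w + r" "w \<in> W" "r \<in> ?R" unfolding subspace_sum_def by blast
    have "q r w = 0" "q r r = 0" using zw W(2) unfolding perp_def by auto
    moreover have "q w r = 0" using perp_sym[OF h W(2), of r w] zw RN by blast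
    ultimately have "q z z = q w w" by (simp add: zw sesqD[OF q])
    then show "0 \<le> Re (q z z)" using W(3)[OF zw(2)] sesqD(5)[OF q] by (cases "w = 0") auto
  qed
  moreover have "vec.dim (subspace_sum W ?R) = vec.dim W + vec.dim ?R"
    by (rule dim_subspace_sum_direct[OF W(1) R WR])
  ultimately show ?thesis using N'(4) dN W(4) by linarith
qed

text \<open>Vectors of \<open>W \<inter> perp q U W\<close> and of the radical pair to zero with all
  of \<open>perp q U W\<close>. Together with maximal positive subspaces of \<open>W\<close> and of
  \<open>perp q U W\<close> they span a nonnegative subspace. Its dimension bounds the negative
  index of \<open>U\<close>, and \<open>inertia\<close> turns this into a bound for the positive
  one.\<close>

lemma m_plus_perp_le:
  fixes U :: "(complex^'m::finite) set"
  assumes q: "sesq q" and h: "herm_on U q" and U: "vec.subspace U" and W: "vec.subspace W" "W \<subseteq> U"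
  shows "m_plus q W + m_plus q (perp q U W) + vec.dim (W \<inter> perp q U W)
    \<le> m_plus q U + vec.dim (W \<inter> perp q U U)"
proof -
  let ?R = "perp q U U" and ?V = "perp q U W"
  have R: "vec.subspace ?R" and V: "vec.subspace ?V" using subspace_perp[OF q U] by auto
  have RV: "?R \<subseteq> ?V" and VU: "?V \<subseteq> U" using W(2) unfolding perp_def by auto
  obtain A where A: "vec.subspace A" "A \<subseteq> W" "\<And>x. x \<in> A \<Longrightarrow> x \<noteq> 0 \<Longrightarrow> Re (q x x) > 0"
    "vec.dim A = m_plus q W"
    using m_plus_attained[OF W(1)] by blast
  obtain B where B: "vec.subspace B" "B \<subseteq> ?V" "\<And>x. x \<in> B \<Longrightarrow> x \<noteq> 0 \<Longrightarrow> Re (q x x) > 0"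
    "vec.dim B = m_plus q ?V"
    using m_plus_attained[OF V] by blast
  define Z where "Z = subspace_sum (W \<inter> ?V) ?R"
  have WV: "vec.subspace (W \<inter> ?V)" by (rule vec.subspace_inter[OF W(1) V])
  have Z: "vec.subspace Z" unfolding Z_def by (rule subspace_subspace_sum[OF WV R])
  have ZV: "Z \<subseteq> ?V" unfolding Z_def using subspace_sum_least[OF V] RV by auto
  have zero: "q v w = 0" "q w v = 0" if "w \<in> W" "v \<in> ?V" for v w
  proof -
    show "q v w = 0" by (rule perpD(2)[OF that(2,1)])
    show "q w v = 0" by (rule perp_sym[OF h W(2) that(2,1)])
  qed
  have Rz: "q r u = 0" "q u r = 0" if "u \<in> U" "r \<in> ?R" for r u
  proof -
    show "q r u = 0" by (rule perpD(2)[OF that(2,1)])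
    show "q u r = 0" by (rule perp_sym[OF h subset_refl that(2,1)])
  qed
  have Zz: "q z v = 0" "q v z = 0" if "z \<in> Z" "v \<in> ?V" for z v
  proof -
    obtain w r where z: "z = w + r" "w \<in> W" "w \<in> ?V" "r \<in> ?R"
      using \<open>z \<in> Z\<close> unfolding Z_def subspace_sum_def by blast
    note zs = zero[OF z(2) that(2)] Rz[OF perpD(1)[OF that(2)] z(4)]
    show "q z v = 0" "q v z = 0" by (simp_all add: z(1) sesqD(1,3)[OF q] zs)
  qed
  define S where "S = subspace_sum A (subspace_sum B Z)"
  have "B \<inter> Z \<subseteq> {0}" using B(3) B(2) Zz by force
  then have d1: "vec.dim (subspace_sum B Z) = vec.dim B + vec.dim Z"
    by (rule dim_subspace_sum_direct[OF B(1) Z])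
  have BZ: "vec.subspace (subspace_sum B Z)" "subspace_sum B Z \<subseteq> ?V"
    using subspace_subspace_sum[OF B(1) Z] subspace_sum_least[OF V B(2) ZV] by auto
  have "A \<inter> subspace_sum B Z \<subseteq> {0}"
  proof
    fix x assume x: "x \<in> A \<inter> subspace_sum B Z"
    then have "q x x = 0" using zero A(2) BZ(2) by blast
    then show "x \<in> {0}" using A(3) x by force
  qed
  then have d2: "vec.dim S = vec.dim A + (vec.dim B + vec.dim Z)"
    unfolding S_def using dim_subspace_sum_direct[OF A(1) BZ(1)] d1 by simp
  have "m_plus (\<lambda>x y. - q x y) U + vec.dim S \<le> vec.dim U"
  proof (rule m_plus_uminus_le[OF U])
    show "vec.subspace S" unfolding S_def by (rule subspace_subspace_sum[OF A(1) BZ(1)])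
    show "S \<subseteq> U" unfolding S_def using subspace_sum_least[OF U] A(2) W(2) BZ(2) VU by blast
    fix x assume "x \<in> S"
    then obtain a b z where x: "x = a + (b + z)" "a \<in> A" "b \<in> B" "z \<in> Z"
      unfolding S_def subspace_sum_def by blast
    have bz: "b \<in> ?V" "z \<in> ?V" "a \<in> W" using x B(2) ZV A(2) by auto
    have "q x x = q a a + q b b"
      using bz x(4) by (simp add: x(1) sesqD[OF q] zero Zz)
    then show "0 \<le> Re (q x x)"
      using A(3)[OF x(2)] B(3)[OF x(3)] sesqD(5)[OF q] by (cases "a = 0"; cases "b = 0"; force)
  qed
  moreover have "vec.dim Z + vec.dim (W \<inter> ?R) = vec.dim (W \<inter> ?V) + vec.dim ?R"
  proof -
    have "W \<inter> ?V \<inter> ?R = W \<inter> ?R" using RV by blast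
    then show ?thesis unfolding Z_def using dim_subspace_sum[OF WV R] by simp
  qed
  ultimately show ?thesis using inertia[OF q h U] d2 A(4) B(4) by linarith
qed

text \<open>The inequality \<open>m_plus_perp_le\<close> is used for the form and for its negative.
  By \<open>inertia\<close> and \<open>dim_perp\<close> their sum is an equality as soon as the
  radical of the form on \<open>perp q U W\<close> is no larger than the evident null vectors; hence
  each of the two is an equality.\<close>

theorem m_plus_perp:
  fixes U :: "(complex^'m::finite) set"
  assumes q: "sesq q" and h: "herm_on U q" and U: "vec.subspace U" and W: "vec.subspace W" "W \<subseteq> U"
  shows "m_plus q W + m_plus q (perp q U W) + vec.dim (W \<inter> perp q U W)
    = m_plus q U + vec.dim (W \<inter> perp q U U)"
proof -
  let ?R = "perp q U U" and ?V = "perp q U W" and ?m = "\<lambda>x y. - q x y"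
  have R: "vec.subspace ?R" and V: "vec.subspace ?V" using subspace_perp[OF q U] by auto
  have RV: "?R \<subseteq> ?V" and VU: "?V \<subseteq> U" using W(2) unfolding perp_def by auto
  have WV: "vec.subspace (W \<inter> ?V)" by (rule vec.subspace_inter[OF W(1) V])
  note 1 = m_plus_perp_le[OF q h U W]
  note 2 = m_plus_perp_le[OF sesq_uminus[OF q] herm_on_uminus[OF h] U W, unfolded perp_uminus]
  have 3: "m_plus q W + m_plus ?m W + vec.dim (W \<inter> ?V) = vec.dim W"
  proof -
    have "perp q W W = W \<inter> ?V" using W(2) unfolding perp_def by auto
    then show ?thesis using inertia[OF q herm_on_subset[OF h W(2)] W(1)] by simp
  qed
  note 4 = inertia[OF q herm_on_subset[OF h VU] V]
  \<comment> \<open>By a dimension count the double complement of \<open>W\<close> is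
    \<open>W\<close> plus the radical, and a radical vector of \<open>?V\<close> lies in it.\<close>
  have Z: "perp q ?V ?V \<subseteq> subspace_sum (W \<inter> ?V) ?R"
  proof
    fix x assume x: "x \<in> perp q ?V ?V"
    then have xV: "x \<in> ?V" unfolding perp_def by auto
    have s: "vec.subspace (subspace_sum W ?R)" by (rule subspace_subspace_sum[OF W(1) R])
    have "subspace_sum W ?R \<subseteq> perp q U ?V"
    proof (rule subspace_sum_least[OF subspace_perp[OF q U]])
      show "?R \<subseteq> perp q U ?V" using VU unfolding perp_def by auto
      show "W \<subseteq> perp q U ?V"
      proof
        fix w assume w: "w \<in> W"
        have "q w v = 0" if "v \<in> ?V" for v
          by (rule perp_sym[OF h W(2) that w])
        then show "w \<in> perp q U ?V" using w W(2) unfolding perp_def by auto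
      qed
    qed
    moreover have "vec.dim (perp q U ?V) \<le> vec.dim (subspace_sum W ?R)"
    proof -
      have "?V \<inter> ?R = ?R" using RV by blast
      then show ?thesis
        using dim_perp[OF q h U V VU] dim_perp[OF q h U W] dim_subspace_sum[OF W(1) R] by simp
    qed
    ultimately have "perp q U ?V = subspace_sum W ?R"
      using subspace_eqI_dim[OF s subspace_perp[OF q U]] by blast
    moreover have "x \<in> perp q U ?V" using x VU unfolding perp_def by auto
    ultimately obtain w r where wr: "x = w + r" "w \<in> W" "r \<in> ?R" unfolding subspace_sum_def by blast
    have "w = x - r" using wr by simp
    then have "w \<in> ?V" using vec.subspace_diff[OF V xV, of r] wr(3) RV by auto
    then show "x \<in> subspace_sum (W \<inter> ?V) ?R" using wr unfolding subspace_sum_def by blast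
  qed
  have "W \<inter> ?V \<inter> ?R = W \<inter> ?R" using RV by blast
  then have 5: "vec.dim (perp q ?V ?V) + vec.dim (W \<inter> ?R) \<le> vec.dim (W \<inter> ?V) + vec.dim ?R"
    using vec.dim_subset[OF Z] dim_subspace_sum[OF WV R] by simp
  show ?thesis
    using 1 2 3 4 5 inertia[OF q h U] dim_perp[OF q h U W] by linarith
qed

section \<open>Spectral flow of monotone families\<close>

lemma sesq_sum_left: "sesq q \<Longrightarrow> q (\<Sum>i\<in>I. f i) y = (\<Sum>i\<in>I. q (f i) y)"
  by (induction I rule: infinite_finite_induct) (auto simp: sesqD)

lemma sesq_sum_right: "sesq q \<Longrightarrow> q x (\<Sum>i\<in>I. f i) = (\<Sum>i\<in>I. q x (f i))"
  by (induction I rule: infinite_finite_induct) (auto simp: sesqD)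

lemma sesq_expand:
  fixes q :: "complex^'m::finite \<Rightarrow> complex^'m \<Rightarrow> complex"
  assumes q: "sesq q"
  shows "q a b = (\<Sum>i\<in>UNIV. \<Sum>j\<in>UNIV. a $ i * cnj (b $ j) * q (axis i 1) (axis j 1))"
proof -
  have "q a b = q (\<Sum>i\<in>UNIV. a $ i *s axis i 1) (\<Sum>j\<in>UNIV. b $ j *s axis j 1)"
    by (simp only: basis_expansion)
  also have "\<dots> = (\<Sum>i\<in>UNIV. \<Sum>j\<in>UNIV. q (a $ i *s axis i 1) (b $ j *s axis j 1))"
    by (subst sum.swap) (simp add: sesq_sum_left[OF q] sesq_sum_right[OF q])
  finally show ?thesis by (simp add: sesqD(2,4)[OF q] mult_ac)
qed

lemma sesq_bound_entries:
  fixes q :: "complex^'m::finite \<Rightarrow> complex^'m \<Rightarrow> complex"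
  assumes q: "sesq q" and e: "\<And>i j. cmod (q (axis i 1) (axis j 1)) \<le> e"
  shows "cmod (q a b) \<le> (e * real (CARD('m)) ^ 2) * norm a * norm b"
proof -
  have e0: "e \<ge> 0" using e[of undefined undefined] norm_ge_zero order_trans by blast
  have t: "cmod (a $ i * cnj (b $ j) * q (axis i 1) (axis j 1)) \<le> norm a * norm b * e" for i j
    unfolding norm_mult complex_mod_cnj
    by (intro mult_mono e Finite_Cartesian_Product.norm_nth_le mult_nonneg_nonneg) auto
  have "cmod (q a b) \<le> (\<Sum>i\<in>(UNIV::'m set). \<Sum>j\<in>(UNIV::'m set). norm a * norm b * e)"
    unfolding sesq_expand[OF q, of a b] by (intro order_trans[OF norm_sum] sum_mono t)
  then show ?thesis by (simp add: power2_eq_square mult_ac)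
qed

lemma sesq_bounded:
  fixes q :: "complex^'m::finite \<Rightarrow> complex^'m \<Rightarrow> complex"
  assumes q: "sesq q"
  shows "\<exists>C\<ge>0. \<forall>a b. cmod (q a b) \<le> C * norm a * norm b"
proof -
  define e where "e = (\<Sum>i\<in>UNIV. \<Sum>j\<in>UNIV. cmod (q (axis i 1) (axis j 1)))"
  have "cmod (q (axis i 1) (axis j 1)) \<le> e" for i j
  proof -
    have "cmod (q (axis i 1) (axis j 1)) \<le> (\<Sum>j\<in>UNIV. cmod (q (axis i 1) (axis j 1)))"
      by (rule member_le_sum) auto
    also have "\<dots> \<le> e" unfolding e_def
      by (rule member_le_sum[of i UNIV "\<lambda>i. \<Sum>j\<in>UNIV. cmod (q (axis i 1) (axis j 1))"])
         (auto intro: sum_nonneg)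
    finally show ?thesis .
  qed
  from sesq_bound_entries[OF q this] have "\<forall>a b. cmod (q a b) \<le> (e * real (CARD('m)) ^ 2) * norm a * norm b"
    by blast
  moreover have "e \<ge> 0" unfolding e_def by (intro sum_nonneg) auto
  ultimately show ?thesis by (intro exI[of _ "e * real (CARD('m)) ^ 2"]) auto
qed

lemma continuous_on_sesq:
  fixes q :: "complex^'m::finite \<Rightarrow> complex^'m \<Rightarrow> complex"
  assumes q: "sesq q" and "continuous_on S f" "continuous_on S g"
  shows "continuous_on S (\<lambda>x. q (f x) (g x))"
  by (subst sesq_expand[OF q]) (intro continuous_intros assms)

lemma scaleR_eq_vector_scalar: "r *\<^sub>R x = complex_of_real r *s (x :: complex^'m::finite)"
  by (simp add: vec_eq_iff complex_eq_iff)

lemma real_subspace_of_vec: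
  assumes "vec.subspace (W :: (complex^'m::finite) set)" shows "subspace W"
proof -
  have "r *\<^sub>R x \<in> W" if "x \<in> W" for r x
  proof -
    show ?thesis unfolding scaleR_eq_vector_scalar using vec.subspace_scale[OF assms that] .
  qed
  then show ?thesis
    using vec.subspace_0[OF assms] vec.subspace_add[OF assms] by (auto simp: subspace_def)
qed

text \<open>Compactness of the unit sphere of \<open>W\<close>. Without unit vectors
  \<open>W\<close> is trivial and any constant works.\<close>

lemma pos_def_bound:
  fixes q :: "complex^'m::finite \<Rightarrow> complex^'m \<Rightarrow> complex"
  assumes q: "sesq q" and W: "vec.subspace W" and pos: "\<And>x. x \<in> W \<Longrightarrow> x \<noteq> 0 \<Longrightarrow> Re (q x x) > 0"
  shows "\<exists>c>0. \<forall>x\<in>W. Re (q x x) \<ge> c * (norm x)^2"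
proof (cases "W \<inter> sphere 0 1 = {}")
  case True
  have "x = 0" if "x \<in> W" for x
  proof (rule ccontr)
    assume "x \<noteq> 0"
    then have "(1 / norm x) *\<^sub>R x \<in> W \<inter> sphere 0 1"
      using real_subspace_of_vec[OF W] that by (auto simp: subspace_scale)
    then show False using True by blast
  qed
  then have "1 * (norm x)^2 \<le> Re (q x x)" if "x \<in> W" for x
    using that sesqD(5)[OF q, of 0] by fastforce
  then show ?thesis using zero_less_one by blast
next
  case False
  have cpt: "compact (W \<inter> sphere 0 1)"
    using closed_subspace[OF real_subspace_of_vec[OF W]] by (intro closed_Int_compact) auto
  have cont: "continuous_on (W \<inter> sphere 0 1) (\<lambda>x. Re (q x x))"
    by (intro continuous_on_sesq[OF q] continuous_intros)
  obtain x0 where x0: "x0 \<in> W \<inter> sphere 0 1" "\<And>y. y \<in> W \<inter> sphere 0 1 \<Longrightarrow> Re (q x0 x0) \<le> Re (q y y)"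
    using continuous_attains_inf[OF cpt False cont] by blast
  have x0nz: "x0 \<noteq> 0" using x0(1) by auto
  have "Re (q x x) \<ge> Re (q x0 x0) * (norm x)^2" if x: "x \<in> W" for x
  proof (cases "x = 0")
    case True then show ?thesis by (simp add: sesqD[OF q])
  next
    case False
    define y where "y = complex_of_real (1 / norm x) *s x"
    have "y = (1 / norm x) *\<^sub>R x" by (simp only: y_def scaleR_eq_vector_scalar)
    then have "norm y = 1" using False by simp
    moreover have "y \<in> W" unfolding y_def by (rule vec.subspace_scale[OF W x])
    ultimately have "y \<in> W \<inter> sphere 0 1" by simp
    from x0(2)[OF this] have "Re (q x0 x0) \<le> Re (q y y)" .
    also have "q y y = complex_of_real ((1 / norm x)^2) * q x x"
      by (simp add: y_def sesqD[OF q] power2_eq_square)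
    finally have "Re (q x0 x0) \<le> Re (q x x) / (norm x)^2"
      by (simp add: power_divide)
    then show ?thesis using False by (simp add: field_simps)
  qed
  then show ?thesis using pos[of x0] x0(1) x0nz by blast
qed

text \<open>Here \<open>a\<close> and \<open>b\<close> are the norms of the components of a vector
  in a positive definite subspace and in the radical. Completing a square charges k/4 of the
  coefficient of b^2 for the mixed term, the error with e = k/8 charges another k/4, and k/2
  survives. What falls on a^2 is of order \<open>h\<close> and is absorbed by
  \<open>c\<close>.\<close>

lemma quadratic_perturbation:
  fixes a b h c C k e :: real
  assumes "0 < h" "0 < k" "0 \<le> C" "0 \<le> a" "0 \<le> b" "a > 0 \<or> b > 0" "e = k / 8"
    "h * (C + 4 * C^2 / k + k) < c"
  shows "c * a^2 + h * (k * b^2 - 2 * C * a * b - C * a^2) - e * h * (a + b)^2 > 0"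
proof -
  have 1: "(a + b)^2 \<le> 2 * a^2 + 2 * b^2"
    using zero_le_power2[of "a - b"] by (simp add: power2_eq_square algebra_simps)
  have 2: "2 * C * a * b \<le> k / 4 * b^2 + 4 * C^2 / k * a^2"
  proof -
    have "0 \<le> (k * b - 4 * C * a)^2 / (4 * k)" using assms by simp
    also have "\<dots> = k / 4 * b^2 - 2 * C * a * b + 4 * C^2 / k * a^2"
      using assms by (simp add: power2_eq_square field_simps)
    finally show ?thesis by simp
  qed
  have "e * h * (a + b)^2 \<le> e * h * (2 * a^2 + 2 * b^2)"
    using 1 assms by (intro mult_left_mono) auto
  moreover have "h * (2 * C * a * b) \<le> h * (k / 4 * b^2 + 4 * C^2 / k * a^2)"
    using 2 assms by (intro mult_left_mono) auto
  ultimately have lb: "c * a^2 + h * (k * b^2 - 2 * C * a * b - C * a^2) - e * h * (a + b)^2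
    \<ge> c * a^2 + h * (k * b^2 - C * a^2) - h * (k / 4 * b^2 + 4 * C^2 / k * a^2) - e * h * (2 * a^2 + 2 * b^2)"
    by (simp add: algebra_simps)
  have eq: "c * a^2 + h * (k * b^2 - C * a^2) - h * (k / 4 * b^2 + 4 * C^2 / k * a^2) - e * h * (2 * a^2 + 2 * b^2)
     = (c - h * (C + 4 * C^2 / k + k)) * a^2 + h * (3 * k / 4) * a^2 + h * k / 2 * b^2"
    unfolding assms(7) by (simp add: field_simps)
  have "(c - h * (C + 4 * C^2 / k + k)) * a^2 + h * (3 * k / 4) * a^2 + h * k / 2 * b^2 > 0"
  proof -
    have "(c - h * (C + 4 * C^2 / k + k)) * a^2 \<ge> 0" using assms by simp
    moreover have "h * (3 * k / 4) * a^2 + h * k / 2 * b^2 > 0"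
      using assms by (auto intro: add_pos_nonneg add_nonneg_pos)
    ultimately show ?thesis by linarith
  qed
  then show ?thesis using lb eq by linarith
qed

text \<open>A first-order expansion of \<open>q\<close> at \<open>q0\<close> with velocity
  \<open>q1\<close> and step \<open>h\<close>; the error is relative to \<open>h\<close> and uniform
  on unit vectors.\<close>

abbreviation near :: "real \<Rightarrow> real \<Rightarrow> (complex^'m::finite \<Rightarrow> complex^'m \<Rightarrow> complex) \<Rightarrow>
    (complex^'m \<Rightarrow> complex^'m \<Rightarrow> complex) \<Rightarrow> (complex^'m \<Rightarrow> complex^'m \<Rightarrow> complex) \<Rightarrow> bool" where
  "near e h q q0 q1 \<equiv> \<forall>a b. cmod (q a b - q0 a b - of_real h * q1 a b) \<le> e * h * norm a * norm b"

text \<open>Since \<open>q0\<close> vanishes between \<open>K\<close> and all of \<open>U\<close>,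
  the zero-order term controls the component in \<open>A\<close> and the first-order term the
  component in \<open>K\<close>; \<open>quadratic_perturbation\<close> handles the mixed terms. The
  thresholds depend on the expansion only and not on the perturbed form.\<close>

lemma pos_def_perturbation:
  fixes q0 q1 :: "complex^'m::finite \<Rightarrow> complex^'m \<Rightarrow> complex"
  assumes q0: "sesq q0" and h0: "herm_on U q0" and q1: "sesq q1"
    and A: "vec.subspace A" "A \<subseteq> U" "\<And>x. x \<in> A \<Longrightarrow> x \<noteq> 0 \<Longrightarrow> Re (q0 x x) > 0"
    and K: "vec.subspace K" "K \<subseteq> perp q0 U U" "\<And>x. x \<in> K \<Longrightarrow> x \<noteq> 0 \<Longrightarrow> Re (q1 x x) > 0"
  shows "\<exists>d>0. \<exists>e>0. \<forall>h q. 0 < h \<and> h < d \<and> near e h q q0 q1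
     \<longrightarrow> (\<forall>x \<in> subspace_sum A K. x \<noteq> 0 \<longrightarrow> Re (q x x) > 0)"
proof -
  obtain c where c: "c > 0" "\<And>x. x \<in> A \<Longrightarrow> Re (q0 x x) \<ge> c * (norm x)^2"
    using pos_def_bound[OF q0 A(1,3)] by blast
  obtain k where k: "k > 0" "\<And>x. x \<in> K \<Longrightarrow> Re (q1 x x) \<ge> k * (norm x)^2"
    using pos_def_bound[OF q1 K(1,3)] by blast
  obtain C where C: "C \<ge> 0" "\<And>a b. cmod (q1 a b) \<le> C * norm a * norm b"
    using sesq_bounded[OF q1] by blast
  define D where "D = C + 4 * C^2 / k + k"
  have D: "D > 0" unfolding D_def using C k by (intro add_nonneg_pos add_nonneg_nonneg) auto
  have main: "Re (q x x) > 0"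
    if h: "0 < h" "h < c / D" and close: "\<And>a b. cmod (q a b - q0 a b - of_real h * q1 a b) \<le> k / 8 * h * norm a * norm b"
      and x: "x \<in> subspace_sum A K" "x \<noteq> 0" for h q x
  proof -
    obtain u v where uv: "x = u + v" "u \<in> A" "v \<in> K" using x(1) unfolding subspace_sum_def by blast
    have vu: "q0 v u = 0" "q0 v v = 0" "q0 u v = 0"
      using uv A(2) K(2) perpD[of v q0 U U] perp_sym[OF h0 subset_refl, of v u] by blast+
    have "q0 x x = q0 u u" using vu by (simp add: uv(1) sesqD[OF q0])
    then have 1: "Re (q0 x x) \<ge> c * (norm u)^2" using c(2)[OF uv(2)] by simp
    have "q1 x x = q1 v v + q1 u v + q1 v u + q1 u u" by (simp add: uv(1) sesqD[OF q1])
    moreover have "Re (q1 u v) \<ge> - (C * norm u * norm v)" "Re (q1 v u) \<ge> - (C * norm u * norm v)"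
       "Re (q1 u u) \<ge> - (C * (norm u)^2)"
      using C(2)[of u v] C(2)[of v u] C(2)[of u u] abs_Re_le_cmod[of "q1 u v"] abs_Re_le_cmod[of "q1 v u"] abs_Re_le_cmod[of "q1 u u"]
      by (auto simp: power2_eq_square mult_ac)
    ultimately have 2: "Re (q1 x x) \<ge> k * (norm v)^2 - 2 * C * norm u * norm v - C * (norm u)^2"
      using k(2)[OF uv(3)] by simp
    have "- Re (q x x - q0 x x - of_real h * q1 x x) \<le> cmod (q x x - q0 x x - of_real h * q1 x x)"
      using abs_Re_le_cmod[of "q x x - q0 x x - of_real h * q1 x x"] by linarith
    also have "\<dots> \<le> k / 8 * h * (norm x)^2" using close[of x x] by (simp add: power2_eq_square mult_ac)
    also have "\<dots> \<le> k / 8 * h * (norm u + norm v)^2"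
      unfolding uv(1) using k h by (intro mult_left_mono power_mono norm_triangle_ineq) auto
    finally have "Re (q x x) \<ge> Re (q0 x x) + h * Re (q1 x x) - k / 8 * h * (norm u + norm v)^2" by simp
    moreover have "h * Re (q1 x x) \<ge> h * (k * (norm v)^2 - 2 * C * norm u * norm v - C * (norm u)^2)"
      using 2 h by (intro mult_left_mono) auto
    moreover have "c * (norm u)^2 + h * (k * (norm v)^2 - 2 * C * norm u * norm v - C * (norm u)^2) - k / 8 * h * (norm u + norm v)^2 > 0"
    proof (rule quadratic_perturbation[OF h(1) k(1) C(1)])
      show "0 < norm u \<or> 0 < norm v" using x(2) uv(1) by auto
      show "h * (C + 4 * C\<^sup>2 / k + k) < c" using h D unfolding D_def[symmetric] by (simp add: pos_less_divide_eq)
    qed auto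
    ultimately show ?thesis using 1 by linarith
  qed
  show ?thesis
    by (rule exI[of _ "c / D"]) (use c D k main in \<open>auto intro!: exI[of _ "k / 8"]\<close>)
qed

lemma sesq_diff: "sesq q \<Longrightarrow> sesq r \<Longrightarrow> sesq (\<lambda>x y. q x y - r x y)"
  unfolding sesq_def by (auto simp: algebra_simps)

lemma sesq_scale: "sesq q \<Longrightarrow> sesq (\<lambda>x y. c * q x y)"
  unfolding sesq_def by (auto simp: algebra_simps)

lemma subspace_sum_zero: "subspace_sum W {0} = W"
  unfolding subspace_sum_def by auto

text \<open>Positive directions persist and are joined by the radical, negative directions persist.
  These lower bounds for the two indices already add up to the dimension of \<open>U\<close>, so by
  \<open>inertia\<close> they are sharp and no radical remains.\<close>

lemma index_jump:
  fixes q0 q1 :: "complex^'m::finite \<Rightarrow> complex^'m \<Rightarrow> complex"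
  assumes U: "vec.subspace U" and q0: "sesq q0" and h0: "herm_on U q0" and q1: "sesq q1"
    and pos: "\<And>x. x \<in> perp q0 U U \<Longrightarrow> x \<noteq> 0 \<Longrightarrow> Re (q1 x x) > 0"
  shows "\<exists>d>0. \<exists>e>0. \<forall>h q. 0 < h \<and> h < d \<and> sesq q \<and> herm_on U q \<and>
     near e h q q0 q1
     \<longrightarrow> m_plus q U = m_plus q0 U + vec.dim (perp q0 U U) \<and>
         m_plus (\<lambda>x y. - q x y) U = m_plus (\<lambda>x y. - q0 x y) U \<and> perp q U U = {0}"
proof -
  let ?K = "perp q0 U U"
  have K: "vec.subspace ?K" by (rule subspace_perp[OF q0 U])
  obtain A where A: "vec.subspace A" "A \<subseteq> U" "\<And>x. x \<in> A \<Longrightarrow> x \<noteq> 0 \<Longrightarrow> Re (q0 x x) > 0" "vec.dim A = m_plus q0 U"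
    using m_plus_attained[OF U, of q0] by blast
  obtain B where B: "vec.subspace B" "B \<subseteq> U" "\<And>x. x \<in> B \<Longrightarrow> x \<noteq> 0 \<Longrightarrow> Re (- q0 x x) > 0"
    "vec.dim B = m_plus (\<lambda>x y. - q0 x y) U"
    using m_plus_attained[OF U, of "\<lambda>x y. - q0 x y"] by blast
  obtain d1 e1 where 1: "d1 > 0" "e1 > 0" "\<forall>h q. 0 < h \<and> h < d1 \<and> near e1 h q q0 q1
     \<longrightarrow> (\<forall>x \<in> subspace_sum A ?K. x \<noteq> 0 \<longrightarrow> Re (q x x) > 0)"
    using pos_def_perturbation[OF q0 h0 q1 A(1-3) K subset_refl pos] by blast
  \<comment> \<open>For the negative index the second subspace is trivial: no radical direction
    turns negative.\<close>
  have z: "vec.subspace ({0} :: (complex^'m) set)" "({0} :: (complex^'m) set) \<subseteq> perp (\<lambda>x y. - q0 x y) U U"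
    using vec.subspace_0[OF K] by (auto simp: perp_uminus)
  have z0: "Re (- q1 x x) > 0" if "x \<in> {0}" "x \<noteq> 0" for x using that by simp
  obtain d2 e2 where 2: "d2 > 0" "e2 > 0" "\<forall>h q. 0 < h \<and> h < d2 \<and> near e2 h q (\<lambda>a b. - q0 a b) (\<lambda>a b. - q1 a b)
     \<longrightarrow> (\<forall>x \<in> B. x \<noteq> 0 \<longrightarrow> Re (q x x) > 0)"
    using pos_def_perturbation[OF sesq_uminus[OF q0] herm_on_uminus[OF h0] sesq_uminus[OF q1] B(1-3) z z0]
    unfolding subspace_sum_zero by blast
  have main: "m_plus q U = m_plus q0 U + vec.dim ?K \<and> m_plus (\<lambda>x y. - q x y) U = m_plus (\<lambda>x y. - q0 x y) U \<and> perp q U U = {0}"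
    if h: "0 < h" "h < min d1 d2" and q: "sesq q" and hq: "herm_on U q"
      and close: "near (min e1 e2) h q q0 q1" for h q
  proof -
    have le: "min e1 e2 * h * norm a * norm b \<le> e1 * h * norm a * norm b"
      "min e1 e2 * h * norm a * norm b \<le> e2 * h * norm a * norm b" for a b :: "complex^'m"
      using h by (auto intro!: mult_right_mono)
    have c1: "near e1 h q q0 q1"
      using close le(1) by (meson order_trans)
    have c2: "near e2 h (\<lambda>a b. - q a b) (\<lambda>a b. - q0 a b) (\<lambda>a b. - q1 a b)"
    proof (intro allI)
      fix a b
      have "- q a b - - q0 a b - of_real h * - q1 a b = - (q a b - q0 a b - of_real h * q1 a b)" by simp
      then have "cmod (- q a b - - q0 a b - of_real h * - q1 a b) = cmod (q a b - q0 a b - of_real h * q1 a b)"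
        by (metis norm_minus_cancel)
      then show "cmod (- q a b - - q0 a b - of_real h * - q1 a b) \<le> e2 * h * norm a * norm b"
        using close[rule_format, of a b] le(2)[of a b] by linarith
    qed
    have "A \<inter> ?K \<subseteq> {0}"
    proof
      fix x assume x: "x \<in> A \<inter> ?K"
      then have "q0 x x = 0" using perpD[of x q0 U U] by blast
      then show "x \<in> {0}" using A(3)[of x] x by auto
    qed
    then have dAK: "vec.dim (subspace_sum A ?K) = vec.dim A + vec.dim ?K"
      by (rule dim_subspace_sum_direct[OF A(1) K])
    have a: "vec.dim (subspace_sum A ?K) \<le> m_plus q U"
      using 1(3)[rule_format, of h q] c1 h
      by (intro m_plus_ge subspace_subspace_sum[OF A(1) K] subspace_sum_least[OF U A(2) perp_subset]) auto
    have b: "vec.dim B \<le> m_plus (\<lambda>x y. - q x y) U"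
      using 2(3)[rule_format, of h "\<lambda>a b. - q a b"] c2 h by (intro m_plus_ge B(1,2)) auto
    have s: "vec.dim (perp q U U) = 0 \<and> m_plus q U = m_plus q0 U + vec.dim ?K \<and> m_plus (\<lambda>x y. - q x y) U = m_plus (\<lambda>x y. - q0 x y) U"
      using inertia[OF q hq U] inertia[OF q0 h0 U] a b dAK A(4) B(4) by linarith
    then have "perp q U U = {0}" using vec.subspace_0[OF subspace_perp[OF q U, of U]] by auto
    then show ?thesis using s by blast
  qed
  have p: "min d1 d2 > 0" "min e1 e2 > 0" using 1(1,2) 2(1,2) by simp_all
  show ?thesis
    by (rule exI, rule conjI[OF p(1)], rule exI, rule conjI[OF p(2)], intro allI impI, elim conjE) (rule main)
qed

text \<open>Differentiability is known for each pair of arguments separately. The finitely many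
  pairs of axis vectors make it uniform, because the entries bound a sesquilinear form.\<close>

lemma sesq_derivative_uniform:
  fixes q :: "real \<Rightarrow> complex^'m::finite \<Rightarrow> complex^'m \<Rightarrow> complex"
  assumes q: "\<And>s. s \<in> S \<Longrightarrow> sesq (q s)" and q': "sesq q'" and s0: "s0 \<in> S"
    and der: "\<And>a b. ((\<lambda>s. q s a b) has_vector_derivative q' a b) (at s0 within S)"
    and e: "e > 0"
  shows "\<exists>d>0. \<forall>s\<in>S. \<bar>s - s0\<bar> < d \<longrightarrow> (\<forall>a b. cmod (q s a b - q s0 a b - of_real (s - s0) * q' a b) \<le> e * \<bar>s - s0\<bar> * norm a * norm b)"
proof -
  define e' where "e' = e / real (CARD('m)) ^ 2"
  have e': "e' > 0" unfolding e'_def using e by simp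
  have "\<forall>i j. \<exists>d>0. \<forall>s\<in>S. \<bar>s - s0\<bar> < d \<longrightarrow> cmod (q s (axis i 1) (axis j 1) - q s0 (axis i 1) (axis j 1) - of_real (s - s0) * q' (axis i 1) (axis j 1)) \<le> e' * \<bar>s - s0\<bar>"
    using der e' unfolding has_vector_derivative_def has_derivative_within_alt
    by (simp add: scaleR_conv_of_real)
  then obtain d where d: "\<And>i j. d i j > 0" "\<And>i j s. s \<in> S \<Longrightarrow> \<bar>s - s0\<bar> < d i j \<Longrightarrow>
      cmod (q s (axis i 1) (axis j 1) - q s0 (axis i 1) (axis j 1) - of_real (s - s0) * q' (axis i 1) (axis j 1)) \<le> e' * \<bar>s - s0\<bar>"
    by metis
  define D where "D = Min (range (\<lambda>(i, j). d i j))"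
  have D: "D > 0" unfolding D_def using d(1) by (subst Min_gr_iff) auto
  have Dle: "D \<le> d i j" for i j unfolding D_def by (intro Min_le) auto
  have "cmod (q s a b - q s0 a b - of_real (s - s0) * q' a b) \<le> e * \<bar>s - s0\<bar> * norm a * norm b"
    if s: "s \<in> S" "\<bar>s - s0\<bar> < D" for s a b
  proof -
    have sq: "sesq (\<lambda>a b. q s a b - q s0 a b - of_real (s - s0) * q' a b)"
      by (intro sesq_diff sesq_scale q q' s s0)
    have "cmod (q s a b - q s0 a b - of_real (s - s0) * q' a b) \<le> (e' * \<bar>s - s0\<bar> * real (CARD('m)) ^ 2) * norm a * norm b"
    proof (rule sesq_bound_entries[OF sq])
      fix i j
      have "\<bar>s - s0\<bar> < d i j" using s(2) Dle[of i j] by linarith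
      then show "cmod (q s (axis i 1) (axis j 1) - q s0 (axis i 1) (axis j 1) - of_real (s - s0) * q' (axis i 1) (axis j 1)) \<le> e' * \<bar>s - s0\<bar>"
        using d(2) s(1) by blast
    qed
    then show ?thesis by (simp add: e'_def)
  qed
  then show ?thesis using D by blast
qed

text \<open>To the right of \<open>s0\<close> this is \<open>index_jump\<close>. To the left it is
  applied to the negated forms with step h = s0 - s: their velocity is again \<open>q'\<close>,
  which is positive on the radical, so that the radical joins the negative directions of
  \<open>q s\<close> and the positive index keeps its value.\<close>

theorem crossing_local:
  fixes q :: "real \<Rightarrow> complex^'m::finite \<Rightarrow> complex^'m \<Rightarrow> complex"
  assumes U: "vec.subspace U" and q: "\<And>s. s \<in> S \<Longrightarrow> sesq (q s)" and hq: "\<And>s. s \<in> S \<Longrightarrow> herm_on U (q s)"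
    and q': "sesq q'" and s0: "s0 \<in> S"
    and der: "\<And>a b. ((\<lambda>s. q s a b) has_vector_derivative q' a b) (at s0 within S)"
    and pos: "\<And>x. x \<in> perp (q s0) U U \<Longrightarrow> x \<noteq> 0 \<Longrightarrow> Re (q' x x) > 0"
  shows "\<exists>d>0. \<forall>s\<in>S. \<bar>s - s0\<bar> < d \<longrightarrow>
     (s0 < s \<longrightarrow> m_plus (q s) U = m_plus (q s0) U + vec.dim (perp (q s0) U U) \<and> perp (q s) U U = {0}) \<and>
     (s < s0 \<longrightarrow> m_plus (q s) U = m_plus (q s0) U \<and> perp (q s) U U = {0})"
proof -
  obtain d1 e1 where 1: "d1 > 0" "e1 > 0" "\<forall>h r. 0 < h \<and> h < d1 \<and> sesq r \<and> herm_on U r \<and>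
     near e1 h r (q s0) q' \<longrightarrow>
     m_plus r U = m_plus (q s0) U + vec.dim (perp (q s0) U U) \<and>
     m_plus (\<lambda>x y. - r x y) U = m_plus (\<lambda>x y. - q s0 x y) U \<and> perp r U U = {0}"
    using index_jump[OF U q[OF s0] hq[OF s0] q' pos] by blast
  let ?n = "\<lambda>x y. - q s0 x y"
  have pn: "Re (q' x x) > 0" if "x \<in> perp ?n U U" "x \<noteq> 0" for x
    using pos that by (simp add: perp_uminus)
  obtain d2 e2 where 2: "d2 > 0" "e2 > 0" "\<forall>h r. 0 < h \<and> h < d2 \<and> sesq r \<and> herm_on U r \<and>
     near e2 h r (\<lambda>a b. - q s0 a b) q' \<longrightarrow>
     m_plus r U = m_plus ?n U + vec.dim (perp ?n U U) \<and>
     m_plus (\<lambda>x y. - r x y) U = m_plus (\<lambda>x y. - (- q s0 x y)) U \<and> perp r U U = {0}"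
    using index_jump[OF U sesq_uminus[OF q[OF s0]] herm_on_uminus[OF hq[OF s0]] q' pn] by blast
  obtain d3 where d3: "d3 > 0" "\<And>s a b. s \<in> S \<Longrightarrow> \<bar>s - s0\<bar> < d3 \<Longrightarrow> cmod (q s a b - q s0 a b - of_real (s - s0) * q' a b) \<le> min e1 e2 * \<bar>s - s0\<bar> * norm a * norm b"
    using sesq_derivative_uniform[OF q q' s0 der, of "min e1 e2"] 1(2) 2(2) by auto
  have le: "min e1 e2 * h * norm a * norm b \<le> e1 * h * norm a * norm b"
      "min e1 e2 * h * norm a * norm b \<le> e2 * h * norm a * norm b" if "h \<ge> 0" for a b :: "complex^'m" and h
    using that by (auto intro!: mult_right_mono)
  have right: "m_plus (q s) U = m_plus (q s0) U + vec.dim (perp (q s0) U U) \<and> perp (q s) U U = {0}"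
    if s: "s \<in> S" "\<bar>s - s0\<bar> < min d3 (min d1 d2)" "s0 < s" for s
  proof -
    have "near e1 (s - s0) (q s) (q s0) q'"
    proof (intro allI)
      fix a b
      have "cmod (q s a b - q s0 a b - of_real (s - s0) * q' a b) \<le> min e1 e2 * (s - s0) * norm a * norm b"
        using d3(2)[OF s(1), of a b] s by simp
      then show "cmod (q s a b - q s0 a b - of_real (s - s0) * q' a b) \<le> e1 * (s - s0) * norm a * norm b"
        using le(1)[of "s - s0" a b] s(3) by linarith
    qed
    then show ?thesis using 1(3)[rule_format, of "s - s0" "q s"] s q hq by auto
  qed
  have left: "m_plus (q s) U = m_plus (q s0) U \<and> perp (q s) U U = {0}"
    if s: "s \<in> S" "\<bar>s - s0\<bar> < min d3 (min d1 d2)" "s < s0" for s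
  proof -
    have "m_plus (\<lambda>x y. - (- q s x y)) U = m_plus (\<lambda>x y. - (- q s0 x y)) U \<and> perp (\<lambda>x y. - q s x y) U U = {0}"
    proof -
      have "near e2 (s0 - s) (\<lambda>a b. - q s a b) (\<lambda>a b. - q s0 a b) q'"
      proof (intro allI)
        fix a b
        have "- q s a b - - q s0 a b - of_real (s0 - s) * q' a b = - (q s a b - q s0 a b - of_real (s - s0) * q' a b)"
          by (simp add: algebra_simps)
        then have "cmod (- q s a b - - q s0 a b - of_real (s0 - s) * q' a b) = cmod (q s a b - q s0 a b - of_real (s - s0) * q' a b)"
          by (metis norm_minus_cancel)
        also have "\<dots> \<le> min e1 e2 * (s0 - s) * norm a * norm b"
          using d3(2)[OF s(1), of a b] s by simp
        finally show "cmod (- q s a b - - q s0 a b - of_real (s0 - s) * q' a b) \<le> e2 * (s0 - s) * norm a * norm b"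
          using le(2)[of "s0 - s" a b] s(3) by linarith
      qed
      then show ?thesis
        using 2(3)[rule_format, of "s0 - s" "\<lambda>x y. - q s x y"] s sesq_uminus[OF q[OF s(1)]] herm_on_uminus[OF hq[OF s(1)]] by auto
    qed
    then show ?thesis by (simp add: perp_uminus)
  qed
  show ?thesis
    by (rule exI[of _ "min d3 (min d1 d2)"]) (use 1(1) 2(1) d3(1) left right in auto)
qed

text \<open>Near \<open>x\<close> only \<open>\<nu> x\<close> can be nonzero and \<open>f\<close>
  jumps just after \<open>x\<close>; bisection in the form of \<open>Bolzano\<close> patches the
  local statements. The half-open range of summation makes the formula additive under concatenation
  of intervals.\<close>

lemma jump_sum:
  fixes f \<nu> :: "real \<Rightarrow> nat"
  assumes "a \<le> b"
    and loc: "\<And>x. x \<in> {a..b} \<Longrightarrow> \<exists>d>0. \<forall>s\<in>{a..b}. \<bar>s - x\<bar> < d \<longrightarrow>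
      (x < s \<longrightarrow> f s = f x + \<nu> x \<and> \<nu> s = 0) \<and> (s < x \<longrightarrow> f s = f x \<and> \<nu> s = 0)"
  shows "finite {s\<in>{a..b}. \<nu> s \<noteq> 0} \<and> f b = f a + (\<Sum>s | a \<le> s \<and> s < b \<and> \<nu> s \<noteq> 0. \<nu> s)"
proof -
  define P where "P u v \<longleftrightarrow> (a \<le> u \<and> v \<le> b \<longrightarrow> finite {s\<in>{u..v}. \<nu> s \<noteq> 0} \<and> f v = f u + (\<Sum>s | u \<le> s \<and> s < v \<and> \<nu> s \<noteq> 0. \<nu> s))" for u v
  have "P a b"
  proof (induction rule: Bolzano[OF assms(1)])
    case (1 u v w)
    show ?case unfolding P_def
    proof (intro impI)
      assume r: "a \<le> u \<and> w \<le> b"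
      have uv: "finite {s\<in>{u..v}. \<nu> s \<noteq> 0}" "f v = f u + (\<Sum>s | u \<le> s \<and> s < v \<and> \<nu> s \<noteq> 0. \<nu> s)"
        and vw: "finite {s\<in>{v..w}. \<nu> s \<noteq> 0}" "f w = f v + (\<Sum>s | v \<le> s \<and> s < w \<and> \<nu> s \<noteq> 0. \<nu> s)"
        using 1 r unfolding P_def by auto
      have "{s\<in>{u..w}. \<nu> s \<noteq> 0} \<subseteq> {s\<in>{u..v}. \<nu> s \<noteq> 0} \<union> {s\<in>{v..w}. \<nu> s \<noteq> 0}" by auto
      then have "finite {s\<in>{u..w}. \<nu> s \<noteq> 0}" using uv(1) vw(1) finite_subset by blast
      moreover have "{s. u \<le> s \<and> s < w \<and> \<nu> s \<noteq> 0} = {s. u \<le> s \<and> s < v \<and> \<nu> s \<noteq> 0} \<union> {s. v \<le> s \<and> s < w \<and> \<nu> s \<noteq> 0}"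
        using 1(3,4) by auto
      moreover have "finite {s. u \<le> s \<and> s < v \<and> \<nu> s \<noteq> 0}" "finite {s. v \<le> s \<and> s < w \<and> \<nu> s \<noteq> 0}"
        by (rule finite_subset[OF _ uv(1)], force) (rule finite_subset[OF _ vw(1)], force)
      ultimately show "finite {s\<in>{u..w}. \<nu> s \<noteq> 0} \<and> f w = f u + (\<Sum>s | u \<le> s \<and> s < w \<and> \<nu> s \<noteq> 0. \<nu> s)"
        using uv(2) vw(2) by (simp add: sum.union_disjoint disjoint_iff)
    qed
  next
    case (2 x)
    obtain d where d: "d > 0" "\<And>s. s \<in> {a..b} \<Longrightarrow> \<bar>s - x\<bar> < d \<Longrightarrow>
      (x < s \<longrightarrow> f s = f x + \<nu> x \<and> \<nu> s = 0) \<and> (s < x \<longrightarrow> f s = f x \<and> \<nu> s = 0)"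
      using loc[of x] 2 by auto
    have "P u v" if uv: "u \<le> x" "x \<le> v" "v - u < d" for u v
      unfolding P_def
    proof (intro impI)
      assume r: "a \<le> u \<and> v \<le> b"
      have z: "\<nu> s = 0" if "s \<in> {u..v}" "s \<noteq> x" for s
        using d(2)[of s] that uv r by (cases "s < x") auto
      have "{s\<in>{u..v}. \<nu> s \<noteq> 0} \<subseteq> {x}" using z by fastforce
      then have fin: "finite {s\<in>{u..v}. \<nu> s \<noteq> 0}" by (rule finite_subset) simp
      have fu: "f u = f x" using d(2)[of u] uv r by (cases "u = x") auto
      have "f v = f u + (\<Sum>s | u \<le> s \<and> s < v \<and> \<nu> s \<noteq> 0. \<nu> s)"
      proof (cases "x = v")
        case True
        then have "{s. u \<le> s \<and> s < v \<and> \<nu> s \<noteq> 0} = {}" using z by force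
        then show ?thesis using fu True by (metis (mono_tags) sum.empty add_0_right)
      next
        case False
        then have fv: "f v = f x + \<nu> x" using d(2)[of v] uv r by auto
        show ?thesis
        proof (cases "\<nu> x = 0")
          case True
          then have "{s. u \<le> s \<and> s < v \<and> \<nu> s \<noteq> 0} = {}" using z by force
          then show ?thesis using fu fv True by (metis (mono_tags) sum.empty add_0_right)
        next
          case nz: False
          then have "{s. u \<le> s \<and> s < v \<and> \<nu> s \<noteq> 0} = {x}" using z uv False by force
          then show ?thesis using fu fv by simp
        qed
      qed
      then show "finite {s\<in>{u..v}. \<nu> s \<noteq> 0} \<and> f v = f u + (\<Sum>s | u \<le> s \<and> s < v \<and> \<nu> s \<noteq> 0. \<nu> s)"
        using fin by blast
    qed
    then show ?case using d(1) by blast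
  qed
  then show ?thesis unfolding P_def by simp
qed

text \<open>This is \<open>index_jump\<close> with velocity 0, whose positivity on a trivial radical
  is vacuous.\<close>

lemma index_stable:
  fixes q :: "'b \<Rightarrow> complex^'m::finite \<Rightarrow> complex^'m \<Rightarrow> complex"
  assumes U: "vec.subspace U" and q0: "sesq q0" and h0: "herm_on U q0" and nd: "perp q0 U U = {0}"
    and q: "\<And>s. sesq (q s)" "\<And>s. herm_on U (q s)"
    and lim: "\<And>a b. ((\<lambda>s. q s a b) \<longlongrightarrow> q0 a b) F"
  shows "\<forall>\<^sub>F s in F. m_plus (q s) U = m_plus q0 U \<and> perp (q s) U U = {0}"
proof -
  have z: "sesq (\<lambda>(a::complex^'m) (b::complex^'m). 0)" unfolding sesq_def by simp
  obtain d e where de: "d > 0" "e > 0" "\<forall>h r. 0 < h \<and> h < d \<and> sesq r \<and> herm_on U r \<and>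
     near e h r q0 (\<lambda>a b. 0) \<longrightarrow>
     m_plus r U = m_plus q0 U + vec.dim (perp q0 U U) \<and>
     m_plus (\<lambda>x y. - r x y) U = m_plus (\<lambda>x y. - q0 x y) U \<and> perp r U U = {0}"
  proof -
    have "\<exists>d>0. \<exists>e>0. \<forall>h r. 0 < h \<and> h < d \<and> sesq r \<and> herm_on U r \<and>
     near e h r q0 (\<lambda>a b. 0) \<longrightarrow>
     m_plus r U = m_plus q0 U + vec.dim (perp q0 U U) \<and>
     m_plus (\<lambda>x y. - r x y) U = m_plus (\<lambda>x y. - q0 x y) U \<and> perp r U U = {0}"
      by (rule index_jump[OF U q0 h0 z]) (use nd in auto)
    then show thesis using that by blast
  qed
  \<comment> \<open>With zero velocity the step is a mere scale for the error, and any value in the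
    admissible range serves.\<close>
  define h where "h = d / 2"
  define e' where "e' = e * h / real (CARD('m)) ^ 2"
  have h: "0 < h" "h < d" using de by (auto simp: h_def)
  have e': "e' > 0" using de h by (auto simp: e'_def)
  have "\<forall>\<^sub>F s in F. \<forall>i j. dist (q s (axis i 1) (axis j 1)) (q0 (axis i 1) (axis j 1)) < e'"
    unfolding eventually_all_finite by (intro eventually_all_finite allI tendstoD[OF lim e'])
  then show ?thesis
  proof (rule eventually_mono)
    fix s assume s: "\<forall>i j. dist (q s (axis i 1) (axis j 1)) (q0 (axis i 1) (axis j 1)) < e'"
    have "near e h (q s) q0 (\<lambda>a b. 0)"
    proof (intro allI)
      fix a b
      have "cmod (q s a b - q0 a b) \<le> (e' * real (CARD('m)) ^ 2) * norm a * norm b"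
        using s by (intro sesq_bound_entries sesq_diff q q0) (auto simp: dist_norm less_imp_le)
      then show "cmod (q s a b - q0 a b - of_real h * 0) \<le> e * h * norm a * norm b"
        by (simp add: e'_def)
    qed
    then show "m_plus (q s) U = m_plus q0 U \<and> perp (q s) U U = {0}"
      using de(3)[rule_format, of h "q s"] h q nd by simp
  qed
qed

section \<open>Linear images and pairs\<close>

abbreviation vlin :: "(complex^'a::finite \<Rightarrow> complex^'b::finite) \<Rightarrow> bool" where
  "vlin f \<equiv> Vector_Spaces.linear (*s) (*s) f"

lemma vlin_iff: "vlin f \<longleftrightarrow> (\<forall>x y. f (x + y) = f x + f y) \<and> (\<forall>c x. f (c *s x) = c *s f x)"
  by (simp add: Vector_Spaces.linear_iff vec.vector_space_axioms)

lemma vlinD: assumes "vlin f"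
  shows "f (x + y) = f x + f y" "f (c *s x) = c *s f x" "f 0 = 0" "f (x - y) = f x - f y"
  using assms vlin_iff[of f] vec.linear_0[OF assms] vec.linear_diff[OF assms] by auto

lemma vlin_compose: "vlin f \<Longrightarrow> vlin g \<Longrightarrow> vlin (\<lambda>x. f (g x))"
  by (simp add: vlin_iff)

lemma vlin_matrix: "vlin ((*v) M)"
  by (rule matrix_vector_mul_linear_gen)

lemma sesq_compose: "sesq q \<Longrightarrow> vlin f \<Longrightarrow> vlin g \<Longrightarrow> sesq (\<lambda>x y. q (f x) (g y))"
  unfolding sesq_def vlin_iff by simp

lemma subspace_vlin_image: "vlin f \<Longrightarrow> vec.subspace S \<Longrightarrow> vec.subspace (f ` S)"
  by (rule vec.linear_subspace_image)

lemma dim_image_inj: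
  fixes f :: "complex^'a::finite \<Rightarrow> complex^'b::finite"
  assumes f: "vlin f" and S: "vec.subspace S" and inj: "\<And>x. x \<in> S \<Longrightarrow> f x = 0 \<Longrightarrow> x = 0"
  shows "vec.dim (f ` S) = vec.dim S"
proof (rule vec.dim_image_eq[OF f])
  have sS: "vec.span S = S" using S by (simp add: vec.span_eq_iff)
  show "inj_on f (vec.span S)" unfolding sS
  proof (rule inj_onI)
    fix x y assume "x \<in> S" "y \<in> S" "f x = f y"
    then show "x = y" using inj[of "x - y"] vec.subspace_diff[OF S] vlinD(4)[OF f, of x y] by simp
  qed
qed

lemma herm_on_diff: "herm_on U p \<Longrightarrow> herm_on U r \<Longrightarrow> herm_on U (\<lambda>x y. p x y - r x y)"
  unfolding herm_on_def by (metis complex_cnj_diff)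

text \<open>The map may have a kernel and only diagonal values are compared. The form of the triple
  index requires this generality: it is a definite description on decompositions and is evaluated on
  the diagonal only. The condition at 0 keeps kernel vectors from counting as positive.\<close>

lemma m_plus_image:
  fixes f :: "complex^'a::finite \<Rightarrow> complex^'b::finite"
  assumes f: "vlin f" and S: "vec.subspace S"
    and qg: "\<And>x. x \<in> S \<Longrightarrow> Re (q (f x) (f x)) = Re (g x x)" and q0: "Re (q 0 0) \<le> 0"
  shows "m_plus q (f ` S) = m_plus g S"
proof (rule antisym)
  obtain W where W: "vec.subspace W" "W \<subseteq> f ` S" "\<And>x. x \<in> W \<Longrightarrow> x \<noteq> 0 \<Longrightarrow> Re (q x x) > 0"
    "vec.dim W = m_plus q (f ` S)"
    using m_plus_attained[OF subspace_vlin_image[OF f S], of q] by blast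
  define S' where "S' = {x\<in>S. f x \<in> W}"
  define N where "N = {x\<in>S'. f x = 0}"
  have S': "vec.subspace S'" using S W(1) unfolding S'_def vec.subspace_def by (auto simp: vlinD[OF f])
  have N: "vec.subspace N" "N \<subseteq> S'" using S' unfolding N_def vec.subspace_def by (auto simp: vlinD[OF f])
  \<comment> \<open>A complement of the kernel inside the preimage of \<open>W\<close>; it is
    carried isomorphically onto \<open>W\<close>.\<close>
  obtain C where C: "vec.subspace C" "C \<subseteq> S'" "N \<inter> C = {0}" "subspace_sum N C = S'"
    using complement_exists[OF S' N] by blast
  have inj: "x = 0" if "x \<in> C" "f x = 0" for x
    using that C(2,3) unfolding N_def by blast
  have "f ` C = W"
  proof
    show "f ` C \<subseteq> W" using C(2) unfolding S'_def by auto
    show "W \<subseteq> f ` C"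
    proof
      fix w assume w: "w \<in> W"
      then obtain x where x: "x \<in> S" "w = f x" using W(2) by blast
      then have "x \<in> subspace_sum N C" unfolding C(4) S'_def using w by simp
      then obtain a c where "x = a + c" "a \<in> N" "c \<in> C" unfolding subspace_sum_def by blast
      then have "w = f c" using x(2) vlinD(1)[OF f] unfolding N_def by simp
      then show "w \<in> f ` C" using \<open>c \<in> C\<close> by blast
    qed
  qed
  then have "vec.dim W = vec.dim C" using dim_image_inj[OF f C(1) inj] by simp
  moreover have "vec.dim C \<le> m_plus g S"
  proof (rule m_plus_ge[OF C(1)])
    show "C \<subseteq> S" using C(2) unfolding S'_def by auto
    fix x assume x: "x \<in> C" "x \<noteq> 0"
    have "f x \<in> W" "x \<in> S" using x(1) C(2) unfolding S'_def by auto
    moreover have "f x \<noteq> 0" using inj x by blast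
    ultimately show "Re (g x x) > 0" using W(3) qg by force
  qed
  ultimately show "m_plus q (f ` S) \<le> m_plus g S" using W(4) by simp
next
  obtain W where W: "vec.subspace W" "W \<subseteq> S" "\<And>x. x \<in> W \<Longrightarrow> x \<noteq> 0 \<Longrightarrow> Re (g x x) > 0"
    "vec.dim W = m_plus g S"
    using m_plus_attained[OF S, of g] by blast
  have inj: "x = 0" if "x \<in> W" "f x = 0" for x
  proof (rule ccontr)
    assume "x \<noteq> 0"
    then have "Re (g x x) > 0" using W(3) that by blast
    moreover have "Re (g x x) = Re (q 0 0)" using qg[of x] W(2) that by auto
    ultimately show False using q0 by simp
  qed
  have "vec.dim (f ` W) \<le> m_plus q (f ` S)"
  proof (rule m_plus_ge[OF subspace_vlin_image[OF f W(1)]])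
    show "f ` W \<subseteq> f ` S" using W(2) by blast
    fix y assume y: "y \<in> f ` W" "y \<noteq> 0"
    then obtain x where x: "x \<in> W" "y = f x" by blast
    then have "x \<noteq> 0" using y(2) vlinD(3)[OF f] by auto
    then have "0 < Re (g x x)" by (rule W(3)[OF x(1)])
    then show "0 < Re (q y y)" using qg[of x] W(2) x by auto
  qed
  then show "m_plus g S \<le> m_plus q (f ` S)"
    using dim_image_inj[OF f W(1) inj] W(4) by simp
qed

section \<open>Momentum and position blocks\<close>

definition mom :: "complex^('n::finite + 'n) \<Rightarrow> complex^'n" where
  "mom z = (\<chi> i. z $ Inl i)"

definition pos :: "complex^('n::finite + 'n) \<Rightarrow> complex^'n" where
  "pos z = (\<chi> i. z $ Inr i)"

lemma block_vec_nth [simp]: "block_vec y x $ Inl i = y $ i" "block_vec y x $ Inr i = x $ i"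
  by (simp_all add: block_vec_def)

lemma mom_block [simp]: "mom (block_vec y x) = y" and pos_block [simp]: "pos (block_vec y x) = x"
  by (simp_all add: mom_def pos_def vec_eq_iff)

lemma block_mom_pos [simp]: "block_vec (mom z) (pos z) = z"
  by (simp add: vec_eq_iff mom_def pos_def block_vec_def split: sum.split)

lemma block_vec_eq_iff: "a = b \<longleftrightarrow> mom a = mom b \<and> pos a = pos b"
  by (metis block_mom_pos)

lemma vlin_mom: "vlin mom" and vlin_pos: "vlin pos"
  by (simp_all add: vlin_iff mom_def pos_def vec_eq_iff)

lemmas mom_simps [simp] = vlinD[OF vlin_mom]
lemmas pos_simps [simp] = vlinD[OF vlin_pos]

lemma block_vec_add: "block_vec a b + block_vec c d = block_vec (a + c) (b + d)"
  and block_vec_scale: "k *s block_vec a b = block_vec (k *s a) (k *s b)"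
  and block_vec_zero: "block_vec 0 0 = (0 :: complex^('n::finite + 'n))" for a b c d :: "complex^'n::finite"
  by (simp_all add: block_vec_eq_iff)

text \<open>The product of two subspaces, kept inside one coordinate space so that dimension, index
  and radical are available for it in the same form as for its factors.\<close>

definition pairs :: "(complex^'m::finite) set \<Rightarrow> (complex^'m) set \<Rightarrow> (complex^('m + 'm)) set" where
  "pairs A B = {x. mom x \<in> A \<and> pos x \<in> B}"

lemma subspace_pairs: "vec.subspace A \<Longrightarrow> vec.subspace B \<Longrightarrow> vec.subspace (pairs A B)"
  unfolding vec.subspace_def pairs_def by simp

lemma dim_pairs:
  assumes A: "vec.subspace A" and B: "vec.subspace B"
  shows "vec.dim (pairs A B) = vec.dim A + vec.dim B"
proof -
  have f: "vlin (\<lambda>a::complex^'a. block_vec a 0)" and g: "vlin (\<lambda>b::complex^'a. block_vec 0 b)"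
    by (simp_all add: vlin_iff block_vec_add block_vec_scale)
  have dA: "vec.dim ((\<lambda>a. block_vec a 0) ` A) = vec.dim A"
    by (rule dim_image_inj[OF f A]) (simp add: block_vec_eq_iff)
  have dB: "vec.dim ((\<lambda>b. block_vec 0 b) ` B) = vec.dim B"
    by (rule dim_image_inj[OF g B]) (simp add: block_vec_eq_iff)
  have "pairs A B = subspace_sum ((\<lambda>a. block_vec a 0) ` A) ((\<lambda>b. block_vec 0 b) ` B)"
  proof (intro set_eqI iffI)
    fix x assume "x \<in> pairs A B"
    moreover have "x = block_vec (mom x) 0 + block_vec 0 (pos x)" by (simp add: block_vec_add)
    ultimately show "x \<in> subspace_sum ((\<lambda>a. block_vec a 0) ` A) ((\<lambda>b. block_vec 0 b) ` B)"
      unfolding subspace_sum_def pairs_def by blast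
  qed (auto simp: subspace_sum_def pairs_def)
  moreover have "vec.dim (subspace_sum ((\<lambda>a. block_vec a 0) ` A) ((\<lambda>b. block_vec 0 b) ` B)) =
     vec.dim ((\<lambda>a. block_vec a 0) ` A) + vec.dim ((\<lambda>b. block_vec 0 b) ` B)"
    by (rule dim_subspace_sum_direct[OF subspace_vlin_image[OF f A] subspace_vlin_image[OF g B]])
       (auto simp: block_vec_eq_iff)
  ultimately show ?thesis using dA dB by simp
qed

definition diff_form :: "(complex^'m::finite \<Rightarrow> complex^'m \<Rightarrow> complex) \<Rightarrow> (complex^'m \<Rightarrow> complex^'m \<Rightarrow> complex)
    \<Rightarrow> complex^('m + 'm) \<Rightarrow> complex^('m + 'm) \<Rightarrow> complex" where
  "diff_form p r x y = r (pos x) (pos y) - p (mom x) (mom y)"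

lemma sesq_diff_form: "sesq p \<Longrightarrow> sesq r \<Longrightarrow> sesq (diff_form p r)"
  unfolding diff_form_def
  by (intro sesq_diff sesq_compose[OF _ vlin_mom vlin_mom] sesq_compose[OF _ vlin_pos vlin_pos])

lemma herm_on_diff_form: "herm_on U p \<Longrightarrow> herm_on U r \<Longrightarrow> herm_on (pairs U U) (diff_form p r)"
  unfolding herm_on_def diff_form_def pairs_def by (metis (no_types, lifting) complex_cnj_diff mem_Collect_eq)

lemma diff_form_uminus: "diff_form (\<lambda>x y. - p x y) (\<lambda>x y. - r x y) = (\<lambda>x y. - diff_form p r x y)"
  by (simp add: diff_form_def fun_eq_iff)

lemma m_plus_diff_form_ge:
  assumes p: "sesq p" and r: "sesq r" and U: "vec.subspace U"
  shows "m_plus (\<lambda>x y. - p x y) U + m_plus r U \<le> m_plus (diff_form p r) (pairs U U)"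
proof -
  obtain A where A: "vec.subspace A" "A \<subseteq> U" "\<And>x. x \<in> A \<Longrightarrow> x \<noteq> 0 \<Longrightarrow> Re (- p x x) > 0"
    "vec.dim A = m_plus (\<lambda>x y. - p x y) U"
    using m_plus_attained[OF U, of "\<lambda>x y. - p x y"] by blast
  obtain B where B: "vec.subspace B" "B \<subseteq> U" "\<And>x. x \<in> B \<Longrightarrow> x \<noteq> 0 \<Longrightarrow> Re (r x x) > 0"
    "vec.dim B = m_plus r U"
    using m_plus_attained[OF U, of r] by blast
  have "vec.dim (pairs A B) \<le> m_plus (diff_form p r) (pairs U U)"
  proof (rule m_plus_ge[OF subspace_pairs[OF A(1) B(1)]])
    show "pairs A B \<subseteq> pairs U U" using A(2) B(2) unfolding pairs_def by auto
    fix x assume x: "x \<in> pairs A B" "x \<noteq> 0"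
    have "Re (- p (mom x) (mom x)) \<ge> 0"
      using A(3)[of "mom x"] x(1) sesqD(5)[OF p] unfolding pairs_def by (cases "mom x = 0") auto
    moreover have "Re (r (pos x) (pos x)) \<ge> 0"
      using B(3)[of "pos x"] x(1) sesqD(5)[OF r] unfolding pairs_def by (cases "pos x = 0") auto
    moreover have "Re (- p (mom x) (mom x)) > 0 \<or> Re (r (pos x) (pos x)) > 0"
      using x A(3)[of "mom x"] B(3)[of "pos x"] block_vec_eq_iff[of x 0] unfolding pairs_def by auto
    ultimately show "0 < Re (diff_form p r x x)" unfolding diff_form_def by auto
  qed
  then show ?thesis using dim_pairs[OF A(1) B(1)] A(4) B(4) by simp
qed

text \<open>Products of definite subspaces give lower bounds for both indices;
  \<open>inertia\<close> on the factors and on the product forces equality.\<close>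

lemma m_plus_diff_form:
  assumes p: "sesq p" and r: "sesq r" and U: "vec.subspace U" and hp: "herm_on U p" and hr: "herm_on U r"
  shows "m_plus (diff_form p r) (pairs U U) = m_plus (\<lambda>x y. - p x y) U + m_plus r U"
    and "perp (diff_form p r) (pairs U U) (pairs U U) = pairs (perp p U U) (perp r U U)"
proof -
  let ?G = "diff_form p r"
  have z: "0 \<in> U" by (rule vec.subspace_0[OF U])
  show rad: "perp ?G (pairs U U) (pairs U U) = pairs (perp p U U) (perp r U U)"
  proof (intro set_eqI iffI)
    fix x assume x: "x \<in> perp ?G (pairs U U) (pairs U U)"
    have "p (mom x) c = 0" if "c \<in> U" for c
      using perpD(2)[OF x, of "block_vec c 0"] that z sesqD(6)[OF r] unfolding diff_form_def pairs_def by auto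
    moreover have "r (pos x) c = 0" if "c \<in> U" for c
      using perpD(2)[OF x, of "block_vec 0 c"] that z sesqD(6)[OF p] unfolding diff_form_def pairs_def by auto
    ultimately show "x \<in> pairs (perp p U U) (perp r U U)"
      using perpD(1)[OF x] unfolding perp_def pairs_def by auto
  qed (auto simp: perp_def pairs_def diff_form_def)
  have 1: "m_plus ?G (pairs U U) + m_plus (\<lambda>x y. - ?G x y) (pairs U U) + vec.dim (pairs (perp p U U) (perp r U U)) = vec.dim U + vec.dim U"
    using inertia[OF sesq_diff_form[OF p r] herm_on_diff_form[OF hp hr] subspace_pairs[OF U U]] rad dim_pairs[OF U U] by simp
  have 2: "vec.dim (pairs (perp p U U) (perp r U U)) = vec.dim (perp p U U) + vec.dim (perp r U U)"
    by (rule dim_pairs[OF subspace_perp[OF p U] subspace_perp[OF r U]])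
  note 3 = m_plus_diff_form_ge[OF p r U]
  have 4: "m_plus p U + m_plus (\<lambda>x y. - r x y) U \<le> m_plus (\<lambda>x y. - ?G x y) (pairs U U)"
    using m_plus_diff_form_ge[OF sesq_uminus[OF p] sesq_uminus[OF r] U] unfolding diff_form_uminus by simp
  show "m_plus ?G (pairs U U) = m_plus (\<lambda>x y. - p x y) U + m_plus r U"
    using 1 2 3 4 inertia[OF p hp U] inertia[OF r hr U] by linarith
qed

text \<open>This is \<open>m_plus_perp\<close> for the diagonal of \<open>U \<oplus> U\<close> and the form \<open>r \<oplus> - p\<close>.\<close>

theorem m_plus_difference:
  assumes p: "sesq p" and r: "sesq r" and U: "vec.subspace U" and hp: "herm_on U p" and hr: "herm_on U r"
  shows "m_plus (diff_form p r) {x \<in> pairs U U. \<forall>c\<in>U. p (mom x) c = r (pos x) c} + m_plus p U + vec.dim (perp p U U)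
    = m_plus (\<lambda>x y. p x y - r x y) U + m_plus r U + vec.dim (perp p U U \<inter> perp r U U)"
proof -
  let ?G = "diff_form p r" and ?d = "\<lambda>x y. p x y - r x y"
  define \<Delta> where "\<Delta> = (\<lambda>a. block_vec a a) ` U"
  have f: "vlin (\<lambda>a::complex^'a. block_vec a a)" by (simp add: vlin_iff block_vec_add block_vec_scale)
  have inj: "a = 0" if "block_vec a a = 0" for a :: "complex^'a" using that by (simp add: block_vec_eq_iff)
  have \<Delta>: "vec.subspace \<Delta>" "\<Delta> \<subseteq> pairs U U"
    unfolding \<Delta>_def using subspace_vlin_image[OF f U] by (auto simp: pairs_def)
  have d: "sesq ?d" "herm_on U ?d"
    using sesq_diff[OF p r] herm_on_diff[OF hp hr] by blast+
  have 1: "perp ?G (pairs U U) \<Delta> = {x \<in> pairs U U. \<forall>c\<in>U. p (mom x) c = r (pos x) c}"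
    unfolding perp_def \<Delta>_def diff_form_def by auto
  \<comment> \<open>On the diagonal the form is r - p, hence the sign.\<close>
  have 2: "m_plus ?G \<Delta> = m_plus (\<lambda>x y. - ?d x y) U"
    unfolding \<Delta>_def by (rule m_plus_image[OF f U]) (auto simp: diff_form_def sesqD[OF p] sesqD[OF r])
  have "\<Delta> \<inter> perp ?G (pairs U U) \<Delta> = (\<lambda>a. block_vec a a) ` perp ?d U U"
    unfolding perp_def \<Delta>_def diff_form_def pairs_def by (auto simp: image_iff)
  then have 3: "vec.dim (\<Delta> \<inter> perp ?G (pairs U U) \<Delta>) = vec.dim (perp ?d U U)"
    using dim_image_inj[OF f subspace_perp[OF d(1) U] inj] by simp
  have "\<Delta> \<inter> pairs (perp p U U) (perp r U U) = (\<lambda>a. block_vec a a) ` (perp p U U \<inter> perp r U U)"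
    unfolding perp_def \<Delta>_def pairs_def by (auto simp: image_iff)
  then have 4: "vec.dim (\<Delta> \<inter> perp ?G (pairs U U) (pairs U U)) = vec.dim (perp p U U \<inter> perp r U U)"
    unfolding m_plus_diff_form(2)[OF p r U hp hr]
    using dim_image_inj[OF f vec.subspace_inter[OF subspace_perp[OF p U] subspace_perp[OF r U]] inj] by simp
  \<comment> \<open>\<open>inertia\<close> for \<open>p\<close> and for \<open>?d\<close> exchanges
    the negative indices for positive ones and leaves only radicals.\<close>
  show ?thesis
    using m_plus_perp[OF sesq_diff_form[OF p r] herm_on_diff_form[OF hp hr] subspace_pairs[OF U U] \<Delta>]
      m_plus_diff_form(1)[OF p r U hp hr] inertia[OF p hp U] inertia[OF d U]
    unfolding 2 3 4 unfolding 1 by linarith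
qed

section \<open>Lagrangian subspaces in a chart\<close>

lemma sesq_herm_inner: "sesq herm_inner"
  by (simp add: sesq_def herm_inner_def algebra_simps sum.distrib sum_distrib_left)

lemmas herm_inner_simps = sesqD[OF sesq_herm_inner]

lemma cnj_herm_inner: "cnj (herm_inner a b) = herm_inner b a"
  by (simp add: herm_inner_def mult.commute)

lemma herm_inner_self: "herm_inner a a = of_real ((norm a)^2)"
proof -
  have "(norm a)^2 = (\<Sum>i\<in>UNIV. (cmod (a $ i))^2)"
    by (simp add: norm_vec_def L2_set_def sum_nonneg)
  then show ?thesis by (simp only: herm_inner_def of_real_sum complex_norm_square)
qed

lemma herm_inner_eq_0_iff: "herm_inner a a = 0 \<longleftrightarrow> a = 0"
  by (simp add: herm_inner_self)

lemma herm_inner_ext: "(\<And>b. herm_inner a b = 0) \<Longrightarrow> a = 0"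
  using herm_inner_eq_0_iff by blast

lemma sum_UNIV_sum: "(\<Sum>k\<in>(UNIV :: ('n::finite + 'n) set). f k) = (\<Sum>i\<in>UNIV. f (Inl i)) + (\<Sum>i\<in>UNIV. f (Inr i))"
proof -
  have "(\<Sum>k\<in>(UNIV :: ('n + 'n) set). f k) = sum f (Inl ` UNIV) + sum f (Inr ` UNIV)"
    unfolding UNIV_sum by (rule sum.union_disjoint) auto
  also have "sum f (Inl ` UNIV) = (\<Sum>i\<in>(UNIV::'n set). f (Inl i))" by (subst sum.reindex) (auto simp: inj_on_def)
  also have "sum f (Inr ` UNIV) = (\<Sum>i\<in>(UNIV::'n set). f (Inr i))" by (subst sum.reindex) (auto simp: inj_on_def)
  finally show ?thesis .
qed

lemma herm_inner_block: "herm_inner a b = herm_inner (mom a) (mom b) + herm_inner (pos a) (pos b)"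
  by (simp add: herm_inner_def sum_UNIV_sum mom_def pos_def)

lemma block_mat_mult_vec:
  "block_mat A B C D *v z = block_vec (A *v mom z + B *v pos z) (C *v mom z + D *v pos z)" for A :: "complex^'n::finite^'n"
  unfolding vec_eq_iff
  by (auto simp: matrix_vector_mult_def block_mat_def block_vec_def sum_UNIV_sum mom_def pos_def split: sum.split)

lemma J_mat_mult_vec: "J_mat *v z = block_vec (- pos z) (mom z)"
proof -
  have "(- mat 1) *v x = - x" for x :: "complex^'a"
    by (simp add: matrix_vector_mult_def mat_def vec_eq_iff if_distrib if_distribR sum_negf cong: if_cong)
  then show ?thesis by (simp add: J_mat_def block_mat_mult_vec)
qed

lemma omega_eq: "\<omega> a b = herm_inner (mom a) (pos b) - herm_inner (pos a) (mom b)"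
  by (simp add: \<omega>_def J_mat_mult_vec herm_inner_block herm_inner_simps)

lemma sesq_omega: "sesq \<omega>"
  by (simp add: sesq_def omega_eq herm_inner_simps algebra_simps)

text \<open>The kernel is the subspace y = s x, which is Lagrangian because \<open>s\<close> is
  real. A Lagrangian subspace transversal to it is parametrized by the values of
  \<open>wmap s\<close>.\<close>

definition wmap :: "real \<Rightarrow> complex^('n::finite + 'n) \<Rightarrow> complex^'n" where
  "wmap s z = mom z - complex_of_real s *s pos z"

lemma vlin_wmap: "vlin (wmap s)"
  by (simp add: vlin_iff wmap_def vec_eq_iff algebra_simps)

text \<open>Where \<omega> vanishes, pairing positions with momenta is Hermitian, and the real
  multiple of the position adds a Hermitian term.\<close>

lemma wmap_herm:
  assumes "\<omega> a b = 0"
  shows "herm_inner (pos a) (wmap s b) = cnj (herm_inner (pos b) (wmap s a))"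
  using assms unfolding omega_eq wmap_def by (simp add: herm_inner_simps cnj_herm_inner)

definition transversal :: "real \<Rightarrow> (complex^('n::finite + 'n)) set \<Rightarrow> bool" where
  "transversal s \<Lambda> \<longleftrightarrow> (\<forall>z\<in>\<Lambda>. wmap s z = 0 \<longrightarrow> z = 0)"

text \<open>Vectors of an isotropic subspace with \<open>y = s x\<close> for distinct \<open>s\<close> have orthogonal \<open>x\<close>.\<close>

lemma finite_not_transversal:
  fixes \<Lambda> :: "(complex^('n::finite + 'n)) set"
  assumes iso: "\<And>a b. a \<in> \<Lambda> \<Longrightarrow> b \<in> \<Lambda> \<Longrightarrow> \<omega> a b = 0"
  shows "finite {s. \<not> transversal s \<Lambda>}"
proof (rule ccontr)
  assume inf: "\<not> finite {s. \<not> transversal s \<Lambda>}"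
  \<comment> \<open>One element more than the dimension of the space of positions.\<close>
  obtain F where F: "F \<subseteq> {s. \<not> transversal s \<Lambda>}" "finite F" "card F = CARD('n) + 1"
    using infinite_arbitrarily_large[OF inf] by blast
  have "\<forall>s\<in>F. \<exists>z\<in>\<Lambda>. wmap s z = 0 \<and> z \<noteq> 0" using F(1) unfolding transversal_def by blast
  then obtain z where z: "\<And>s. s \<in> F \<Longrightarrow> z s \<in> \<Lambda> \<and> wmap s (z s) = 0 \<and> z s \<noteq> 0" by metis
  have mz: "mom (z s) = complex_of_real s *s pos (z s)" if "s \<in> F" for s
    using z[OF that] by (simp add: wmap_def)
  have nz: "pos (z s) \<noteq> 0" if "s \<in> F" for s
    using z[OF that] mz[OF that] by (auto simp: block_vec_eq_iff)
  have orth: "herm_inner (pos (z s)) (pos (z t)) = 0" if "s \<in> F" "t \<in> F" "s \<noteq> t" for s t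
  proof -
    have "\<omega> (z s) (z t) = 0" using iso z that by blast
    then have "(complex_of_real s - complex_of_real t) * herm_inner (pos (z s)) (pos (z t)) = 0"
      unfolding omega_eq by (simp add: mz that herm_inner_simps algebra_simps)
    then show ?thesis using that(3) by simp
  qed
  have inj: "inj_on (\<lambda>s. pos (z s)) F"
  proof (rule inj_onI, rule ccontr)
    fix s t assume st: "s \<in> F" "t \<in> F" "pos (z s) = pos (z t)" "s \<noteq> t"
    then show False using orth[OF st(1,2,4)] nz[OF st(2)] herm_inner_eq_0_iff by metis
  qed
  have "vec.independent ((\<lambda>s. pos (z s)) ` F)"
  proof (rule vec.independent_if_scalars_zero)
    show "finite ((\<lambda>s. pos (z s)) ` F)" using F(2) by blast
    fix f v assume sum: "(\<Sum>x\<in>(\<lambda>s. pos (z s)) ` F. f x *s x) = 0" and v: "v \<in> (\<lambda>s. pos (z s)) ` F"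
    obtain t where t: "t \<in> F" "v = pos (z t)" using v by blast
    have "0 = herm_inner (\<Sum>s\<in>F. f (pos (z s)) *s pos (z s)) (pos (z t))"
      using sum by (simp add: sum.reindex[OF inj] herm_inner_simps)
    also have "\<dots> = (\<Sum>s\<in>F. f (pos (z s)) * herm_inner (pos (z s)) (pos (z t)))"
      by (simp add: sesq_sum_left[OF sesq_herm_inner] herm_inner_simps)
    also have "\<dots> = (\<Sum>s\<in>F. if s = t then f v * herm_inner v v else 0)"
      by (rule sum.cong) (use orth t in auto)
    also have "\<dots> = f v * herm_inner v v" using t(1) F(2) by simp
    finally show "f v = 0" using nz[OF t(1)] t(2) herm_inner_eq_0_iff by auto
  qed
  then have "card ((\<lambda>s. pos (z s)) ` F) \<le> vec.dim (UNIV :: (complex^'n) set)"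
    by (intro vec.independent_card_le_dim) auto
  also have "\<dots> \<le> CARD('n)" using dim_subset_UNIV_cart_gen by blast
  finally show False using card_image[OF inj] F(3) by simp
qed

lemma wmap_surj:
  fixes \<Lambda> :: "(complex^('n::finite + 'n)) set"
  assumes \<Lambda>: "vec.subspace \<Lambda>" "2 * vec.dim \<Lambda> = CARD('n + 'n)" and tr: "transversal s \<Lambda>"
  shows "wmap s ` \<Lambda> = UNIV"
proof -
  have "vec.dim (wmap s ` \<Lambda>) = vec.dim \<Lambda>"
    using tr unfolding transversal_def by (intro dim_image_inj[OF vlin_wmap \<Lambda>(1)]) blast
  then have "vec.dim (wmap s ` \<Lambda>) = CARD('n)" using \<Lambda>(2) by simp
  moreover have "vec.dim (UNIV :: (complex^'n) set) \<le> CARD('n)" by (rule dim_subset_UNIV_cart_gen)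
  ultimately show ?thesis
    by (intro subspace_eqI_dim subspace_vlin_image[OF vlin_wmap \<Lambda>(1)] vec.subspace_UNIV) auto
qed

lemma chart_exists:
  fixes \<Lambda> :: "(complex^('n::finite + 'n)) set"
  assumes \<Lambda>: "vec.subspace \<Lambda>" "2 * vec.dim \<Lambda> = CARD('n + 'n)" and tr: "transversal s \<Lambda>"
  shows "\<exists>g. vlin g \<and> (\<forall>v. g v \<in> \<Lambda>) \<and> (\<forall>v. wmap s (g v) = v) \<and> (\<forall>z\<in>\<Lambda>. g (wmap s z) = z)"
proof -
  have inj: "inj_on (wmap s) \<Lambda>"
  proof (rule inj_onI)
    fix x y assume xy: "x \<in> \<Lambda>" "y \<in> \<Lambda>" "wmap s x = wmap s y"
    then have "wmap s (x - y) = 0" by (simp add: vlinD[OF vlin_wmap])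
    moreover have "x - y \<in> \<Lambda>" by (rule vec.subspace_diff[OF \<Lambda>(1) xy(1,2)])
    ultimately show "x = y" using tr unfolding transversal_def by auto
  qed
  obtain g where g: "g ` UNIV \<subseteq> \<Lambda>" "vlin g" "\<forall>z\<in>\<Lambda>. g (wmap s z) = z"
    using vec.linear_exists_left_inverse_on[OF vlin_wmap \<Lambda>(1) inj] by blast
  have "wmap s (g v) = v" for v
  proof -
    obtain z where "z \<in> \<Lambda>" "v = wmap s z" using wmap_surj[OF assms] by blast
    then show ?thesis using g(3) by simp
  qed
  then show ?thesis using g by blast
qed

lemma Lambda_D_iff: "z \<in> \<Lambda>\<^sub>D \<longleftrightarrow> pos z = 0"
  unfolding \<Lambda>\<^sub>D_def by (auto simp: block_vec_eq_iff)

lemma subspace_Lambda_D: "vec.subspace \<Lambda>\<^sub>D"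
  unfolding vec.subspace_def by (simp add: Lambda_D_iff)

lemma wmap_pos_eqI: "wmap s a = wmap s b \<Longrightarrow> pos a = pos b \<Longrightarrow> a = b"
  by (simp add: wmap_def block_vec_eq_iff)

text \<open>Two decompositions of the same vector differ by an element of
  \<open>\<beta> \<inter> \<kappa>\<close>, and isotropy of both subspaces annihilates the changed
  terms. The diagonal suffices, since the positive index tests nothing else.\<close>

lemma Q_form_self:
  assumes w: "sesq w" and \<beta>: "vec.subspace \<beta>" "\<And>a b. a \<in> \<beta> \<Longrightarrow> b \<in> \<beta> \<Longrightarrow> w a b = 0"
    and \<kappa>: "vec.subspace \<kappa>" "\<And>a b. a \<in> \<kappa> \<Longrightarrow> b \<in> \<kappa> \<Longrightarrow> w a b = 0"
    and yz: "y \<in> \<beta>" "z \<in> \<kappa>"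
  shows "Q_form w \<beta> \<kappa> (y + z) (y + z) = w y z"
  unfolding Q_form_def
proof (rule the_equality)
  show "\<exists>y\<^sub>1\<in>\<beta>. \<exists>z\<^sub>1\<in>\<kappa>. \<exists>y\<^sub>2\<in>\<beta>. \<exists>z\<^sub>2\<in>\<kappa>. y + z = y\<^sub>1 + z\<^sub>1 \<and> y + z = y\<^sub>2 + z\<^sub>2 \<and> w y z = w y\<^sub>1 z\<^sub>2"
    using yz by blast
next
  fix c
  assume "\<exists>y\<^sub>1\<in>\<beta>. \<exists>z\<^sub>1\<in>\<kappa>. \<exists>y\<^sub>2\<in>\<beta>. \<exists>z\<^sub>2\<in>\<kappa>. y + z = y\<^sub>1 + z\<^sub>1 \<and> y + z = y\<^sub>2 + z\<^sub>2 \<and> c = w y\<^sub>1 z\<^sub>2"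
  then obtain y1 z1 y2 z2 where h: "y1 \<in> \<beta>" "z1 \<in> \<kappa>" "y2 \<in> \<beta>" "z2 \<in> \<kappa>"
    "y + z = y1 + z1" "y + z = y2 + z2" "c = w y1 z2" by blast
  define d e where "d = y1 - y" and "e = z2 - z"
  have dd: "d = z - z1" unfolding d_def using h(5) by (simp add: algebra_simps)
  have ee: "e = y - y2" unfolding e_def using h(6) by (simp add: algebra_simps)
  have d: "d \<in> \<beta>" "d \<in> \<kappa>"
    using d_def dd h yz vec.subspace_diff[OF \<beta>(1)] vec.subspace_diff[OF \<kappa>(1)] by metis+
  have e: "e \<in> \<beta>" "e \<in> \<kappa>"
    using e_def ee h yz vec.subspace_diff[OF \<beta>(1)] vec.subspace_diff[OF \<kappa>(1)] by metis+
  have yd: "y1 = y + d" and ze: "z2 = z + e" unfolding d_def e_def by simp_all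
  have zz: "w d z = 0" "w y e = 0" "w d e = 0" using \<beta>(2) \<kappa>(2) d e yz by blast+
  show "c = w y z" unfolding h(7) yd ze by (simp add: sesqD(1,3)[OF w] zz)
qed

section \<open>Symplectic matrices and images of Lagrangian subspaces\<close>

definition symplectic :: "complex^('n::finite + 'n)^('n + 'n) \<Rightarrow> bool" where
  "symplectic M \<longleftrightarrow> (\<forall>a b. \<omega> (M *v a) (M *v b) = \<omega> a b)"

lemma omega_nondegenerate: "(\<And>b. \<omega> a b = 0) \<Longrightarrow> a = 0"
proof -
  assume a: "\<And>b. \<omega> a b = 0"
  have "herm_inner (mom a) c = 0" for c using a[of "block_vec 0 c"] by (simp add: omega_eq herm_inner_simps)
  moreover have "herm_inner (pos a) c = 0" for c using a[of "block_vec c 0"] by (simp add: omega_eq herm_inner_simps)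
  ultimately show "a = 0" using herm_inner_ext by (simp add: block_vec_eq_iff) blast
qed

lemma symplectic_inj:
  assumes "symplectic M" "M *v a = 0" shows "a = 0"
proof (rule omega_nondegenerate)
  fix b show "\<omega> a b = 0"
    using assms sesqD(5)[OF sesq_omega] unfolding symplectic_def by metis
qed

lemma dim_symplectic_image: "symplectic M \<Longrightarrow> vec.subspace S \<Longrightarrow> vec.dim ((*v) M ` S) = vec.dim S"
  by (rule dim_image_inj[OF vlin_matrix]) (auto dest: symplectic_inj)

lemma lagrangian_uminus: "lagrangian_subspace (\<lambda>a b. - \<omega> a b) \<Lambda> = lagrangian_subspace \<omega> \<Lambda>"
  unfolding lagrangian_subspace_def by simp

lemma lagrangianD:
  fixes \<Lambda> :: "(complex^('n::finite + 'n)) set"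
  assumes "lagrangian_subspace \<omega> \<Lambda>"
  shows "vec.subspace \<Lambda>" "\<And>a b. a \<in> \<Lambda> \<Longrightarrow> b \<in> \<Lambda> \<Longrightarrow> \<omega> a b = 0" "2 * vec.dim \<Lambda> = CARD('n + 'n)"
  using assms unfolding lagrangian_subspace_def by auto

lemma lagrangian_image:
  assumes M: "symplectic M" and \<Lambda>: "lagrangian_subspace \<omega> \<Lambda>"
  shows "lagrangian_subspace \<omega> ((*v) M ` \<Lambda>)"
  unfolding lagrangian_subspace_def
  using subspace_vlin_image[OF vlin_matrix lagrangianD(1)[OF \<Lambda>]] lagrangianD(2)[OF \<Lambda>] M
    dim_symplectic_image[OF M lagrangianD(1)[OF \<Lambda>]] lagrangianD(3)[OF \<Lambda>]
  unfolding symplectic_def by auto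

text \<open>The chart with parameter \<open>s\<close> consists of the Lagrangian subspaces transversal to \<open>{y = s x}\<close>; in it
  a Lagrangian subspace is the graph of a Hermitian form over \<open>\<Lambda>\<^sub>D\<close>. For the images \<open>M \<Lambda>\<close> and for a second
  subspace with chart map \<open>g\<close> these forms are \<open>hform\<close> and \<open>rform\<close>, both pulled back to \<open>\<Lambda>\<close>. The radical
  of \<open>hform\<close> is then an intersection with \<open>\<Lambda>\<^sub>D\<close>, that of \<open>dform\<close> one with the second subspace.\<close>

definition hform :: "real \<Rightarrow> complex^('n::finite + 'n)^('n + 'n) \<Rightarrow> complex^('n + 'n) \<Rightarrow> complex^('n + 'n) \<Rightarrow> complex" where
  "hform s M a b = herm_inner (pos (M *v a)) (wmap s (M *v b))"

definition rform :: "real \<Rightarrow> (complex^'n \<Rightarrow> complex^('n::finite + 'n)) \<Rightarrow> complex^('n + 'n)^('n + 'n) \<Rightarrow> complex^('n + 'n) \<Rightarrow> complex^('n + 'n) \<Rightarrow> complex" where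
  "rform s g M a b = herm_inner (pos (g (wmap s (M *v a)))) (wmap s (M *v b))"

definition dform :: "real \<Rightarrow> (complex^'n \<Rightarrow> complex^('n::finite + 'n)) \<Rightarrow> complex^('n + 'n)^('n + 'n) \<Rightarrow> complex^('n + 'n) \<Rightarrow> complex^('n + 'n) \<Rightarrow> complex" where
  "dform s g M a b = hform s M a b - rform s g M a b"

definition chart :: "real \<Rightarrow> (complex^('n::finite + 'n)) set \<Rightarrow> (complex^'n \<Rightarrow> complex^('n + 'n)) \<Rightarrow> bool" where
  "chart s \<Lambda> g \<longleftrightarrow> vlin g \<and> (\<forall>v. g v \<in> \<Lambda>) \<and> (\<forall>v. wmap s (g v) = v) \<and> (\<forall>z\<in>\<Lambda>. g (wmap s z) = z)"

lemma chartD: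
  assumes "chart s \<Lambda> g"
  shows "vlin g" "g v \<in> \<Lambda>" "wmap s (g v) = v" "z \<in> \<Lambda> \<Longrightarrow> g (wmap s z) = z"
  using assms unfolding chart_def by auto

lemma sesq_hform: "sesq (hform s M)"
  unfolding hform_def[abs_def]
  by (rule sesq_compose[OF sesq_herm_inner vlin_compose[OF vlin_pos vlin_matrix] vlin_compose[OF vlin_wmap vlin_matrix]])

lemma sesq_rform:
  assumes "vlin g" shows "sesq (rform s g M)"
proof -
  have w: "vlin (\<lambda>a. wmap s (M *v a))" by (rule vlin_compose[OF vlin_wmap vlin_matrix])
  show ?thesis unfolding rform_def[abs_def]
    by (rule sesq_compose[OF sesq_herm_inner vlin_compose[OF vlin_pos vlin_compose[OF assms w]] w])
qed

lemma sesq_dform: "vlin g \<Longrightarrow> sesq (dform s g M)"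
  unfolding dform_def[abs_def] by (rule sesq_diff[OF sesq_hform sesq_rform])

lemma herm_on_hform:
  assumes "symplectic M" "lagrangian_subspace \<omega> \<Lambda>"
  shows "herm_on \<Lambda> (hform s M)"
  unfolding herm_on_def
proof (intro ballI)
  fix a b assume "a \<in> \<Lambda>" "b \<in> \<Lambda>"
  then have "\<omega> (M *v b) (M *v a) = 0"
    using assms lagrangianD(2) unfolding symplectic_def by metis
  then show "hform s M b a = cnj (hform s M a b)" unfolding hform_def by (rule wmap_herm)
qed

lemma herm_on_rform:
  assumes "lagrangian_subspace \<omega> \<Lambda>" "chart s \<Lambda> g"
  shows "herm_on U (rform s g M)"
  unfolding herm_on_def
proof (intro ballI)
  fix a b
  have "\<omega> (g (wmap s (M *v b))) (g (wmap s (M *v a))) = 0"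
    by (intro lagrangianD(2)[OF assms(1)] chartD(2)[OF assms(2)])
  from wmap_herm[OF this, of s] show "rform s g M b a = cnj (rform s g M a b)"
    unfolding rform_def by (simp add: chartD(3)[OF assms(2)])
qed

lemma herm_on_dform:
  assumes "symplectic M" "lagrangian_subspace \<omega> \<Lambda>" "lagrangian_subspace \<omega> \<Lambda>'" "chart s \<Lambda>' g"
  shows "herm_on \<Lambda> (dform s g M)"
  unfolding dform_def[abs_def]
  by (rule herm_on_diff[OF herm_on_hform[OF assms(1,2)] herm_on_rform[OF assms(3,4)]])

section \<open>Chart forms and the triple index\<close>

context
  fixes M :: "complex^('n::finite + 'n)^('n + 'n)" and \<Lambda> :: "(complex^('n + 'n)) set" and s :: real
  assumes M: "symplectic M" and \<Lambda>: "lagrangian_subspace \<omega> \<Lambda>" and tr: "transversal s ((*v) M ` \<Lambda>)"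
begin

lemma chart_vector_exists: "\<exists>a\<in>\<Lambda>. wmap s (M *v a) = v"
  using wmap_surj[OF lagrangianD(1,3)[OF lagrangian_image[OF M \<Lambda>]] tr] by (metis imageE UNIV_I)

lemma chart_orthogonal: "(\<forall>a\<in>\<Lambda>. herm_inner x (wmap s (M *v a)) = herm_inner y (wmap s (M *v a))) \<longleftrightarrow> x = y"
proof
  assume h: "\<forall>a\<in>\<Lambda>. herm_inner x (wmap s (M *v a)) = herm_inner y (wmap s (M *v a))"
  have "herm_inner (x - y) v = 0" for v
    using chart_vector_exists[of v] h by (auto simp: herm_inner_simps)
  then show "x = y" using herm_inner_ext[of "x - y"] by simp
qed simp

lemma perp_hform: "perp (hform s M) \<Lambda> \<Lambda> = {a\<in>\<Lambda>. pos (M *v a) = 0}"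
  unfolding perp_def hform_def using chart_orthogonal[of "pos (M *v _)" 0] by (auto simp: herm_inner_simps)

lemma dim_perp_hform: "vec.dim (perp (hform s M) \<Lambda> \<Lambda>) = vec.dim ((*v) M ` \<Lambda> \<inter> \<Lambda>\<^sub>D)"
proof -
  have "(*v) M ` \<Lambda> \<inter> \<Lambda>\<^sub>D = (*v) M ` perp (hform s M) \<Lambda> \<Lambda>"
    unfolding perp_hform by (auto simp: Lambda_D_iff)
  then show ?thesis
    using dim_symplectic_image[OF M subspace_perp[OF sesq_hform lagrangianD(1)[OF \<Lambda>]]] by simp
qed

context
  fixes \<Lambda>' :: "(complex^('n + 'n)) set" and g
  assumes \<Lambda>': "lagrangian_subspace \<omega> \<Lambda>'" and g: "chart s \<Lambda>' g"
begin

text \<open>Equality of the two functionals means equal positions. The values of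
  \<open>wmap s\<close> agree by construction, so \<open>M *v a\<close> coincides with its partner
  in \<open>\<Lambda>'\<close>.\<close>

lemma perp_dform: "perp (dform s g M) \<Lambda> \<Lambda> = {a\<in>\<Lambda>. M *v a \<in> \<Lambda>'}"
proof (intro set_eqI iffI)
  fix a assume a: "a \<in> perp (dform s g M) \<Lambda> \<Lambda>"
  have "\<forall>b\<in>\<Lambda>. herm_inner (pos (M *v a)) (wmap s (M *v b)) = herm_inner (pos (g (wmap s (M *v a)))) (wmap s (M *v b))"
    using perpD(2)[OF a] unfolding dform_def hform_def rform_def by simp
  then have "pos (M *v a) = pos (g (wmap s (M *v a)))" unfolding chart_orthogonal .
  then have "M *v a = g (wmap s (M *v a))"
    using wmap_pos_eqI[of s] chartD(3)[OF g] by metis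
  then show "a \<in> {a\<in>\<Lambda>. M *v a \<in> \<Lambda>'}" using chartD(2)[OF g] perpD(1)[OF a] by (metis (mono_tags, lifting) mem_Collect_eq)
next
  fix a assume "a \<in> {a\<in>\<Lambda>. M *v a \<in> \<Lambda>'}"
  then show "a \<in> perp (dform s g M) \<Lambda> \<Lambda>"
    unfolding perp_def dform_def hform_def rform_def by (simp add: chartD(4)[OF g])
qed

lemma dim_perp_dform: "vec.dim (perp (dform s g M) \<Lambda> \<Lambda>) = vec.dim ((*v) M ` \<Lambda> \<inter> \<Lambda>')"
proof -
  have "(*v) M ` \<Lambda> \<inter> \<Lambda>' = (*v) M ` perp (dform s g M) \<Lambda> \<Lambda>"
    unfolding perp_dform by auto
  then show ?thesis
    using dim_symplectic_image[OF M subspace_perp[OF sesq_dform[OF chartD(1)[OF g]] lagrangianD(1)[OF \<Lambda>]]] by simp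
qed

text \<open>\<open>M\<close> only reparametrizes the chart, so this index depends on the second
  subspace and on the chart alone. It is one of the summands that stay constant when \<mu>
  varies.\<close>

lemma m_plus_rform: "m_plus (rform s g M) \<Lambda> = m_plus (\<lambda>u v. herm_inner (pos (g u)) v) UNIV"
proof -
  have "(\<lambda>a. wmap s (M *v a)) ` \<Lambda> = UNIV" using chart_vector_exists by (auto simp: image_iff) metis
  moreover have "m_plus (\<lambda>u v. herm_inner (pos (g u)) v) ((\<lambda>a. wmap s (M *v a)) ` \<Lambda>) = m_plus (rform s g M) \<Lambda>"
    by (rule m_plus_image[OF vlin_compose[OF vlin_wmap vlin_matrix] lagrangianD(1)[OF \<Lambda>]])
       (auto simp: rform_def herm_inner_simps)
  ultimately show ?thesis by simp
qed

text \<open>Splitting \<open>M *v a\<close> into a vector of \<open>\<Lambda>'\<close> and one of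
  \<open>\<Lambda>\<^sub>D\<close> amounts to finding a vector of \<open>\<Lambda>'\<close> with the
  same position, that is, some b whose \<open>rform\<close> functional is the \<open>hform\<close>
  functional of a. On such pairs the form of the triple index is \<open>diff_form\<close>, and
  \<open>m_plus_difference\<close> applies. The radical of \<open>hform\<close> and its common part
  with the radical of \<open>rform\<close> account for the two intersection dimensions.\<close>

theorem triple_index_chart:
  "triple_index \<omega> ((*v) M ` \<Lambda>) \<Lambda>' \<Lambda>\<^sub>D + m_plus (hform s M) \<Lambda>
    = m_plus (dform s g M) \<Lambda> + m_plus (\<lambda>u v. herm_inner (pos (g u)) v) UNIV"
proof -
  let ?h = "hform s M" and ?r = "rform s g M"
  define L where "L b = g (wmap s (M *v b))" for b
  have L: "L b \<in> \<Lambda>'" "wmap s (L b) = wmap s (M *v b)" for b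
    unfolding L_def by (simp_all add: chartD[OF g])
  note sub = lagrangianD(1)[OF \<Lambda>]
  define S where "S = {x \<in> pairs \<Lambda> \<Lambda>. \<forall>c\<in>\<Lambda>. ?h (mom x) c = ?r (pos x) c}"
  have S_iff: "x \<in> S \<longleftrightarrow> mom x \<in> \<Lambda> \<and> pos x \<in> \<Lambda> \<and> pos (M *v mom x) = pos (L (pos x))" for x
    unfolding S_def pairs_def hform_def rform_def L_def chart_orthogonal by simp
  have f: "vlin (\<lambda>x. M *v mom x)" by (rule vlin_compose[OF vlin_matrix vlin_mom])
  have pL: "vlin L" unfolding L_def by (rule vlin_compose[OF chartD(1)[OF g] vlin_compose[OF vlin_wmap vlin_matrix]])
  have subS: "vec.subspace S"
    unfolding vec.subspace_def
    using vec.subspace_0[OF sub] vec.subspace_add[OF sub] vec.subspace_scale[OF sub]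
    by (auto simp: S_iff vlinD[OF pL] vlinD[OF vlin_matrix])
  have QD: "Q_form \<omega> \<Lambda>' \<Lambda>\<^sub>D (y + z) (y + z) = \<omega> y z" if "y \<in> \<Lambda>'" "z \<in> \<Lambda>\<^sub>D" for y z
    by (rule Q_form_self[OF sesq_omega lagrangianD(1)[OF \<Lambda>'] lagrangianD(2)[OF \<Lambda>'] subspace_Lambda_D _ that])
      (auto simp: omega_eq Lambda_D_iff herm_inner_simps)
  have Qval: "Q_form \<omega> \<Lambda>' \<Lambda>\<^sub>D (M *v mom x) (M *v mom x) = diff_form ?h ?r x x" if x: "x \<in> S" for x
  proof -
    let ?y = "L (pos x)"
    have pz: "pos (M *v mom x) = pos ?y" using x S_iff by blast
    then have "M *v mom x - ?y \<in> \<Lambda>\<^sub>D" by (simp add: Lambda_D_iff)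
    from QD[OF L(1) this, of "pos x"] have "Q_form \<omega> \<Lambda>' \<Lambda>\<^sub>D (M *v mom x) (M *v mom x) = \<omega> ?y (M *v mom x - ?y)"
      by simp
    also have "\<dots> = - herm_inner (pos ?y) (mom (M *v mom x) - mom ?y)"
      using pz by (simp add: omega_eq herm_inner_simps)
    also have "\<dots> = diff_form ?h ?r x x"
    proof -
      have "?r (pos x) (pos x) = herm_inner (pos ?y) (wmap s ?y)"
        unfolding L(2) by (simp add: rform_def L_def)
      moreover have "?h (mom x) (mom x) = herm_inner (pos ?y) (wmap s (M *v mom x))"
        by (simp add: hform_def pz)
      ultimately show ?thesis by (simp add: diff_form_def wmap_def herm_inner_simps pz)
    qed
    finally show ?thesis .
  qed
  \<comment> \<open>The map forgets the second component and may have a kernel, which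
    \<open>m_plus_image\<close> allows.\<close>
  have img: "(\<lambda>x. M *v mom x) ` S = (*v) M ` \<Lambda> \<inter> subspace_sum \<Lambda>' \<Lambda>\<^sub>D"
  proof (intro set_eqI iffI)
    fix z assume "z \<in> (\<lambda>x. M *v mom x) ` S"
    then obtain x where x: "x \<in> S" "z = M *v mom x" by blast
    then have "z = L (pos x) + (M *v mom x - L (pos x))" "M *v mom x - L (pos x) \<in> \<Lambda>\<^sub>D"
      by (simp_all add: S_iff Lambda_D_iff)
    then show "z \<in> (*v) M ` \<Lambda> \<inter> subspace_sum \<Lambda>' \<Lambda>\<^sub>D"
      using x L(1) unfolding subspace_sum_def S_iff by blast
  next
    fix z assume "z \<in> (*v) M ` \<Lambda> \<inter> subspace_sum \<Lambda>' \<Lambda>\<^sub>D"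
    then obtain a y d where z: "z = M *v a" "a \<in> \<Lambda>" "z = y + d" "y \<in> \<Lambda>'" "d \<in> \<Lambda>\<^sub>D"
      unfolding subspace_sum_def by blast
    obtain b where b: "b \<in> \<Lambda>" "wmap s (M *v b) = wmap s y" using chart_vector_exists by blast
    then have "L b = y" unfolding L_def using chartD(4)[OF g z(4)] by simp
    moreover have "pos z = pos y" using z(3,5) by (simp add: Lambda_D_iff)
    ultimately have "block_vec a b \<in> S" using z b by (simp add: S_iff)
    then show "z \<in> (\<lambda>x. M *v mom x) ` S" using z(1) by (force simp: image_iff)
  qed
  have "Re (Q_form \<omega> \<Lambda>' \<Lambda>\<^sub>D 0 0) \<le> 0"
    using QD[OF vec.subspace_0[OF lagrangianD(1)[OF \<Lambda>']] vec.subspace_0[OF subspace_Lambda_D]]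
    by (simp add: omega_eq herm_inner_simps)
  then have m: "m_plus (Q_form \<omega> \<Lambda>' \<Lambda>\<^sub>D) ((*v) M ` \<Lambda> \<inter> subspace_sum \<Lambda>' \<Lambda>\<^sub>D) = m_plus (diff_form ?h ?r) S"
    unfolding img[symmetric] by (intro m_plus_image[OF f subS]) (simp_all add: Qval)
  have sub2: "vec.subspace (perp ?h \<Lambda> \<Lambda> \<inter> perp ?r \<Lambda> \<Lambda>)"
    by (intro vec.subspace_inter subspace_perp sesq_hform sesq_rform chartD(1)[OF g] sub)
  have "(*v) M ` (perp ?h \<Lambda> \<Lambda> \<inter> perp ?r \<Lambda> \<Lambda>) = (*v) M ` \<Lambda> \<inter> \<Lambda>' \<inter> \<Lambda>\<^sub>D"
  proof -
    have r: "perp ?r \<Lambda> \<Lambda> = {a\<in>\<Lambda>. pos (L a) = 0}"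
      unfolding perp_def rform_def L_def using chart_orthogonal[of "pos (g (wmap s (M *v _)))" 0] by (auto simp: herm_inner_simps)
    have "pos (M *v a) = 0 \<and> pos (L a) = 0 \<longleftrightarrow> M *v a \<in> \<Lambda>' \<and> pos (M *v a) = 0" for a
    proof
      assume h: "pos (M *v a) = 0 \<and> pos (L a) = 0"
      then have "M *v a = L a" using wmap_pos_eqI[of s "M *v a" "L a"] L(2) by simp
      then show "M *v a \<in> \<Lambda>' \<and> pos (M *v a) = 0" using L(1)[of a] h by simp
    next
      assume "M *v a \<in> \<Lambda>' \<and> pos (M *v a) = 0"
      then show "pos (M *v a) = 0 \<and> pos (L a) = 0" using chartD(4)[OF g, of "M *v a"] unfolding L_def by simp
    qed
    then have "perp ?h \<Lambda> \<Lambda> \<inter> perp ?r \<Lambda> \<Lambda> = {a\<in>\<Lambda>. M *v a \<in> \<Lambda>' \<and> pos (M *v a) = 0}"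
      unfolding perp_hform r by auto
    then show ?thesis by (auto simp: Lambda_D_iff)
  qed
  then have d: "vec.dim ((*v) M ` \<Lambda> \<inter> \<Lambda>' \<inter> \<Lambda>\<^sub>D) = vec.dim (perp ?h \<Lambda> \<Lambda> \<inter> perp ?r \<Lambda> \<Lambda>)"
    using dim_symplectic_image[OF M sub2] by simp
  have "vec.dim ((*v) M ` \<Lambda> \<inter> \<Lambda>' \<inter> \<Lambda>\<^sub>D) \<le> vec.dim ((*v) M ` \<Lambda> \<inter> \<Lambda>\<^sub>D)"
    by (rule vec.dim_subset) blast
  moreover have "m_plus (diff_form ?h ?r) S + m_plus ?h \<Lambda> + vec.dim (perp ?h \<Lambda> \<Lambda>)
    = m_plus (dform s g M) \<Lambda> + m_plus ?r \<Lambda> + vec.dim (perp ?h \<Lambda> \<Lambda> \<inter> perp ?r \<Lambda> \<Lambda>)"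
    unfolding S_def dform_def[abs_def]
    by (rule m_plus_difference[OF sesq_hform sesq_rform[OF chartD(1)[OF g]] sub herm_on_hform[OF M \<Lambda>] herm_on_rform[OF \<Lambda>' g]])
  ultimately show ?thesis
    unfolding triple_index_def m dim_perp_hform d m_plus_rform by linarith
qed

end

end

lemma lagrangian_chart_exists:
  "lagrangian_subspace \<omega> \<Lambda> \<Longrightarrow> transversal s \<Lambda> \<Longrightarrow> \<exists>g. chart s \<Lambda> g"
  unfolding chart_def by (rule chart_exists[OF lagrangianD(1,3)])

lemma common_transversal:
  assumes "lagrangian_subspace \<omega> \<Lambda>" "lagrangian_subspace \<omega> \<Lambda>'"
  shows "\<exists>s. transversal s \<Lambda> \<and> transversal s \<Lambda>'"
proof -
  have "finite ({s. \<not> transversal s \<Lambda>} \<union> {s. \<not> transversal s \<Lambda>'})"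
    using finite_not_transversal[OF lagrangianD(2)[OF assms(1)]] finite_not_transversal[OF lagrangianD(2)[OF assms(2)]] by simp
  then obtain s where "s \<notin> {s. \<not> transversal s \<Lambda>} \<union> {s. \<not> transversal s \<Lambda>'}"
    using ex_new_if_finite[OF infinite_UNIV_char_0] by blast
  then show ?thesis by blast
qed

section \<open>Linear differential equations\<close>

lemma vlin_bounded_linear:
  fixes f :: "complex^'a::finite \<Rightarrow> complex^'b::finite"
  assumes "vlin f" shows "bounded_linear f"
proof -
  have "linear f"
    by (rule linearI) (simp_all add: vlinD[OF assms] scaleR_eq_vector_scalar)
  then show ?thesis by (simp add: linear_conv_bounded_linear)
qed

lemma scaleR_matrix_nth: "(r *\<^sub>R A) $ i $ j = complex_of_real r * A $ i $ j" for A :: "complex^'n::finite^'m::finite"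
  by (simp add: complex_eq_iff)

lemma bounded_bilinear_matrix_mult:
  "bounded_bilinear ((**) :: complex^'b::finite^'a::finite \<Rightarrow> complex^'c::finite^'b \<Rightarrow> complex^'c^'a)"
  unfolding bilinear_conv_bounded_bilinear[symmetric] bilinear_def
  by (auto intro!: linearI simp: vec_eq_iff matrix_matrix_mult_def scaleR_matrix_nth algebra_simps sum.distrib sum_distrib_left
    simp del: vector_scaleR_component)

lemma bounded_bilinear_matrix_vector_mult:
  "bounded_bilinear ((*v) :: complex^'b::finite^'a::finite \<Rightarrow> complex^'b \<Rightarrow> complex^'a)"
  unfolding bilinear_conv_bounded_bilinear[symmetric] bilinear_def
  by (auto intro!: linearI simp: vec_eq_iff matrix_vector_mult_def scaleR_matrix_nth scaleR_eq_vector_scalar algebra_simps sum.distrib sum_distrib_left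
    simp del: vector_scaleR_component)

lemma bounded_bilinear_herm_inner: "bounded_bilinear herm_inner"
proof -
  have "bilinear herm_inner"
    unfolding bilinear_def
    by (auto intro!: linearI simp: herm_inner_simps scaleR_eq_vector_scalar scaleR_conv_of_real)
  then show ?thesis by (simp add: bilinear_conv_bounded_bilinear)
qed

lemmas matrix_mult_continuous_on = bounded_bilinear.continuous_on[OF bounded_bilinear_matrix_mult]
lemmas matrix_vector_mult_continuous_on = bounded_bilinear.continuous_on[OF bounded_bilinear_matrix_vector_mult]

lemma continuous_on_det:
  fixes A :: "'a::topological_space \<Rightarrow> complex^'n::finite^'n"
  assumes "\<And>i j. continuous_on S (\<lambda>x. A x $ i $ j)"
  shows "continuous_on S (\<lambda>x. det (A x))"
  unfolding det_def by (intro continuous_intros assms)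

lemma matrix_inv_works:
  fixes A :: "complex^'n::finite^'n"
  assumes "invertible A"
  shows "A ** matrix_inv A = mat 1" "matrix_inv A ** A = mat 1"
    "A *v (matrix_inv A *v v) = v" "matrix_inv A *v (A *v v) = v"
proof -
  have "A ** matrix_inv A = mat 1 \<and> matrix_inv A ** A = mat 1"
    unfolding matrix_inv_def by (rule someI_ex) (use assms in \<open>simp add: invertible_def\<close>)
  then show "A ** matrix_inv A = mat 1" "matrix_inv A ** A = mat 1" by auto
  then show "A *v (matrix_inv A *v v) = v" "matrix_inv A *v (A *v v) = v"
    by (simp_all add: matrix_vector_mul_assoc)
qed

lemma invertible_if_ker:
  fixes A :: "complex^'n::finite^'n"
  assumes "\<And>x. A *v x = 0 \<Longrightarrow> x = 0"
  shows "invertible A"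
  using assms matrix_left_invertible_ker[of A] invertible_left_inverse[of A] by blast

text \<open>By Cramer's rule the entries are quotients of determinants, which are polynomials in the
  entries of \<open>A x\<close>.\<close>

lemma continuous_on_matrix_inv:
  fixes A :: "'a::topological_space \<Rightarrow> complex^'n::finite^'n"
  assumes cont: "continuous_on S A" and inv: "\<And>x. x \<in> S \<Longrightarrow> invertible (A x)"
  shows "continuous_on S (\<lambda>x. matrix_inv (A x))"
proof -
  have c: "continuous_on S (\<lambda>x. A x $ i $ j)" for i j
    by (intro continuous_on_component cont)
  define B where "B x j k = (\<chi> i l. if l = k then axis j 1 $ i else A x $ i $ l)" for x j k
  have "matrix_inv (A x) $ k $ j = det (B x j k) / det (A x)" if x: "x \<in> S" for x k j
  proof -
    have d: "det (A x) \<noteq> 0" using inv[OF x] invertible_det_nz by blast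
    have "A x *v (matrix_inv (A x) *v axis j 1) = axis j 1"
      by (rule matrix_inv_works(3)[OF inv[OF x]])
    then have "matrix_inv (A x) *v axis j 1 = (\<chi> k. det (B x j k) / det (A x))"
      unfolding B_def using cramer[OF d] by blast
    moreover have "(matrix_inv (A x) *v axis j 1) $ k = matrix_inv (A x) $ k $ j"
      by (simp add: matrix_vector_mult_def axis_def if_distrib cong: if_cong)
    ultimately show ?thesis by simp
  qed
  moreover have "continuous_on S (\<lambda>x. det (B x j k) / det (A x))" for j k
  proof (rule continuous_on_divide)
    have "continuous_on S (\<lambda>x. B x j k $ i $ l)" for i l
      unfolding B_def by (cases "l = k") (simp_all add: c)
    then show "continuous_on S (\<lambda>x. det (B x j k))" by (rule continuous_on_det)
    show "continuous_on S (\<lambda>x. det (A x))" by (rule continuous_on_det[OF c])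
    show "\<forall>x\<in>S. det (A x) \<noteq> 0" using inv invertible_det_nz by blast
  qed
  ultimately have "continuous_on S (\<lambda>x. matrix_inv (A x) $ k $ j)" for k j
    by (metis (no_types, lifting) continuous_on_cong)
  then have "continuous_on S (\<lambda>x. \<chi> k j. matrix_inv (A x) $ k $ j)"
    by (intro continuous_on_vec_lambda)
  then show ?thesis by (simp add: vec_lambda_eta)
qed

text \<open>The iterated integrals of the Peano-Baker series. The parameter \<mu> stays outside as a
  power, so the solution becomes a power series in \<mu> whose coefficients are continuous in
  t.\<close>

primrec picard :: "(real \<Rightarrow> complex^'m::finite^'m) \<Rightarrow> nat \<Rightarrow> real \<Rightarrow> complex^'m^'m" where
  "picard G 0 t = mat 1"
| "picard G (Suc k) t = integral {0..t} (\<lambda>\<tau>. G \<tau> ** picard G k \<tau>)"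

definition picard_sum :: "(real \<Rightarrow> complex^'m::finite^'m) \<Rightarrow> real \<Rightarrow> real \<Rightarrow> complex^'m^'m" where
  "picard_sum G \<mu> t = (\<Sum>k. \<mu> ^ k *\<^sub>R picard G k t)"

context
  fixes T :: real and G :: "real \<Rightarrow> complex^'m::finite^'m"
  assumes T: "0 \<le> T" and G: "continuous_on {0..T} G"
begin

lemma continuous_on_picard: "continuous_on {0..T} (picard G k)"
proof (induction k)
  case 0
  have "picard G 0 = (\<lambda>t. mat 1)" by (simp add: fun_eq_iff)
  then show ?case by simp
next
  case (Suc k)
  have "continuous_on {0..T} (\<lambda>\<tau>. G \<tau> ** picard G k \<tau>)"
    by (rule matrix_mult_continuous_on[OF G Suc])
  then have "((\<lambda>t. integral {0..t} (\<lambda>\<tau>. G \<tau> ** picard G k \<tau>)) has_vector_derivative G t ** picard G k t) (at t within {0..T})"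
    if "t \<in> {0..T}" for t
    using integral_has_vector_derivative that by blast
  then have "continuous_on {0..T} (\<lambda>t. integral {0..t} (\<lambda>\<tau>. G \<tau> ** picard G k \<tau>))"
    by (intro continuous_on_vector_derivative)
  then show ?case by simp
qed

lemma picard_derivative:
  "t \<in> {0..T} \<Longrightarrow> (picard G (Suc k) has_vector_derivative G t ** picard G k t) (at t within {0..T})"
proof -
  assume t: "t \<in> {0..T}"
  have "picard G (Suc k) = (\<lambda>t. integral {0..t} (\<lambda>\<tau>. G \<tau> ** picard G k \<tau>))" by (simp add: fun_eq_iff)
  then show ?thesis
    using integral_has_vector_derivative[OF matrix_mult_continuous_on[OF G continuous_on_picard] t] by simp
qed

text \<open>The iterates are compared with the terms of an exponential series: each term is the
  integral of C times the preceding one, where C is the bound of \<open>G\<close> times the norm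
  constant of the matrix product.\<close>

lemma picard_bound: "\<exists>C\<ge>0. \<forall>k. \<forall>t\<in>{0..T}. norm (picard G k t) \<le> norm (mat 1 :: complex^'m^'m) * (C * t) ^ k / fact k"
proof -
  obtain K where K: "K \<ge> 0" "\<And>(A :: complex^'m^'m) (B :: complex^'m^'m). norm (A ** B) \<le> norm A * norm B * K"
    using bounded_bilinear.nonneg_bounded[OF bounded_bilinear_matrix_mult] by blast
  have "bounded (G ` {0..T})"
    by (intro compact_imp_bounded compact_continuous_image G) auto
  then obtain b where b: "b > 0" "\<And>t. t \<in> {0..T} \<Longrightarrow> norm (G t) \<le> b"
    unfolding bounded_pos by blast
  define N where "N = norm (mat 1 :: complex^'m^'m)"
  define C where "C = b * K"
  have C: "C \<ge> 0" unfolding C_def using b K by simp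
  have "\<forall>t\<in>{0..T}. norm (picard G k t) \<le> N * (C * t) ^ k / fact k" for k
  proof (induction k)
    case 0 show ?case by (simp add: N_def)
  next
    case (Suc k)
    show ?case
    proof
      fix t assume t: "t \<in> {0..T}"
      have sub: "{0..t} \<subseteq> {0..T}" using t by auto
      have der: "((\<lambda>\<tau>. N * (C * \<tau>) ^ Suc k / fact (Suc k)) has_vector_derivative C * (N * (C * \<tau>) ^ k / fact k)) (at \<tau> within {0..t})" for \<tau>
      proof -
        have "((\<lambda>\<tau>. C * \<tau>) has_real_derivative C) (at \<tau> within {0..t})"
          by (auto intro!: derivative_eq_intros)
        from DERIV_cdivide[OF DERIV_cmult[OF DERIV_power_Suc[OF this, of k], of N], of "fact (Suc k)"]
        have "((\<lambda>\<tau>. N * (C * \<tau>) ^ Suc k / fact (Suc k)) has_real_derivative (N * ((1 + real k) * (C * (C * \<tau>) ^ k)) / fact (Suc k))) (at \<tau> within {0..t})"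
          by simp
        moreover have "N * ((1 + real k) * (C * (C * \<tau>) ^ k)) / fact (Suc k) = C * (N * (C * \<tau>) ^ k / fact k)"
        proof -
          have "fact (Suc k) = (1 + real k) * fact k" by simp
          then show ?thesis by (simp add: divide_simps del: fact_Suc)
        qed
        ultimately show ?thesis by (simp only: has_real_derivative_iff_has_vector_derivative)
      qed
      have int: "((\<lambda>\<tau>. C * (N * (C * \<tau>) ^ k / fact k)) has_integral (N * (C * t) ^ Suc k / fact (Suc k) - N * (C * 0) ^ Suc k / fact (Suc k))) {0..t}"
        by (rule fundamental_theorem_of_calculus) (use t der in auto)
      have "norm (integral {0..t} (\<lambda>\<tau>. G \<tau> ** picard G k \<tau>)) \<le> integral {0..t} (\<lambda>\<tau>. C * (N * (C * \<tau>) ^ k / fact k))"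
      proof (rule integral_norm_bound_integral)
        show "(\<lambda>\<tau>. G \<tau> ** picard G k \<tau>) integrable_on {0..t}"
          by (rule integrable_continuous_real) (rule continuous_on_subset[OF matrix_mult_continuous_on[OF G continuous_on_picard] sub])
        show "(\<lambda>\<tau>. C * (N * (C * \<tau>) ^ k / fact k)) integrable_on {0..t}" using int by (rule has_integral_integrable)
        fix \<tau> assume \<tau>: "\<tau> \<in> {0..t}"
        have "norm (G \<tau> ** picard G k \<tau>) \<le> norm (G \<tau>) * norm (picard G k \<tau>) * K" by (rule K(2))
        also have "\<dots> \<le> b * (N * (C * \<tau>) ^ k / fact k) * K"
          using b(2)[of \<tau>] Suc \<tau> sub K(1) b(1) by (intro mult_right_mono mult_mono) auto
        finally show "norm (G \<tau> ** picard G k \<tau>) \<le> C * (N * (C * \<tau>) ^ k / fact k)"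
          by (simp add: C_def mult_ac)
      qed
      then show "norm (picard G (Suc k) t) \<le> N * (C * t) ^ Suc k / fact (Suc k)"
        using integral_unique[OF int] by simp
    qed
  qed
  then show ?thesis using C unfolding N_def by blast
qed

text \<open>The majorant is independent of t and of \<mu> in a bounded interval. It yields both
  joint continuity of the sum and termwise differentiation.\<close>

lemma picard_majorant:
  "\<exists>b. summable b \<and> (\<forall>k. b k \<ge> 0) \<and> (\<forall>k. \<forall>\<mu>\<in>{-M..M}. \<forall>t\<in>{0..T}. norm (\<mu> ^ k *\<^sub>R picard G k t) \<le> b k)"
proof -
  define N where "N = norm (mat 1 :: complex^'m^'m)"
  obtain C where C: "C \<ge> 0" "\<And>k t. t \<in> {0..T} \<Longrightarrow> norm (picard G k t) \<le> N * (C * t) ^ k / fact k"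
    unfolding N_def using picard_bound by blast
  define b where "b k = N * (inverse (fact k) * (\<bar>M\<bar> * (C * T)) ^ k)" for k
  have "summable b" unfolding b_def by (intro summable_mult summable_exp)
  moreover have "norm (\<mu> ^ k *\<^sub>R picard G k t) \<le> b k" if "\<mu> \<in> {-M..M}" "t \<in> {0..T}" for k \<mu> t
  proof -
    have "norm (\<mu> ^ k *\<^sub>R picard G k t) \<le> \<bar>\<mu>\<bar> ^ k * (N * (C * t) ^ k / fact k)"
      using mult_left_mono[OF C(2)[OF that(2), of k], of "\<bar>\<mu>\<bar> ^ k"] by (simp add: power_abs)
    also have "\<dots> \<le> \<bar>M\<bar> ^ k * (N * (C * T) ^ k / fact k)"
      using that C(1) T unfolding N_def
      by (intro mult_mono power_mono divide_right_mono mult_left_mono) auto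
    finally show ?thesis by (simp add: b_def power_mult_distrib divide_inverse mult_ac)
  qed
  moreover have "b k \<ge> 0" for k using C(1) T by (simp add: b_def N_def)
  ultimately show ?thesis by blast
qed

lemma summable_picard: "t \<in> {0..T} \<Longrightarrow> summable (\<lambda>k. \<mu> ^ k *\<^sub>R picard G k t)"
proof -
  assume t: "t \<in> {0..T}"
  obtain b where b: "summable b" "\<And>k. norm (\<mu> ^ k *\<^sub>R picard G k t) \<le> b k"
    using picard_majorant[of "\<bar>\<mu>\<bar>"] t by fastforce
  show ?thesis by (rule summable_comparison_test'[OF b(1)]) (rule b(2))
qed

lemma continuous_on_picard_sum:
  "continuous_on ({-M..M} \<times> {0..T}) (\<lambda>(\<mu>, t). picard_sum G \<mu> t)"
proof -
  obtain b where b: "summable b" "\<And>k \<mu> t. \<mu> \<in> {-M..M} \<Longrightarrow> t \<in> {0..T} \<Longrightarrow> norm (\<mu> ^ k *\<^sub>R picard G k t) \<le> b k"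
    using picard_majorant[of M] by blast
  have "uniform_limit ({-M..M} \<times> {0..T}) (\<lambda>n x. \<Sum>k<n. fst x ^ k *\<^sub>R picard G k (snd x)) (\<lambda>x. \<Sum>k. fst x ^ k *\<^sub>R picard G k (snd x)) sequentially"
    by (rule Weierstrass_m_test[OF _ b(1)]) (use b(2) in auto)
  moreover have "continuous_on ({-M..M} \<times> {0..T}) (\<lambda>x. \<Sum>k<n. fst x ^ k *\<^sub>R picard G k (snd x))" for n
    by (intro continuous_intros continuous_on_compose2[OF continuous_on_picard]) auto
  ultimately have "continuous_on ({-M..M} \<times> {0..T}) (\<lambda>x. \<Sum>k. fst x ^ k *\<^sub>R picard G k (snd x))"
    by (intro uniform_limit_theorem[where F = sequentially]) auto
  then show ?thesis by (simp add: picard_sum_def case_prod_unfold)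
qed

lemma picard_sum_zero: "t \<in> {0..T} \<Longrightarrow> picard_sum G 0 t = mat 1"
  unfolding picard_sum_def by (subst suminf_finite[of "{0}"]) auto

lemma picard_sum_initial: "picard_sum G \<mu> 0 = mat 1"
proof -
  have "picard G k 0 = 0" if "k \<noteq> 0" for k using that by (cases k) auto
  then show ?thesis unfolding picard_sum_def by (subst suminf_finite[of "{0}"]) auto
qed

text \<open>Termwise differentiation: the derivative of a term is \<mu> \<open>G\<close> times the
  term one order lower, so the differentiated series is dominated as well.\<close>

lemma picard_sum_derivative:
  assumes t: "t \<in> {0..T}"
  shows "((\<lambda>t. picard_sum G \<mu> t) has_vector_derivative \<mu> *\<^sub>R (G t ** picard_sum G \<mu> t)) (at t within {0..T})"
proof -
  define f where "f n t = \<mu> ^ n *\<^sub>R picard G n t" for n t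
  \<comment> \<open>The term of order 0 is constant in t, and the shift by one order leaves a zero
    in front.\<close>
  define d where "d n t = (case n of 0 \<Rightarrow> 0 | Suc k \<Rightarrow> \<mu> ^ Suc k *\<^sub>R (G t ** picard G k t))" for n t
  obtain K where K: "K \<ge> 0" "\<And>(A :: complex^'m^'m) (B :: complex^'m^'m). norm (A ** B) \<le> norm A * norm B * K"
    using bounded_bilinear.nonneg_bounded[OF bounded_bilinear_matrix_mult] by blast
  have "bounded (G ` {0..T})"
    by (intro compact_imp_bounded compact_continuous_image G) auto
  then obtain c where c: "c > 0" "\<And>t. t \<in> {0..T} \<Longrightarrow> norm (G t) \<le> c"
    unfolding bounded_pos by blast
  obtain b where b: "summable b" "\<And>k. b k \<ge> 0" "\<And>k t. t \<in> {0..T} \<Longrightarrow> norm (\<mu> ^ k *\<^sub>R picard G k t) \<le> b k"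
    using picard_majorant[of "\<bar>\<mu>\<bar>"] by fastforce
  define B where "B n = (case n of 0 \<Rightarrow> 0 | Suc k \<Rightarrow> \<bar>\<mu>\<bar> * (c * b k * K))" for n
  have "summable (\<lambda>k. B (Suc k))" unfolding B_def using b(1) by (auto intro!: summable_mult summable_mult2)
  then have sB: "summable B" by (simp only: summable_Suc_iff)
  have dB: "norm (d n t) \<le> B n" if "t \<in> {0..T}" for n t
  proof (cases n)
    case 0 then show ?thesis by (simp add: d_def B_def)
  next
    case (Suc k)
    have "norm (d n t) = \<bar>\<mu>\<bar> * norm (G t ** (\<mu> ^ k *\<^sub>R picard G k t))"
      by (simp add: d_def Suc bounded_bilinear.scaleR_right[OF bounded_bilinear_matrix_mult] abs_mult power_abs)
    also have "\<dots> \<le> \<bar>\<mu>\<bar> * (norm (G t) * norm (\<mu> ^ k *\<^sub>R picard G k t) * K)"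
      by (intro mult_left_mono K(2) abs_ge_zero)
    also have "\<dots> \<le> \<bar>\<mu>\<bar> * (c * b k * K)"
      using c(2)[OF that] b(3)[OF that, of k] c(1) b(2)[of k] K(1)
      by (intro mult_left_mono mult_right_mono mult_mono norm_ge_zero abs_ge_zero) simp_all
    finally show ?thesis by (simp add: B_def Suc)
  qed
  have ul: "uniform_limit {0..T} (\<lambda>n t. \<Sum>i<n. d i t) (\<lambda>t. \<Sum>i. d i t) sequentially"
    by (rule Weierstrass_m_test[OF dB sB])
  have sd: "(\<Sum>i. d i t) = \<mu> *\<^sub>R (G t ** picard_sum G \<mu> t)" if t: "t \<in> {0..T}" for t
  proof -
    have "summable (\<lambda>i. d i t)" by (rule summable_comparison_test'[OF sB]) (rule dB[OF t])
    moreover have "d 0 t = 0" by (simp add: d_def)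
    ultimately have "(\<Sum>i. d i t) = (\<Sum>i. d (Suc i) t)" using suminf_split_head[of "\<lambda>i. d i t"] by simp
    also have "\<dots> = (\<Sum>i. \<mu> *\<^sub>R (G t ** (\<mu> ^ i *\<^sub>R picard G i t)))"
      by (simp add: d_def bounded_bilinear.scaleR_right[OF bounded_bilinear_matrix_mult])
    also have "\<dots> = \<mu> *\<^sub>R (G t ** picard_sum G \<mu> t)"
    proof -
      have "bounded_linear (\<lambda>X. \<mu> *\<^sub>R (G t ** X))"
        by (intro bounded_linear_compose[OF bounded_linear_scaleR_right] bounded_bilinear.bounded_linear_right[OF bounded_bilinear_matrix_mult])
      from bounded_linear.suminf[OF this summable_picard[OF t, of \<mu>]]
      show ?thesis unfolding picard_sum_def by (rule sym)
    qed
    finally show ?thesis .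
  qed
  have "\<exists>g. \<forall>x\<in>{0..T}. (\<lambda>n. f n x) sums (g x) \<and> (g has_derivative (\<lambda>h. h *\<^sub>R (\<Sum>i. d i x))) (at x within {0..T})"
  proof (rule has_derivative_series)
    show "convex {0..T}" by simp
    show "(f n has_derivative (\<lambda>h. h *\<^sub>R d n x)) (at x within {0..T})" if "x \<in> {0..T}" for n x
    proof (cases n)
      case 0
      have "f 0 = (\<lambda>t. mat 1)" by (simp add: f_def fun_eq_iff)
      then show ?thesis by (simp add: 0 d_def)
    next
      case (Suc k)
      have "(f (Suc k) has_vector_derivative \<mu> ^ Suc k *\<^sub>R (G x ** picard G k x)) (at x within {0..T})"
        unfolding f_def[abs_def] by (rule bounded_linear.has_vector_derivative[OF bounded_linear_scaleR_right picard_derivative[OF that]])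
      then show ?thesis by (simp add: has_vector_derivative_def Suc d_def)
    qed
    show "\<forall>\<^sub>F n in sequentially. \<forall>x\<in>{0..T}. \<forall>h. norm ((\<Sum>i<n. h *\<^sub>R d i x) - h *\<^sub>R (\<Sum>i. d i x)) \<le> e * norm h"
      if "e > 0" for e
      using uniform_limitD[OF ul that]
    proof (rule eventually_mono)
      fix n assume n: "\<forall>x\<in>{0..T}. dist (\<Sum>i<n. d i x) (\<Sum>i. d i x) < e"
      show "\<forall>x\<in>{0..T}. \<forall>h. norm ((\<Sum>i<n. h *\<^sub>R d i x) - h *\<^sub>R (\<Sum>i. d i x)) \<le> e * norm h"
      proof (intro ballI allI)
        fix x h :: real assume x: "x \<in> {0..T}"
        have le: "norm ((\<Sum>i<n. d i x) - (\<Sum>i. d i x)) \<le> e"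
          using n x by (auto simp: dist_norm less_imp_le)
        have "(\<Sum>i<n. h *\<^sub>R d i x) - h *\<^sub>R (\<Sum>i. d i x) = h *\<^sub>R ((\<Sum>i<n. d i x) - (\<Sum>i. d i x))"
          by (simp add: scaleR_sum_right scaleR_diff_right)
        then show "norm ((\<Sum>i<n. h *\<^sub>R d i x) - h *\<^sub>R (\<Sum>i. d i x)) \<le> e * norm h"
          using mult_right_mono[OF le, of "norm h"] by (simp add: mult.commute)
      qed
    qed
    show "t \<in> {0..T}" by (rule t)
    show "(\<lambda>n. f n t) sums (\<Sum>n. f n t)" unfolding f_def by (intro summable_sums summable_picard t)
  qed
  then obtain g where g: "\<And>x. x \<in> {0..T} \<Longrightarrow> (\<lambda>n. f n x) sums (g x)"
    "\<And>x. x \<in> {0..T} \<Longrightarrow> (g has_derivative (\<lambda>h. h *\<^sub>R (\<Sum>i. d i x))) (at x within {0..T})" by blast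
  have gs: "g x = picard_sum G \<mu> x" if "x \<in> {0..T}" for x
    using g(1)[OF that] unfolding picard_sum_def f_def by (simp add: sums_iff)
  have "(g has_vector_derivative \<mu> *\<^sub>R (G t ** picard_sum G \<mu> t)) (at t within {0..T})"
    using g(2)[OF t] sd[OF t] by (simp add: has_vector_derivative_def)
  then show ?thesis
    by (rule has_vector_derivative_transform[OF t gs[symmetric], rotated])
qed

end

section \<open>The linear Hamiltonian system\<close>

lemma matrix_vector_minus: "(- A) *v x = - (A *v x)" for A :: "complex^'n::finite^'m::finite"
  by (simp add: matrix_vector_mult_def vec_eq_iff sum_negf)

text \<open>Of the Lagrangian only continuity, the adjoint relations and positivity are retained.
  \<open>Q_adj\<close> makes the transpose the adjoint, which is where reality of \<open>Q\<close>
  enters.\<close>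

locale jacobi_system =
  fixes T :: real and P Q R :: "real \<Rightarrow> complex^'n::finite^'n" and \<gamma> :: "real \<Rightarrow> complex^('n + 'n)^('n + 'n)"
  assumes T_pos: "0 < T"
    and P_cont: "continuous_on {0..T} P" and Q_cont: "continuous_on {0..T} Q" and R_cont: "continuous_on {0..T} R"
    and P_herm: "\<And>t a b. t \<in> {0..T} \<Longrightarrow> herm_inner (P t *v a) b = herm_inner a (P t *v b)"
    and R_herm: "\<And>t a b. t \<in> {0..T} \<Longrightarrow> herm_inner (R t *v a) b = herm_inner a (R t *v b)"
    and Q_adj: "\<And>t a b. t \<in> {0..T} \<Longrightarrow> herm_inner (transpose (Q t) *v a) b = herm_inner a (Q t *v b)"
    and P_pos: "\<And>t a. t \<in> {0..T} \<Longrightarrow> a \<noteq> 0 \<Longrightarrow> Re (herm_inner (P t *v a) a) > 0"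
    and fundamental: "fundamental_solution T (\<lambda>t. B_mat (P t) (Q t) (R t)) \<gamma>"
begin

lemma Q_adj': "t \<in> {0..T} \<Longrightarrow> herm_inner a (transpose (Q t) *v b) = herm_inner (Q t *v a) b"
  using Q_adj[of t b a] by (metis cnj_herm_inner)

lemma P_invertible: "t \<in> {0..T} \<Longrightarrow> invertible (P t)"
proof (rule invertible_if_ker, rule ccontr)
  fix x assume "t \<in> {0..T}" "P t *v x = 0" "x \<noteq> 0"
  then show False using P_pos[of t x] by (simp add: herm_inner_simps)
qed

text \<open>The relation y = P \<xi>' + Q \<xi> solved for the velocity.\<close>

definition vel :: "real \<Rightarrow> complex^('n + 'n) \<Rightarrow> complex^'n" where
  "vel t z = matrix_inv (P t) *v (mom z - Q t *v pos z)"

text \<open>The eigenvalue equation for \<mu> as a first-order system in (y, \<xi>).\<close>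

definition field :: "real \<Rightarrow> real \<Rightarrow> complex^('n + 'n) \<Rightarrow> complex^('n + 'n)" where
  "field \<mu> t z = block_vec (transpose (Q t) *v vel t z + R t *v pos z - complex_of_real \<mu> *s pos z) (vel t z)"

lemma mom_eq: "t \<in> {0..T} \<Longrightarrow> mom z = P t *v vel t z + Q t *v pos z"
  by (simp add: vel_def matrix_inv_works(3)[OF P_invertible])

lemma field_eq: "(J_mat ** B_mat (P t) (Q t) (R t)) *v z = field 0 t z"
proof -
  have "(J_mat ** B_mat (P t) (Q t) (R t)) *v z = J_mat *v (B_mat (P t) (Q t) (R t) *v z)"
    by (simp add: matrix_vector_mul_assoc)
  then show ?thesis
    by (simp add: B_mat_def block_mat_mult_vec J_mat_mult_vec field_def vel_def matrix_vector_minus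
      matrix_vector_mul_assoc[symmetric] matrix_vector_mult_diff_distrib matrix_vector_mult_diff_rdistrib algebra_simps
      del: transpose_matrix_vector)
qed

text \<open>Lagrange's identity: the coefficient terms cancel by the adjoint relations, and only the
  difference of the spectral parameters remains.\<close>

lemma omega_field:
  assumes t: "t \<in> {0..T}"
  shows "\<omega> (field \<mu> t z) w + \<omega> z (field \<nu> t w) = - complex_of_real (\<mu> - \<nu>) * herm_inner (pos z) (pos w)"
proof -
  have 1: "herm_inner (mom z) (vel t w) = herm_inner (vel t z) (P t *v vel t w) + herm_inner (Q t *v pos z) (vel t w)"
    by (subst mom_eq[OF t]) (simp add: herm_inner_simps P_herm[OF t])
  have 2: "herm_inner (vel t z) (mom w) = herm_inner (vel t z) (P t *v vel t w) + herm_inner (vel t z) (Q t *v pos w)"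
    by (subst mom_eq[OF t, of w]) (simp add: herm_inner_simps)
  show ?thesis
    unfolding omega_eq field_def
    by (simp add: herm_inner_simps 1 2 Q_adj[OF t] Q_adj'[OF t] R_herm[OF t] algebra_simps del: transpose_matrix_vector)
qed

lemma omega_has_derivative:
  assumes "(f has_vector_derivative f') F" "(g has_vector_derivative g') F" "F = at t within S"
  shows "((\<lambda>t. \<omega> (f t) (g t)) has_vector_derivative \<omega> (f t) g' + \<omega> f' (g t)) F"
proof -
  note m = bounded_linear.has_vector_derivative[OF vlin_bounded_linear[OF vlin_mom]]
  note p = bounded_linear.has_vector_derivative[OF vlin_bounded_linear[OF vlin_pos]]
  note h = bounded_bilinear.has_vector_derivative[OF bounded_bilinear_herm_inner]
  show ?thesis
    using has_vector_derivative_diff[OF h[OF m[OF assms(1)[unfolded assms(3)]] p[OF assms(2)[unfolded assms(3)]]]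
        h[OF p[OF assms(1)[unfolded assms(3)]] m[OF assms(2)[unfolded assms(3)]]]]
    unfolding omega_eq assms(3) by (simp add: algebra_simps)
qed

text \<open>Lagrange's identity integrated. Equal parameters give conservation of \<omega>;
  different ones produce the L2 product that drives monotonicity in \<mu>.\<close>

lemma omega_solutions:
  assumes f: "\<And>t. t \<in> {0..T} \<Longrightarrow> (f has_vector_derivative field \<mu> t (f t)) (at t within {0..T})"
    and g: "\<And>t. t \<in> {0..T} \<Longrightarrow> (g has_vector_derivative field \<nu> t (g t)) (at t within {0..T})"
    and t: "t \<in> {0..T}"
  shows "\<omega> (f t) (g t) = \<omega> (f 0) (g 0) - complex_of_real (\<mu> - \<nu>) * integral {0..t} (\<lambda>\<tau>. herm_inner (pos (f \<tau>)) (pos (g \<tau>)))"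
    and "(\<lambda>\<tau>. herm_inner (pos (f \<tau>)) (pos (g \<tau>))) integrable_on {0..t}"
proof -
  have sub: "{0..t} \<subseteq> {0..T}" using t by auto
  have der: "((\<lambda>t. \<omega> (f t) (g t)) has_vector_derivative - complex_of_real (\<mu> - \<nu>) * herm_inner (pos (f \<tau>)) (pos (g \<tau>))) (at \<tau> within {0..t})"
    if "\<tau> \<in> {0..t}" for \<tau>
  proof -
    have \<tau>: "\<tau> \<in> {0..T}" using that sub by auto
    have "\<omega> (f \<tau>) (field \<nu> \<tau> (g \<tau>)) + \<omega> (field \<mu> \<tau> (f \<tau>)) (g \<tau>) = - complex_of_real (\<mu> - \<nu>) * herm_inner (pos (f \<tau>)) (pos (g \<tau>))"
      by (subst add.commute) (rule omega_field[OF \<tau>])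
    with omega_has_derivative[OF f[OF \<tau>] g[OF \<tau>] refl]
    have "((\<lambda>t. \<omega> (f t) (g t)) has_vector_derivative - complex_of_real (\<mu> - \<nu>) * herm_inner (pos (f \<tau>)) (pos (g \<tau>))) (at \<tau> within {0..T})"
      by simp
    then show ?thesis by (rule has_vector_derivative_within_subset[OF _ sub])
  qed
  have fc: "continuous_on {0..T} f" by (rule continuous_on_vector_derivative) (rule f)
  have gc: "continuous_on {0..T} g" by (rule continuous_on_vector_derivative) (rule g)
  have "continuous_on {0..T} (\<lambda>\<tau>. herm_inner (pos (f \<tau>)) (pos (g \<tau>)))"
    by (rule bounded_bilinear.continuous_on[OF bounded_bilinear_herm_inner
      bounded_linear.continuous_on[OF vlin_bounded_linear[OF vlin_pos] fc]
      bounded_linear.continuous_on[OF vlin_bounded_linear[OF vlin_pos] gc]])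
  then show int: "(\<lambda>\<tau>. herm_inner (pos (f \<tau>)) (pos (g \<tau>))) integrable_on {0..t}"
    by (intro integrable_continuous_real continuous_on_subset[OF _ sub])
  have "((\<lambda>\<tau>. - complex_of_real (\<mu> - \<nu>) * herm_inner (pos (f \<tau>)) (pos (g \<tau>))) has_integral \<omega> (f t) (g t) - \<omega> (f 0) (g 0)) {0..t}"
    using t by (intro fundamental_theorem_of_calculus der) auto
  then have "\<omega> (f t) (g t) - \<omega> (f 0) (g 0) = integral {0..t} (\<lambda>\<tau>. - complex_of_real (\<mu> - \<nu>) * herm_inner (pos (f \<tau>)) (pos (g \<tau>)))"
    using integral_unique by metis
  also have "\<dots> = - complex_of_real (\<mu> - \<nu>) * integral {0..t} (\<lambda>\<tau>. herm_inner (pos (f \<tau>)) (pos (g \<tau>)))"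
    by (rule integral_mult_right)
  finally show "\<omega> (f t) (g t) = \<omega> (f 0) (g 0) - complex_of_real (\<mu> - \<nu>) * integral {0..t} (\<lambda>\<tau>. herm_inner (pos (f \<tau>)) (pos (g \<tau>)))"
    by (simp add: algebra_simps)
qed

section \<open>The fundamental solution and the flow with R - \<mu>\<close>

lemma gamma_initial: "\<gamma> 0 = mat 1"
  using fundamental unfolding fundamental_solution_def by simp

lemma gamma_derivative: "t \<in> {0..T} \<Longrightarrow> (\<gamma> has_vector_derivative (J_mat ** B_mat (P t) (Q t) (R t) ** \<gamma> t)) (at t within {0..T})"
  using fundamental unfolding fundamental_solution_def by simp

lemma gamma_vector_derivative:
  assumes "t \<in> {0..T}"
  shows "((\<lambda>t. \<gamma> t *v c) has_vector_derivative field 0 t (\<gamma> t *v c)) (at t within {0..T})"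
  using bounded_linear.has_vector_derivative[OF bounded_bilinear.bounded_linear_left[OF bounded_bilinear_matrix_vector_mult] gamma_derivative[OF assms], of c]
  by (simp add: field_eq[symmetric] matrix_vector_mul_assoc matrix_mul_assoc)

lemma gamma_cont: "continuous_on {0..T} \<gamma>"
  by (rule continuous_on_vector_derivative) (rule gamma_derivative)

lemma gamma_symplectic: "t \<in> {0..T} \<Longrightarrow> symplectic (\<gamma> t)"
  unfolding symplectic_def
  using omega_solutions(1)[OF gamma_vector_derivative gamma_vector_derivative] by (simp add: gamma_initial)

lemma symplectic_invertible: "symplectic M \<Longrightarrow> invertible M"
  using symplectic_inj by (blast intro: invertible_if_ker)

text \<open>The derivative of \<open>field\<close> with respect to \<mu>.\<close>

definition shift_mat :: "complex^('n + 'n)^('n + 'n)" where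
  "shift_mat = block_mat 0 (- mat 1) 0 0"

lemma shift_mat_mult: "shift_mat *v z = block_vec (- pos z) 0"
  by (simp add: shift_mat_def block_mat_mult_vec matrix_vector_minus)

text \<open>Variation of constants: \<open>\<gamma>\<close> times the solution of \<open>\<phi>' = \<mu> G \<phi>\<close> solves the system with \<open>R - \<mu>\<close>,
  and \<open>\<phi>\<close> is a power series in \<open>\<mu>\<close>.\<close>

definition G :: "real \<Rightarrow> complex^('n + 'n)^('n + 'n)" where
  "G t = matrix_inv (\<gamma> t) ** (shift_mat ** \<gamma> t)"

lemma G_cont: "continuous_on {0..T} G"
  unfolding G_def[abs_def]
  by (intro matrix_mult_continuous_on continuous_on_matrix_inv gamma_cont continuous_on_const
    symplectic_invertible gamma_symplectic)

definition flow :: "real \<Rightarrow> real \<Rightarrow> complex^('n + 'n)^('n + 'n)" where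
  "flow \<mu> t = \<gamma> t ** picard_sum G \<mu> t"

lemma flow_initial: "flow \<mu> 0 = mat 1"
  using picard_sum_initial[OF _ G_cont] T_pos by (simp add: flow_def gamma_initial)

lemma flow_zero: "t \<in> {0..T} \<Longrightarrow> flow 0 t = \<gamma> t"
  using picard_sum_zero[OF _ G_cont] T_pos by (simp add: flow_def)

lemma flow_derivative:
  assumes t: "t \<in> {0..T}"
  shows "((\<lambda>t. flow \<mu> t *v c) has_vector_derivative field \<mu> t (flow \<mu> t *v c)) (at t within {0..T})"
proof -
  have "((\<lambda>t. flow \<mu> t) has_vector_derivative
     \<gamma> t ** (\<mu> *\<^sub>R (G t ** picard_sum G \<mu> t)) + (J_mat ** B_mat (P t) (Q t) (R t) ** \<gamma> t) ** picard_sum G \<mu> t) (at t within {0..T})"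
    unfolding flow_def
    by (rule bounded_bilinear.has_vector_derivative[OF bounded_bilinear_matrix_mult gamma_derivative[OF t] picard_sum_derivative[OF _ G_cont t]])
       (use T_pos in simp)
  from bounded_linear.has_vector_derivative[OF bounded_bilinear.bounded_linear_left[OF bounded_bilinear_matrix_vector_mult] this, of c]
  have d: "((\<lambda>t. flow \<mu> t *v c) has_vector_derivative
     (\<gamma> t ** (\<mu> *\<^sub>R (G t ** picard_sum G \<mu> t)) + (J_mat ** B_mat (P t) (Q t) (R t) ** \<gamma> t) ** picard_sum G \<mu> t) *v c) (at t within {0..T})" .
  let ?z = "flow \<mu> t *v c"
  have 1: "((J_mat ** B_mat (P t) (Q t) (R t) ** \<gamma> t) ** picard_sum G \<mu> t) *v c = field 0 t ?z"
    by (simp add: field_eq[symmetric] flow_def matrix_vector_mul_assoc matrix_mul_assoc)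
  have "\<gamma> t ** G t = shift_mat ** \<gamma> t"
    unfolding G_def by (simp add: matrix_mul_assoc matrix_inv_works(1)[OF symplectic_invertible[OF gamma_symplectic[OF t]]])
  then have "\<gamma> t ** (\<mu> *\<^sub>R (G t ** picard_sum G \<mu> t)) = \<mu> *\<^sub>R (shift_mat ** flow \<mu> t)"
    by (simp add: bounded_bilinear.scaleR_right[OF bounded_bilinear_matrix_mult] flow_def matrix_mul_assoc)
  then have 2: "(\<gamma> t ** (\<mu> *\<^sub>R (G t ** picard_sum G \<mu> t))) *v c = complex_of_real \<mu> *s block_vec (- pos ?z) 0"
    by (simp add: bounded_bilinear.scaleR_left[OF bounded_bilinear_matrix_vector_mult] matrix_vector_mul_assoc[symmetric] shift_mat_mult scaleR_eq_vector_scalar)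
  have "(\<gamma> t ** (\<mu> *\<^sub>R (G t ** picard_sum G \<mu> t)) + (J_mat ** B_mat (P t) (Q t) (R t) ** \<gamma> t) ** picard_sum G \<mu> t) *v c = field \<mu> t ?z"
    unfolding matrix_vector_mult_add_rdistrib 1 2
    by (simp add: field_def block_vec_add block_vec_scale)
  with d show ?thesis by simp
qed

lemma flow_continuous: "continuous_on ({-M..M} \<times> {0..T}) (\<lambda>(\<mu>, t). flow \<mu> t)"
  unfolding flow_def case_prod_unfold
  using continuous_on_picard_sum[OF _ G_cont, of M] T_pos
  by (intro matrix_mult_continuous_on continuous_on_compose2[OF gamma_cont] continuous_intros) (auto simp: case_prod_unfold)

lemma omega_flow:
  assumes "t \<in> {0..T}"
  shows "\<omega> (flow \<mu> t *v a) (flow \<nu> t *v b) = \<omega> a b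
    - complex_of_real (\<mu> - \<nu>) * integral {0..t} (\<lambda>\<tau>. herm_inner (pos (flow \<mu> \<tau> *v a)) (pos (flow \<nu> \<tau> *v b)))"
  using omega_solutions(1)[OF flow_derivative flow_derivative assms] by (simp add: flow_initial)

lemma flow_symplectic: "t \<in> {0..T} \<Longrightarrow> symplectic (flow \<mu> t)"
  unfolding symplectic_def using omega_flow[of t \<mu> _ \<mu>] by simp

text \<open>\<omega> is conserved between \<open>z\<close> and every solution
  \<open>flow \<mu> t *v c\<close>. The flow is invertible, so these solutions exhaust the space at
  each time, and nondegeneracy of \<omega> identifies \<open>z\<close>.\<close>

lemma flow_unique:
  assumes z: "\<And>t. t \<in> {0..T} \<Longrightarrow> (z has_vector_derivative field \<mu> t (z t)) (at t within {0..T})" and t: "t \<in> {0..T}"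
  shows "z t = flow \<mu> t *v z 0"
proof -
  have "\<omega> (z t - flow \<mu> t *v z 0) b = 0" for b
  proof -
    define c where "c = matrix_inv (flow \<mu> t) *v b"
    have b: "b = flow \<mu> t *v c"
      unfolding c_def by (simp add: matrix_inv_works(3)[OF symplectic_invertible[OF flow_symplectic[OF t]]])
    have "\<omega> (z t) b = \<omega> (z 0) c"
      unfolding b using omega_solutions(1)[OF z flow_derivative t] by (simp add: flow_initial)
    also have "\<dots> = \<omega> (flow \<mu> t *v z 0) b"
      unfolding b using flow_symplectic[OF t] by (simp add: symplectic_def)
    finally show ?thesis by (simp add: sesqD(9)[OF sesq_omega])
  qed
  then have "z t - flow \<mu> t *v z 0 = 0" by (rule omega_nondegenerate)
  then show ?thesis by simp
qed

text \<open>Vanishing position forces vanishing velocity at time 0 and hence vanishing momentum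
  there. This makes the L2 product of solutions definite and the map from initial values to
  eigenfunctions injective.\<close>

lemma pos_flow_zero:
  assumes z: "\<And>t. t \<in> {0..T} \<Longrightarrow> pos (flow \<mu> t *v a) = 0"
  shows "a = 0"
proof -
  have 0: "0 \<in> {0..T}" using T_pos by simp
  have d: "((\<lambda>t. pos (flow \<mu> t *v a)) has_vector_derivative pos (field \<mu> 0 (flow \<mu> 0 *v a))) (at 0 within {0..T})"
    by (rule bounded_linear.has_vector_derivative[OF vlin_bounded_linear[OF vlin_pos] flow_derivative[OF 0]])
  have "((\<lambda>t. 0) has_vector_derivative pos (field \<mu> 0 (flow \<mu> 0 *v a))) (at 0 within {0..T})"
    by (rule has_vector_derivative_transform[OF 0 _ d]) (use z in simp)
  then have "pos (field \<mu> 0 a) = 0"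
    using vector_derivative_unique_within_closed_interval[OF T_pos, of 0 "\<lambda>t. 0" _ 0] 0 has_vector_derivative_const
    by (simp add: flow_initial)
  then have "vel 0 a = 0" by (simp add: field_def)
  then show "a = 0" using mom_eq[OF 0, of a] z[OF 0] by (simp add: flow_initial block_vec_eq_iff)
qed

end

text \<open>Derivatives are unique and so inherit sesquilinearity. This serves where derivative
  vectors are merely chosen and show no linear dependence on the argument.\<close>

lemma sesq_of_derivative:
  assumes q: "\<And>s. sesq (q s)"
    and der: "\<And>a b. ((\<lambda>s. q s a b) has_vector_derivative q' a b) (at (s0::real))"
  shows "sesq q'"
  unfolding sesq_def
proof (intro conjI allI)
  fix x y z :: "complex^'a" and c
  note u = vector_derivative_unique_at
  show "q' (x + y) z = q' x z + q' y z"
    by (rule u[OF der]) (use has_vector_derivative_add[OF der[of x z] der[of y z]] in \<open>simp add: sesqD(1)[OF q]\<close>)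
  show "q' x (y + z) = q' x y + q' x z"
    by (rule u[OF der]) (use has_vector_derivative_add[OF der[of x y] der[of x z]] in \<open>simp add: sesqD(3)[OF q]\<close>)
  show "q' (c *s x) y = c * q' x y"
    by (rule u[OF der]) (use has_vector_derivative_mult_right[OF der[of x y], of c] in \<open>simp add: sesqD(2)[OF q]\<close>)
  show "q' x (c *s y) = cnj c * q' x y"
    by (rule u[OF der]) (use has_vector_derivative_mult_right[OF der[of x y], of "cnj c"] in \<open>simp add: sesqD(4)[OF q]\<close>)
qed

lemma sesq_add: "sesq q \<Longrightarrow> sesq r \<Longrightarrow> sesq (\<lambda>x y. q x y + r x y)"
  unfolding sesq_def by (auto simp: algebra_simps)

section \<open>Crossings and the spectral parameter\<close>

locale jacobi_bvp = jacobi_system T P Q R \<gamma>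
  for T :: real and P Q R :: "real \<Rightarrow> complex^'n::finite^'n" and \<gamma> :: "real \<Rightarrow> complex^('n + 'n)^('n + 'n)" +
  fixes \<Lambda>\<^sub>s \<Lambda>\<^sub>e :: "(complex^('n + 'n)) set"
  assumes start: "lagrangian_subspace \<omega> \<Lambda>\<^sub>s" and endp: "lagrangian_subspace \<omega> \<Lambda>\<^sub>e"
begin

definition crossing :: "real \<Rightarrow> real \<Rightarrow> nat" where
  "crossing \<mu> t = vec.dim ((*v) (flow \<mu> t) ` \<Lambda>\<^sub>s \<inter> \<Lambda>\<^sub>D)"

definition eig :: "real \<Rightarrow> nat" where
  "eig \<mu> = vec.dim ((*v) (flow \<mu> T) ` \<Lambda>\<^sub>s \<inter> \<Lambda>\<^sub>e)"

abbreviation trans_at :: "real \<Rightarrow> real \<Rightarrow> real \<Rightarrow> bool" where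
  "trans_at s \<mu> t \<equiv> transversal s ((*v) (flow \<mu> t) ` \<Lambda>\<^sub>s)"

abbreviation hind :: "real \<Rightarrow> real \<Rightarrow> real \<Rightarrow> nat" where
  "hind s \<mu> t \<equiv> m_plus (hform s (flow \<mu> t)) \<Lambda>\<^sub>s"

abbreviation hrad :: "real \<Rightarrow> real \<Rightarrow> real \<Rightarrow> (complex^('n + 'n)) set" where
  "hrad s \<mu> t \<equiv> perp (hform s (flow \<mu> t)) \<Lambda>\<^sub>s \<Lambda>\<^sub>s"

abbreviation dind :: "real \<Rightarrow> (complex^'n \<Rightarrow> complex^('n + 'n)) \<Rightarrow> real \<Rightarrow> nat" where
  "dind s g \<mu> \<equiv> m_plus (dform s g (flow \<mu> T)) \<Lambda>\<^sub>s"

abbreviation drad :: "real \<Rightarrow> (complex^'n \<Rightarrow> complex^('n + 'n)) \<Rightarrow> real \<Rightarrow> (complex^('n + 'n)) set" where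
  "drad s g \<mu> \<equiv> perp (dform s g (flow \<mu> T)) \<Lambda>\<^sub>s \<Lambda>\<^sub>s"

lemmas sub_s = lagrangianD(1)[OF start]

section \<open>Crossings with the vertical Lagrangian in time\<close>

lemma vlin_field: "vlin (field \<mu> t)"
  by (simp add: vlin_iff field_def vel_def block_vec_add block_vec_scale vlinD[OF vlin_matrix] algebra_simps
    vec.scale_right_distrib vec.scale_right_diff_distrib vec.scale_left_commute del: transpose_matrix_vector)

lemma hform_t_derivative:
  assumes "t \<in> {0..T}" "S \<subseteq> {0..T}"
  shows "((\<lambda>t. hform s (flow \<mu> t) a b) has_vector_derivative
    herm_inner (pos (flow \<mu> t *v a)) (wmap s (field \<mu> t (flow \<mu> t *v b)))
    + herm_inner (pos (field \<mu> t (flow \<mu> t *v a))) (wmap s (flow \<mu> t *v b))) (at t within S)"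
proof -
  note f = has_vector_derivative_within_subset[OF flow_derivative[OF assms(1)] assms(2)]
  show ?thesis unfolding hform_def
    by (rule bounded_bilinear.has_vector_derivative[OF bounded_bilinear_herm_inner
      bounded_linear.has_vector_derivative[OF vlin_bounded_linear[OF vlin_pos] f]
      bounded_linear.has_vector_derivative[OF vlin_bounded_linear[OF vlin_wmap] f]])
qed

text \<open>The Legendre condition makes crossings with the vertical Lagrangian positive in time.\<close>

lemma crossing_t_local:
  assumes ab: "{a..b} \<subseteq> {0..T}" and t0: "t0 \<in> {a..b}"
    and tr: "\<And>t. t \<in> {a..b} \<Longrightarrow> trans_at s \<mu> t"
  shows "\<exists>d>0. \<forall>t\<in>{a..b}. \<bar>t - t0\<bar> < d \<longrightarrow>
     (t0 < t \<longrightarrow> hind s \<mu> t = hind s \<mu> t0 + crossing \<mu> t0 \<and> crossing \<mu> t = 0) \<and>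
     (t < t0 \<longrightarrow> hind s \<mu> t = hind s \<mu> t0 \<and> crossing \<mu> t = 0)"
proof -
  have t0T: "t0 \<in> {0..T}" using ab t0 by blast
  have sy: "symplectic (flow \<mu> t)" if "t \<in> {a..b}" for t using flow_symplectic ab that by blast
  have dim: "vec.dim (hrad s \<mu> t) = crossing \<mu> t" if "t \<in> {a..b}" for t
    unfolding crossing_def by (rule dim_perp_hform[OF sy[OF that] start tr[OF that]])
  let ?q' = "\<lambda>a b. herm_inner (pos (flow \<mu> t0 *v a)) (wmap s (field \<mu> t0 (flow \<mu> t0 *v b)))
    + herm_inner (pos (field \<mu> t0 (flow \<mu> t0 *v a))) (wmap s (flow \<mu> t0 *v b))"
  have vf: "vlin (\<lambda>a. field \<mu> t0 (flow \<mu> t0 *v a))" by (rule vlin_compose[OF vlin_field vlin_matrix])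
  have q': "sesq ?q'"
    by (intro sesq_add sesq_compose[OF sesq_herm_inner vlin_compose[OF vlin_pos vlin_matrix] vlin_compose[OF vlin_wmap vf]]
      sesq_compose[OF sesq_herm_inner vlin_compose[OF vlin_pos vf] vlin_compose[OF vlin_wmap vlin_matrix]])
  \<comment> \<open>With zero position the momentum is P \<xi>', and the derivative of the form
    reduces to the product of \<xi>' with P \<xi>'; the term with \<open>s\<close> drops
    out.\<close>
  have pos': "Re (?q' x x) > 0" if x: "x \<in> hrad s \<mu> t0" "x \<noteq> 0" for x
  proof -
    let ?z = "flow \<mu> t0 *v x"
    have pz: "pos ?z = 0" using x(1) perp_hform[OF sy[OF t0] start tr[OF t0]] by blast
    have "?z \<noteq> 0" using symplectic_inj[OF sy[OF t0]] x(2) by blast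
    then have mz: "mom ?z \<noteq> 0" using pz by (auto simp: block_vec_eq_iff)
    have m: "mom ?z = P t0 *v vel t0 ?z" using mom_eq[OF t0T, of ?z] pz by (simp add: vlinD(3)[OF vlin_matrix])
    then have "vel t0 ?z \<noteq> 0" using mz by (auto simp: vlinD(3)[OF vlin_matrix])
    from P_pos[OF t0T this] have "Re (herm_inner (vel t0 ?z) (mom ?z)) > 0"
      unfolding m[symmetric] using P_herm[OF t0T, of "vel t0 ?z" "vel t0 ?z"] m by simp
    then show ?thesis by (simp add: pz field_def wmap_def herm_inner_simps)
  qed
  obtain d where d: "d > 0" "\<And>t. t \<in> {a..b} \<Longrightarrow> \<bar>t - t0\<bar> < d \<Longrightarrow>
     (t0 < t \<longrightarrow> hind s \<mu> t = hind s \<mu> t0 + vec.dim (hrad s \<mu> t0)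
        \<and> hrad s \<mu> t = {0}) \<and>
     (t < t0 \<longrightarrow> hind s \<mu> t = hind s \<mu> t0 \<and> hrad s \<mu> t = {0})"
    using crossing_local[where q = "\<lambda>t. hform s (flow \<mu> t)" and S = "{a..b}", OF sub_s sesq_hform herm_on_hform[OF sy start] q' t0
        hform_t_derivative[OF t0T ab] pos'] by blast
  have zero: "crossing \<mu> t = 0" if "t \<in> {a..b}" "hrad s \<mu> t = {0}" for t
    using dim[OF that(1)] that(2) by simp
  show ?thesis
    by (rule exI[of _ d]) (use d dim[OF t0] zero in auto)
qed

section \<open>Continuous dependence on the spectral parameter\<close>

lemma flow_isCont: "t \<in> {0..T} \<Longrightarrow> isCont (\<lambda>\<mu>. flow \<mu> t) \<mu>0"
proof -
  assume t: "t \<in> {0..T}"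
  define M where "M = \<bar>\<mu>0\<bar> + 1"
  have "continuous_on {-M..M} (\<lambda>\<mu>. (\<lambda>(\<mu>, t). flow \<mu> t) (\<mu>, t))"
    by (rule continuous_on_compose2[OF flow_continuous[of M]]) (use t in \<open>auto intro!: continuous_intros\<close>)
  moreover have "\<mu>0 \<in> interior {-M..M}" unfolding M_def by (simp add: abs_if)
  ultimately show ?thesis using continuous_on_interior by force
qed

lemma hform_tendsto:
  "t \<in> {0..T} \<Longrightarrow> ((\<lambda>\<mu>. hform s (flow \<mu> t) a b) \<longlongrightarrow> hform s (flow \<mu>0 t) a b) (nhds \<mu>0)"
proof -
  assume t: "t \<in> {0..T}"
  have "((\<lambda>\<mu>. flow \<mu> t) \<longlongrightarrow> flow \<mu>0 t) (nhds \<mu>0)"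
    using flow_isCont[OF t, of \<mu>0] tendsto_at_iff_tendsto_nhds[of "\<lambda>\<mu>. flow \<mu> t" \<mu>0] unfolding isCont_def by blast
  from bounded_linear.tendsto[OF bounded_bilinear.bounded_linear_left[OF bounded_bilinear_matrix_vector_mult] this]
  have v: "((\<lambda>\<mu>. flow \<mu> t *v c) \<longlongrightarrow> flow \<mu>0 t *v c) (nhds \<mu>0)" for c .
  show ?thesis unfolding hform_def
    by (rule bounded_bilinear.tendsto[OF bounded_bilinear_herm_inner
      bounded_linear.tendsto[OF vlin_bounded_linear[OF vlin_pos] v]
      bounded_linear.tendsto[OF vlin_bounded_linear[OF vlin_wmap] v]])
qed

text \<open>On \<open>\<Lambda>\<^sub>s\<close> the flow followed by \<open>wmap s\<close> is
  bounded below at the given point, and the flow is jointly continuous. Openness in both variables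
  at once lets one chart serve a whole time interval for all nearby \<mu>.\<close>

lemma transversal_open:
  assumes t0: "t0 \<in> {0..T}" and tr: "trans_at s \<mu>0 t0"
  shows "\<exists>d>0. \<forall>\<mu> t. \<bar>\<mu> - \<mu>0\<bar> < d \<and> t \<in> {0..T} \<and> \<bar>t - t0\<bar> < d \<longrightarrow> trans_at s \<mu> t"
proof -
  let ?w = "\<lambda>\<mu> t a. wmap s (flow \<mu> t *v a)"
  have vw: "vlin (?w \<mu> t)" for \<mu> t by (rule vlin_compose[OF vlin_wmap vlin_matrix])
  have "Re (herm_inner (?w \<mu>0 t0 a) (?w \<mu>0 t0 a)) > 0" if "a \<in> \<Lambda>\<^sub>s" "a \<noteq> 0" for a
  proof -
    have "flow \<mu>0 t0 *v a \<noteq> 0" using symplectic_inj[OF flow_symplectic[OF t0]] that(2) by blast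
    then have "?w \<mu>0 t0 a \<noteq> 0" using tr that(1) unfolding transversal_def by blast
    then show ?thesis by (simp add: herm_inner_self)
  qed
  from pos_def_bound[OF sesq_compose[OF sesq_herm_inner vw vw] sub_s this]
  obtain c where c: "c > 0" "\<And>a. a \<in> \<Lambda>\<^sub>s \<Longrightarrow> Re (herm_inner (?w \<mu>0 t0 a) (?w \<mu>0 t0 a)) \<ge> c * (norm a)^2" by blast
  have low: "norm (?w \<mu>0 t0 a) \<ge> sqrt c * norm a" if "a \<in> \<Lambda>\<^sub>s" for a
  proof -
    have "sqrt (c * (norm a)^2) \<le> sqrt ((norm (?w \<mu>0 t0 a))^2)"
      using c(2)[OF that] by (intro real_sqrt_le_mono) (simp add: herm_inner_self)
    then show ?thesis by (simp add: real_sqrt_mult)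
  qed
  obtain K1 where K1: "K1 > 0" "\<And>x :: complex^('n + 'n). norm (wmap s x) \<le> norm x * K1"
    using bounded_linear.pos_bounded[OF vlin_bounded_linear[OF vlin_wmap]] by blast
  obtain K2 where K2: "K2 > 0" "\<And>(A :: complex^('n + 'n)^('n + 'n)) x. norm (A *v x) \<le> norm A * norm x * K2"
    using bounded_bilinear.pos_bounded[OF bounded_bilinear_matrix_vector_mult] by blast
  \<comment> \<open>A change of the flow by less than \<open>e\<close> moves the composed map by
    less than its lower bound \<open>sqrt c\<close>.\<close>
  define e where "e = sqrt c / (K1 * K2)"
  have e: "e > 0" unfolding e_def using c K1 K2 by simp
  define M where "M = \<bar>\<mu>0\<bar> + 1"
  have "(\<mu>0, t0) \<in> {-M..M} \<times> {0..T}" using t0 unfolding M_def by auto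
  then obtain d where d: "d > 0" "\<And>x. x \<in> {-M..M} \<times> {0..T} \<Longrightarrow> dist x (\<mu>0, t0) < d \<Longrightarrow> dist (flow (fst x) (snd x)) (flow \<mu>0 t0) < e"
    using flow_continuous[of M] e unfolding continuous_on_iff case_prod_unfold by fastforce
  have "trans_at s \<mu> t" if h: "\<bar>\<mu> - \<mu>0\<bar> < min 1 (d / 2)" "t \<in> {0..T}" "\<bar>t - t0\<bar> < min 1 (d / 2)" for \<mu> t
  proof -
    have "dist (\<mu>, t) (\<mu>0, t0) \<le> \<bar>\<mu> - \<mu>0\<bar> + \<bar>t - t0\<bar>"
      unfolding dist_Pair_Pair dist_real_def using sqrt_sum_squares_le_sum_abs[of "\<bar>\<mu> - \<mu>0\<bar>" "\<bar>t - t0\<bar>"] by simp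
    then have "dist (\<mu>, t) (\<mu>0, t0) < d" using h by linarith
    moreover have "(\<mu>, t) \<in> {-M..M} \<times> {0..T}" using h unfolding M_def by auto
    ultimately have lt: "norm (flow \<mu> t - flow \<mu>0 t0) < e" using d(2)[of "(\<mu>, t)"] by (simp add: dist_norm)
    show ?thesis unfolding transversal_def
    proof (intro ballI impI)
      fix z assume "z \<in> (*v) (flow \<mu> t) ` \<Lambda>\<^sub>s" "wmap s z = 0"
      then obtain a where a: "a \<in> \<Lambda>\<^sub>s" "z = flow \<mu> t *v a" "?w \<mu> t a = 0" by auto
      have "?w \<mu>0 t0 a = ?w \<mu> t a - wmap s ((flow \<mu> t - flow \<mu>0 t0) *v a)"
        by (simp add: matrix_vector_mult_diff_rdistrib vlinD(4)[OF vlin_wmap])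
      then have "norm (?w \<mu>0 t0 a) = norm (wmap s ((flow \<mu> t - flow \<mu>0 t0) *v a))" using a(3) by simp
      also have "\<dots> \<le> norm (flow \<mu> t - flow \<mu>0 t0) * norm a * K2 * K1"
        using K1(2)[of "(flow \<mu> t - flow \<mu>0 t0) *v a"] mult_right_mono[OF K2(2)[of "flow \<mu> t - flow \<mu>0 t0" a], of K1] K1(1)
        by linarith
      finally have le: "sqrt c * norm a \<le> norm (flow \<mu> t - flow \<mu>0 t0) * norm a * K2 * K1" using low[OF a(1)] by linarith
      have "a = 0"
      proof (rule ccontr)
        assume "a \<noteq> 0"
        then have "norm (flow \<mu> t - flow \<mu>0 t0) * (norm a * (K2 * K1)) < e * (norm a * (K2 * K1))"
          using lt K1(1) K2(1) by (intro mult_strict_right_mono) auto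
        also have "\<dots> = sqrt c * norm a" using K1(1) K2(1) by (simp add: e_def)
        finally show False using le by (simp add: mult_ac)
      qed
      then show "z = 0" using a(2) by (simp add: vlinD(3)[OF vlin_matrix])
    qed
  qed
  then show ?thesis using d(1) by (intro exI[of _ "min 1 (d / 2)"]) auto
qed

lemma transversal_open_end:
  "trans_at s \<mu>0 T \<Longrightarrow> \<exists>d>0. \<forall>\<mu>. \<bar>\<mu> - \<mu>0\<bar> < d \<longrightarrow> trans_at s \<mu> T"
proof -
  assume tr: "trans_at s \<mu>0 T"
  have TT: "T \<in> {0..T}" using T_pos by simp
  obtain d where d: "d > 0" "\<forall>\<mu> t. \<bar>\<mu> - \<mu>0\<bar> < d \<and> t \<in> {0..T} \<and> \<bar>t - T\<bar> < d \<longrightarrow> trans_at s \<mu> t"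
    using transversal_open[OF TT tr] by blast
  then show ?thesis using TT by (intro exI[of _ d]) simp
qed

lemma chart_parameter: "t \<in> {0..T} \<Longrightarrow> \<exists>s. trans_at s \<mu> t \<and> transversal s \<Lambda>\<^sub>e"
  using common_transversal[OF lagrangian_image[OF flow_symplectic start] endp] by blast

text \<open>A chart at \<open>t0\<close> remains valid nearby, and positivity of crossings applies
  in it. Clipping the interval to \<open>{0..T}\<close> covers the end points.\<close>

lemma crossing_isolated:
  assumes t0: "t0 \<in> {0..T}"
  shows "\<exists>d>0. \<forall>t\<in>{0..T}. \<bar>t - t0\<bar> < d \<longrightarrow> t \<noteq> t0 \<longrightarrow> crossing \<mu> t = 0"
proof -
  obtain s where s: "trans_at s \<mu> t0" using chart_parameter[OF t0] by blast
  obtain d where d: "d > 0" "\<And>t. t \<in> {0..T} \<Longrightarrow> \<bar>t - t0\<bar> < d \<Longrightarrow> trans_at s \<mu> t"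
    using transversal_open[OF t0 s] by fastforce
  define a b where "a = max 0 (t0 - d / 2)" and "b = min T (t0 + d / 2)"
  have ab: "{a..b} \<subseteq> {0..T}" "t0 \<in> {a..b}" using t0 d(1) unfolding a_def b_def by auto
  have "trans_at s \<mu> t" if "t \<in> {a..b}" for t
  proof (rule d(2))
    show "\<bar>t - t0\<bar> < d" using that d(1) unfolding a_def b_def by auto
  qed (use that ab in blast)
  from crossing_t_local[OF ab this] obtain d' where d': "d' > 0" "\<And>t. t \<in> {a..b} \<Longrightarrow> \<bar>t - t0\<bar> < d' \<Longrightarrow>
     (t0 < t \<longrightarrow> crossing \<mu> t = 0) \<and> (t < t0 \<longrightarrow> crossing \<mu> t = 0)" by blast
  have "crossing \<mu> t = 0" if t: "t \<in> {0..T}" "\<bar>t - t0\<bar> < min d' (d / 2)" "t \<noteq> t0" for t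
  proof -
    have "\<bar>t - t0\<bar> < d / 2" using t(2) by simp
    then have "t0 - d / 2 \<le> t" "t \<le> t0 + d / 2" by linarith+
    then have "t \<in> {a..b}" using t(1) unfolding a_def b_def by simp
    then show ?thesis using d'(2)[of t] t by (cases "t0 < t") auto
  qed
  then show ?thesis using d' d by (intro exI[of _ "min d' (d / 2)"]) auto
qed

lemma finite_crossings: "finite {t\<in>{0..T}. crossing \<mu> t \<noteq> 0}"
proof -
  define P where "P u v \<longleftrightarrow> finite {t\<in>{u..v} \<inter> {0..T}. crossing \<mu> t \<noteq> 0}" for u v
  have "P 0 T"
  proof (induction rule: Bolzano[OF less_imp_le[OF T_pos]])
    case (1 u v w)
    have "{t\<in>{u..w} \<inter> {0..T}. crossing \<mu> t \<noteq> 0} \<subseteq> {t\<in>{u..v} \<inter> {0..T}. crossing \<mu> t \<noteq> 0} \<union> {t\<in>{v..w} \<inter> {0..T}. crossing \<mu> t \<noteq> 0}"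
      by auto
    then show ?case using 1(1,2) unfolding P_def by (meson finite_UnI finite_subset)
  next
    case (2 x)
    obtain d where d: "d > 0" "\<And>t. t \<in> {0..T} \<Longrightarrow> \<bar>t - x\<bar> < d \<Longrightarrow> t \<noteq> x \<Longrightarrow> crossing \<mu> t = 0"
      using crossing_isolated[of x \<mu>] 2 by auto
    have "P u v" if "u \<le> x" "x \<le> v" "v - u < d" for u v
    proof -
      have "{t\<in>{u..v} \<inter> {0..T}. crossing \<mu> t \<noteq> 0} \<subseteq> {x}"
      proof
        fix t assume t: "t \<in> {t\<in>{u..v} \<inter> {0..T}. crossing \<mu> t \<noteq> 0}"
        then have "\<bar>t - x\<bar> < d" using that by auto
        then show "t \<in> {x}" using d(2)[of t] t by auto
      qed
      then show ?thesis unfolding P_def by (rule finite_subset) simp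
    qed
    then show ?case using d(1) by blast
  qed
  then show ?thesis unfolding P_def by simp
qed

text \<open>The interval is half-open, so that counts add up under subdivision and a crossing is
  charged to the interval on which the chart index jumps.\<close>

definition cnt :: "real \<Rightarrow> real \<Rightarrow> real \<Rightarrow> nat" where
  "cnt \<mu> a b = (\<Sum>t | a \<le> t \<and> t < b \<and> crossing \<mu> t \<noteq> 0. crossing \<mu> t)"

lemma finite_cnt: "0 \<le> a \<Longrightarrow> b \<le> T \<Longrightarrow> finite {t. a \<le> t \<and> t < b \<and> crossing \<mu> t \<noteq> 0}"
  by (rule finite_subset[OF _ finite_crossings[of \<mu>]]) auto

lemma cnt_split:
  assumes "0 \<le> a" "a \<le> b" "b \<le> c" "c \<le> T"
  shows "cnt \<mu> a c = cnt \<mu> a b + cnt \<mu> b c"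
proof -
  have "{t. a \<le> t \<and> t < c \<and> crossing \<mu> t \<noteq> 0} = {t. a \<le> t \<and> t < b \<and> crossing \<mu> t \<noteq> 0} \<union> {t. b \<le> t \<and> t < c \<and> crossing \<mu> t \<noteq> 0}"
    using assms by auto
  then show ?thesis unfolding cnt_def
    using finite_cnt[of a b \<mu>] finite_cnt[of b c \<mu>] assms by (simp add: sum.union_disjoint disjoint_iff)
qed

lemma cnt_chart:
  assumes "a \<le> b" "{a..b} \<subseteq> {0..T}" "\<And>t. t \<in> {a..b} \<Longrightarrow> trans_at s \<mu> t"
  shows "hind s \<mu> b = hind s \<mu> a + cnt \<mu> a b"
  unfolding cnt_def
  using jump_sum[OF assms(1), of "\<lambda>t. hind s \<mu> t" "crossing \<mu>"] crossing_t_local[OF assms(2) _ assms(3)] by blast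

text \<open>Without a crossing at \<open>\<mu>0\<close> the form is nondegenerate, so its index is
  locally constant in \<mu>.\<close>

lemma hform_index_stable:
  assumes t: "t \<in> {0..T}" and tr: "trans_at s \<mu>0 t" and z: "crossing \<mu>0 t = 0"
  shows "\<forall>\<^sub>F \<mu> in nhds \<mu>0. hind s \<mu> t = hind s \<mu>0 t"
proof -
  have "vec.dim (hrad s \<mu>0 t) = 0"
    using dim_perp_hform[OF flow_symplectic[OF t] start tr] z unfolding crossing_def by simp
  then have nd: "hrad s \<mu>0 t = {0}"
    using vec.subspace_0[OF subspace_perp[OF sesq_hform[of s "flow \<mu>0 t"] sub_s]] by auto
  have "\<forall>\<^sub>F \<mu> in nhds \<mu>0. hind s \<mu> t = hind s \<mu>0 t \<and> hrad s \<mu> t = {0}"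
    by (rule index_stable[OF sub_s sesq_hform herm_on_hform[OF flow_symplectic[OF t] start] nd sesq_hform herm_on_hform[OF flow_symplectic[OF t] start] hform_tendsto[OF t]])
  then show ?thesis by (rule eventually_mono) blast
qed

text \<open>Near \<open>\<mu>\<^sub>0\<close> the crossings with the vertical Lagrangian enter or leave \<open>{0..T}\<close> only through
  the end point \<open>T\<close>, where a chart index records them.\<close>

lemma cnt_local:
  fixes \<mu>0 :: real
  shows "\<exists>s c. trans_at s \<mu>0 T \<and> transversal s \<Lambda>\<^sub>e \<and>
    (\<forall>\<^sub>F \<mu> in nhds \<mu>0. int (cnt \<mu> 0 T) = int (hind s \<mu> T) + c)"
proof -
  obtain \<sigma> where \<sigma>: "\<And>t. t \<in> {0..T} \<Longrightarrow> trans_at (\<sigma> t) \<mu>0 t \<and> transversal (\<sigma> t) \<Lambda>\<^sub>e"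
  proof -
    have "\<forall>t\<in>{0..T}. \<exists>s. trans_at s \<mu>0 t \<and> transversal s \<Lambda>\<^sub>e" using chart_parameter by blast
    from bchoice[OF this] show ?thesis using that by blast
  qed
  \<comment> \<open>At each time the index is taken in the chart chosen for that time, so that
    adjacent intervals share the value at their common end and it cancels.\<close>
  define e where "e t \<mu> = int (hind (\<sigma> t) \<mu> t)" for t \<mu>
  define Pr where "Pr a b \<longleftrightarrow> (0 \<le> a \<and> b \<le> T \<longrightarrow> (\<exists>c. \<forall>\<^sub>F \<mu> in nhds \<mu>0. int (cnt \<mu> a b) = e b \<mu> - e a \<mu> + c))" for a b
  have "Pr 0 T"
  proof (induction rule: Bolzano[OF less_imp_le[OF T_pos]])
    case (1 u v w)
    show ?case unfolding Pr_def
    proof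
      assume r: "0 \<le> u \<and> w \<le> T"
      obtain c1 where c1: "\<forall>\<^sub>F \<mu> in nhds \<mu>0. int (cnt \<mu> u v) = e v \<mu> - e u \<mu> + c1" using 1 r unfolding Pr_def by auto
      obtain c2 where c2: "\<forall>\<^sub>F \<mu> in nhds \<mu>0. int (cnt \<mu> v w) = e w \<mu> - e v \<mu> + c2" using 1 r unfolding Pr_def by auto
      have "\<forall>\<^sub>F \<mu> in nhds \<mu>0. int (cnt \<mu> u w) = e w \<mu> - e u \<mu> + (c1 + c2)"
        using c1 c2 by eventually_elim (use cnt_split[of u v w] 1(3,4) r in auto)
      then show "\<exists>c. \<forall>\<^sub>F \<mu> in nhds \<mu>0. int (cnt \<mu> u w) = e w \<mu> - e u \<mu> + c" by blast
    qed
  next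
    case (2 x)
    then have x: "x \<in> {0..T}" by simp
    obtain d1 where d1: "d1 > 0" "\<And>\<mu> t. \<bar>\<mu> - \<mu>0\<bar> < d1 \<Longrightarrow> t \<in> {0..T} \<Longrightarrow> \<bar>t - x\<bar> < d1 \<Longrightarrow> trans_at (\<sigma> x) \<mu> t"
      using transversal_open[OF x, of "\<sigma> x" \<mu>0] \<sigma>[OF x] by metis
    obtain d2 where d2: "d2 > 0" "\<And>t. t \<in> {0..T} \<Longrightarrow> \<bar>t - x\<bar> < d2 \<Longrightarrow> t \<noteq> x \<Longrightarrow> crossing \<mu>0 t = 0"
      using crossing_isolated[OF x, of \<mu>0] by metis
    \<comment> \<open>At \<open>u = x\<close> the two charts coincide. Elsewhere \<open>u\<close>
      carries no crossing at \<open>\<mu>0\<close>, so both indices are locally constant in \<mu>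
      and so is their difference.\<close>
    have chart_change: "\<exists>c. \<forall>\<^sub>F \<mu> in nhds \<mu>0. int (hind (\<sigma> x) \<mu> u) = e u \<mu> + c"
      if u: "u \<in> {0..T}" "\<bar>u - x\<bar> < min d1 d2" for u
    proof (cases "u = x")
      case True
      then show ?thesis by (intro exI[of _ 0]) (simp add: e_def)
    next
      case False
      then have z: "crossing \<mu>0 u = 0" using d2(2) u by simp
      have tr: "trans_at (\<sigma> x) \<mu>0 u" using d1 u by simp
      have "\<forall>\<^sub>F \<mu> in nhds \<mu>0. int (hind (\<sigma> x) \<mu> u) = e u \<mu> + (int (hind (\<sigma> x) \<mu>0 u) - e u \<mu>0)"
        using hform_index_stable[OF u(1) tr z] hform_index_stable[OF u(1) _ z, of "\<sigma> u"] \<sigma>[OF u(1)]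
        unfolding e_def by (auto elim: eventually_elim2)
      then show ?thesis by blast
    qed
    have "Pr a b" if ab: "a \<le> x" "x \<le> b" "b - a < min d1 d2" for a b
      unfolding Pr_def
    proof
      assume r: "0 \<le> a \<and> b \<le> T"
      obtain c1 where c1: "\<forall>\<^sub>F \<mu> in nhds \<mu>0. int (hind (\<sigma> x) \<mu> a) = e a \<mu> + c1"
        using chart_change[of a] ab r by auto
      obtain c2 where c2: "\<forall>\<^sub>F \<mu> in nhds \<mu>0. int (hind (\<sigma> x) \<mu> b) = e b \<mu> + c2"
        using chart_change[of b] ab r by auto
      have "\<forall>\<^sub>F \<mu> in nhds \<mu>0. dist \<mu> \<mu>0 < d1" using d1(1) by (metis eventually_nhds_metric)
      then have near: "\<forall>\<^sub>F \<mu> in nhds \<mu>0. \<bar>\<mu> - \<mu>0\<bar> < d1" by (simp add: dist_real_def)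
      have "\<forall>\<^sub>F \<mu> in nhds \<mu>0. int (cnt \<mu> a b) = e b \<mu> - e a \<mu> + (c2 - c1)"
        using c1 c2 near
      proof eventually_elim
        case (elim \<mu>)
        have "hind (\<sigma> x) \<mu> b = hind (\<sigma> x) \<mu> a + cnt \<mu> a b"
        proof (rule cnt_chart)
          fix t assume "t \<in> {a..b}"
          then show "trans_at (\<sigma> x) \<mu> t" using d1(2)[OF elim(3), of t] ab r by auto
        qed (use ab r in auto)
        then show ?case using elim(1,2) by linarith
      qed
      then show "\<exists>c. \<forall>\<^sub>F \<mu> in nhds \<mu>0. int (cnt \<mu> a b) = e b \<mu> - e a \<mu> + c" by blast
    qed
    then show ?case using d1(1) d2(1) by (intro exI[of _ "min d1 d2"]) auto
  qed
  then obtain c where c: "\<forall>\<^sub>F \<mu> in nhds \<mu>0. int (cnt \<mu> 0 T) = e T \<mu> - e 0 \<mu> + c"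
    unfolding Pr_def by auto
  \<comment> \<open>The flow starts at the identity for every \<mu>, so the left end point
    contributes a constant.\<close>
  have "e 0 \<mu> = e 0 \<mu>0" for \<mu> by (simp add: e_def flow_initial)
  then have "\<forall>\<^sub>F \<mu> in nhds \<mu>0. int (cnt \<mu> 0 T) = int (hind (\<sigma> T) \<mu> T) + (c - e 0 \<mu>0)"
    using c unfolding e_def[of T] by (auto elim!: eventually_mono)
  moreover have "T \<in> {0..T}" using T_pos by simp
  ultimately show ?thesis using \<sigma>[of T] by blast
qed

text \<open>The right-hand side of the index formula with \<open>R\<close> replaced by \<open>R - \<mu>\<close>.\<close>

definition total :: "real \<Rightarrow> nat" where
  "total \<mu> = (\<Sum>t | 0 < t \<and> t < T \<and> crossing \<mu> t \<noteq> 0. crossing \<mu> t) + triple_index \<omega> ((*v) (flow \<mu> T) ` \<Lambda>\<^sub>s) \<Lambda>\<^sub>e \<Lambda>\<^sub>D"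

text \<open>A crossing at time 0 is counted by \<open>cnt\<close> but absent from the index formula.
  Its multiplicity is the same for all \<mu>, because the flow starts at the identity.\<close>

lemma cnt_zero: "cnt \<mu> 0 T = (\<Sum>t | 0 < t \<and> t < T \<and> crossing \<mu> t \<noteq> 0. crossing \<mu> t) + crossing 0 0"
proof -
  have 00: "crossing \<mu> 0 = crossing 0 0" by (simp add: crossing_def flow_initial)
  have fin: "finite {t. 0 < t \<and> t < T \<and> crossing \<mu> t \<noteq> 0}"
    by (rule finite_subset[OF _ finite_cnt[of 0 T \<mu>]]) auto
  show ?thesis
  proof (cases "crossing \<mu> 0 = 0")
    case True
    then have "{t. 0 \<le> t \<and> t < T \<and> crossing \<mu> t \<noteq> 0} = {t. 0 < t \<and> t < T \<and> crossing \<mu> t \<noteq> 0}"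
      by (auto simp: order.order_iff_strict)
    then show ?thesis using True 00 by (simp add: cnt_def)
  next
    case False
    then have "{t. 0 \<le> t \<and> t < T \<and> crossing \<mu> t \<noteq> 0} = insert 0 {t. 0 < t \<and> t < T \<and> crossing \<mu> t \<noteq> 0}"
      using T_pos by (auto simp: order.order_iff_strict)
    then show ?thesis using fin 00 by (simp add: cnt_def)
  qed
qed

text \<open>The chart index at time T enters the crossing count with a plus sign and the triple
  index with a minus sign, so it cancels. What remains is the form that compares the two Lagrangians
  at the end point.\<close>

lemma total_local:
  "\<exists>s g c. trans_at s \<mu>0 T \<and> chart s \<Lambda>\<^sub>e g \<and>
    (\<forall>\<^sub>F \<mu> in nhds \<mu>0. int (total \<mu>) = int (dind s g \<mu>) + c)"
proof -
  have TT: "T \<in> {0..T}" using T_pos by simp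
  obtain s c where s: "trans_at s \<mu>0 T" "transversal s \<Lambda>\<^sub>e"
    and c: "\<forall>\<^sub>F \<mu> in nhds \<mu>0. int (cnt \<mu> 0 T) = int (hind s \<mu> T) + c"
    using cnt_local[of \<mu>0] by blast
  obtain g where g: "chart s \<Lambda>\<^sub>e g" using lagrangian_chart_exists[OF endp s(2)] by blast
  obtain d where d: "d > 0" "\<And>\<mu>. \<bar>\<mu> - \<mu>0\<bar> < d \<Longrightarrow> trans_at s \<mu> T"
    using transversal_open_end[OF s(1)] by blast
  have "\<forall>\<^sub>F \<mu> in nhds \<mu>0. dist \<mu> \<mu>0 < d" using d(1) by (metis eventually_nhds_metric)
  then have near: "\<forall>\<^sub>F \<mu> in nhds \<mu>0. \<bar>\<mu> - \<mu>0\<bar> < d" by (simp add: dist_real_def)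
  define k where "k = m_plus (\<lambda>u v. herm_inner (pos (g u)) v) UNIV"
  have "\<forall>\<^sub>F \<mu> in nhds \<mu>0. int (total \<mu>) = int (dind s g \<mu>) + (c - int (crossing 0 0) + int k)"
    using c near
  proof eventually_elim
    case (elim \<mu>)
    have "triple_index \<omega> ((*v) (flow \<mu> T) ` \<Lambda>\<^sub>s) \<Lambda>\<^sub>e \<Lambda>\<^sub>D + hind s \<mu> T
      = dind s g \<mu> + k"
      unfolding k_def by (rule triple_index_chart[OF flow_symplectic[OF TT] start d(2)[OF elim(2)] endp g])
    then show ?case using elim(1) cnt_zero[of \<mu>] unfolding total_def by linarith
  qed
  then show ?thesis using s(1) g by blast
qed

end

section \<open>Differentiation in the spectral parameter\<close>

context jacobi_system
begin

lemma pos_integral_isCont: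
  "isCont (\<lambda>\<mu>. integral {0..T} (\<lambda>t. herm_inner (pos (flow \<mu> t *v a)) (pos (flow \<mu>0 t *v b)))) \<mu>0"
proof -
  define M where "M = \<bar>\<mu>0\<bar> + 1"
  have c: "continuous_on ({-M..M} \<times> {0..T}) (\<lambda>x. flow (fst x) (snd x))"
    using flow_continuous[of M] by (simp add: case_prod_unfold)
  have c0: "continuous_on ({-M..M} \<times> {0..T}) (\<lambda>x. flow \<mu>0 (snd x))"
    by (rule continuous_on_compose2[OF c, of _ "\<lambda>x. (\<mu>0, snd x)", simplified]) (auto simp: M_def intro!: continuous_intros)
  have p: "continuous_on S (\<lambda>x. pos (A x *v v))" if "continuous_on S A" for S :: "(real \<times> real) set" and A v
    by (rule bounded_linear.continuous_on[OF vlin_bounded_linear[OF vlin_pos] matrix_vector_mult_continuous_on[OF that continuous_on_const]])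
  have "continuous_on ({-M..M} \<times> cbox 0 T) (\<lambda>(\<mu>, t). herm_inner (pos (flow \<mu> t *v a)) (pos (flow \<mu>0 t *v b)))"
    using bounded_bilinear.continuous_on[OF bounded_bilinear_herm_inner p[OF c] p[OF c0]] by (simp add: case_prod_unfold)
  from integral_continuous_on_param[OF this]
  have "continuous_on {-M..M} (\<lambda>\<mu>. integral {0..T} (\<lambda>t. herm_inner (pos (flow \<mu> t *v a)) (pos (flow \<mu>0 t *v b))))" by simp
  moreover have "\<mu>0 \<in> interior {-M..M}" unfolding M_def by (simp add: abs_if)
  ultimately show ?thesis by (rule continuous_on_interior)
qed

text \<open>Coordinates are pairings with \<omega>, so convergence of vectors can be tested through
  \<omega>.\<close>

lemma omega_axis:
  "z $ Inl i = \<omega> z (block_vec 0 (axis i 1))" "z $ Inr i = - \<omega> z (block_vec (axis i 1) 0)"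
  for z :: "complex^('n + 'n)"
proof -
  have "herm_inner v (axis i 1) = v $ i" for v :: "complex^'n"
    by (simp add: herm_inner_def axis_def if_distrib cong: if_cong)
  moreover have "z $ Inl i = mom z $ i" "z $ Inr i = pos z $ i" by (simp_all add: mom_def pos_def)
  ultimately show "z $ Inl i = \<omega> z (block_vec 0 (axis i 1))" "z $ Inr i = - \<omega> z (block_vec (axis i 1) 0)"
    by (simp_all add: omega_eq herm_inner_simps)
qed

text \<open>By \<open>omega_flow\<close> the pairing of the difference quotient with
  \<open>flow \<mu>0 T *v b\<close> is exactly minus the L2 product of the two solutions. These
  vectors exhaust the space and the product is continuous in \<mu>, so the quotient converges and
  its limit has the limiting pairings.\<close>

lemma flow_mu_derivative:
  "\<exists>d. ((\<lambda>\<mu>. flow \<mu> T *v a) has_vector_derivative d) (at \<mu>0) \<and>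
    (\<forall>b. \<omega> d (flow \<mu>0 T *v b) = - integral {0..T} (\<lambda>t. herm_inner (pos (flow \<mu>0 t *v a)) (pos (flow \<mu>0 t *v b))))"
proof -
  have TT: "T \<in> {0..T}" using T_pos by simp
  define I where "I \<mu> b = integral {0..T} (\<lambda>t. herm_inner (pos (flow \<mu> t *v a)) (pos (flow \<mu>0 t *v b)))" for \<mu> b
  define u where "u \<mu> = (1 / (\<mu> - \<mu>0)) *\<^sub>R (flow \<mu> T *v a - flow \<mu>0 T *v a)" for \<mu>
  have ou: "\<omega> (u \<mu>) (flow \<mu>0 T *v b) = - I \<mu> b" if "\<mu> \<noteq> \<mu>0" for \<mu> b
  proof -
    have K: "complex_of_real \<mu> - complex_of_real \<mu>0 \<noteq> 0" using that by simp
    have "\<omega> (u \<mu>) (flow \<mu>0 T *v b) = (\<omega> (flow \<mu> T *v a) (flow \<mu>0 T *v b) - \<omega> a b) / (complex_of_real \<mu> - complex_of_real \<mu>0)"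
      using flow_symplectic[OF TT, of \<mu>0]
      by (simp add: u_def scaleR_eq_vector_scalar sesqD[OF sesq_omega] symplectic_def diff_divide_distrib)
    also have "\<dots> = - I \<mu> b" unfolding omega_flow[OF TT] I_def using K by (simp add: field_simps)
    finally show ?thesis .
  qed
  define inv where "inv w = matrix_inv (flow \<mu>0 T) *v w" for w
  have inv: "flow \<mu>0 T *v inv w = w" for w
    unfolding inv_def by (rule matrix_inv_works(3)[OF symplectic_invertible[OF flow_symplectic[OF TT]]])
  have lim: "((\<lambda>\<mu>. \<omega> (u \<mu>) w) \<longlongrightarrow> - I \<mu>0 (inv w)) (at \<mu>0)" for w
  proof -
    have "((\<lambda>\<mu>. - I \<mu> (inv w)) \<longlongrightarrow> - I \<mu>0 (inv w)) (at \<mu>0)"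
      using pos_integral_isCont[where a = a and b = "inv w" and ?\<mu>0.0 = \<mu>0] unfolding isCont_def I_def[abs_def] by (rule tendsto_minus)
    moreover have "\<forall>\<^sub>F \<mu> in at \<mu>0. - I \<mu> (inv w) = \<omega> (u \<mu>) w"
      using ou[of _ "inv w"] unfolding inv by (auto simp: eventually_at_filter)
    ultimately show ?thesis by (rule Lim_transform_eventually)
  qed
  \<comment> \<open>The only candidate: its coordinates are the limits of the pairings selected by
    \<open>omega_axis\<close>.\<close>
  define d :: "complex^('n + 'n)" where
    "d = (\<chi> k. case k of Inl i \<Rightarrow> - I \<mu>0 (inv (block_vec 0 (axis i 1))) | Inr i \<Rightarrow> I \<mu>0 (inv (block_vec (axis i 1) 0)))"
  have ud: "(u \<longlongrightarrow> d) (at \<mu>0)"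
  proof (rule vec_tendstoI)
    fix k :: "'n + 'n"
    show "((\<lambda>\<mu>. u \<mu> $ k) \<longlongrightarrow> d $ k) (at \<mu>0)"
    proof (cases k)
      case (Inl i)
      have "((\<lambda>\<mu>. u \<mu> $ Inl i) \<longlongrightarrow> - I \<mu>0 (inv (block_vec 0 (axis i 1)))) (at \<mu>0)"
        unfolding omega_axis(1) by (rule lim)
      then show ?thesis by (simp add: Inl d_def)
    next
      case (Inr i)
      have "((\<lambda>\<mu>. u \<mu> $ Inr i) \<longlongrightarrow> - (- I \<mu>0 (inv (block_vec (axis i 1) 0)))) (at \<mu>0)"
        unfolding omega_axis(2) by (rule tendsto_minus[OF lim])
      then show ?thesis by (simp add: Inr d_def)
    qed
  qed
  have "((\<lambda>\<mu>. flow \<mu> T *v a) has_vector_derivative d) (at \<mu>0)"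
    unfolding has_vector_derivative_def has_derivative_iff_norm
  proof
    show "bounded_linear (\<lambda>h. h *\<^sub>R d)" by (rule bounded_linear_scaleR_left)
    have "((\<lambda>\<mu>. norm (u \<mu> - d)) \<longlongrightarrow> 0) (at \<mu>0)"
      using tendsto_norm_zero[OF LIM_zero[OF ud]] .
    moreover have "\<forall>\<^sub>F \<mu> in at \<mu>0. norm (u \<mu> - d) = norm (flow \<mu> T *v a - flow \<mu>0 T *v a - (\<mu> - \<mu>0) *\<^sub>R d) / norm (\<mu> - \<mu>0)"
      unfolding eventually_at_filter
    proof (rule always_eventually, intro allI impI)
      fix \<mu> assume "\<mu> \<noteq> \<mu>0"
      then have "flow \<mu> T *v a - flow \<mu>0 T *v a - (\<mu> - \<mu>0) *\<^sub>R d = (\<mu> - \<mu>0) *\<^sub>R (u \<mu> - d)"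
        by (simp add: u_def scaleR_diff_right)
      then show "norm (u \<mu> - d) = norm (flow \<mu> T *v a - flow \<mu>0 T *v a - (\<mu> - \<mu>0) *\<^sub>R d) / norm (\<mu> - \<mu>0)"
        using \<open>\<mu> \<noteq> \<mu>0\<close> by simp
    qed
    ultimately show "((\<lambda>\<mu>. norm (flow \<mu> T *v a - flow \<mu>0 T *v a - (\<mu> - \<mu>0) *\<^sub>R d) / norm (\<mu> - \<mu>0)) \<longlongrightarrow> 0) (at \<mu>0)"
      by (rule Lim_transform_eventually)
  qed
  moreover have "\<omega> d (flow \<mu>0 T *v b) = - I \<mu>0 b" for b
  proof -
    have "((\<lambda>\<mu>. \<omega> (u \<mu>) (flow \<mu>0 T *v b)) \<longlongrightarrow> \<omega> d (flow \<mu>0 T *v b)) (at \<mu>0)"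
      unfolding omega_eq
      by (intro tendsto_diff bounded_bilinear.tendsto[OF bounded_bilinear_herm_inner] tendsto_const
        bounded_linear.tendsto[OF vlin_bounded_linear[OF vlin_mom] ud] bounded_linear.tendsto[OF vlin_bounded_linear[OF vlin_pos] ud])
    moreover have "((\<lambda>\<mu>. \<omega> (u \<mu>) (flow \<mu>0 T *v b)) \<longlongrightarrow> - I \<mu>0 b) (at \<mu>0)"
    proof -
      have "((\<lambda>\<mu>. - I \<mu> b) \<longlongrightarrow> - I \<mu>0 b) (at \<mu>0)"
        using pos_integral_isCont[where a = a and b = b and ?\<mu>0.0 = \<mu>0] unfolding isCont_def I_def[abs_def] by (rule tendsto_minus)
      moreover have "\<forall>\<^sub>F \<mu> in at \<mu>0. - I \<mu> b = \<omega> (u \<mu>) (flow \<mu>0 T *v b)"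
        using ou[of _ b] by (auto simp: eventually_at_filter)
      ultimately show ?thesis by (rule Lim_transform_eventually)
    qed
    ultimately show ?thesis by (rule tendsto_unique[OF trivial_limit_at])
  qed
  ultimately show ?thesis unfolding I_def by blast
qed

lemma pos_integral_positive:
  assumes "a \<noteq> 0"
  shows "Re (integral {0..T} (\<lambda>t. herm_inner (pos (flow \<mu> t *v a)) (pos (flow \<mu> t *v a)))) > 0"
proof -
  let ?f = "\<lambda>t. (norm (pos (flow \<mu> t *v a)))^2"
  have "continuous_on {0..T} (\<lambda>t. flow \<mu> t *v a)"
    by (rule continuous_on_vector_derivative) (rule flow_derivative)
  then have c: "continuous_on {0..T} ?f"
    by (intro continuous_intros bounded_linear.continuous_on[OF vlin_bounded_linear[OF vlin_pos]])
  have "integral {0..T} ?f \<noteq> 0"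
    using integral_eq_0_iff[OF c T_pos] pos_flow_zero[of \<mu> a] assms by auto
  moreover have "integral {0..T} ?f \<ge> 0" by (intro integral_nonneg integrable_continuous_real c) auto
  ultimately have "integral {0..T} ?f > 0" by simp
  moreover have "integral {0..T} (\<lambda>t. herm_inner (pos (flow \<mu> t *v a)) (pos (flow \<mu> t *v a))) = complex_of_real (integral {0..T} ?f)"
    unfolding herm_inner_self using integral_linear[OF integrable_continuous_real[OF c] bounded_linear_of_real] by (simp add: o_def)
  ultimately show ?thesis by simp
qed

end

text \<open>On a Lagrangian subspace the product of momentum and position depends on the position
  alone, since the difference of two vectors with equal position lies in the subspace and isotropy
  annihilates its contribution. A linear choice of preimages then gives the bound.\<close>

lemma lagrangian_form_bound:
  assumes "lagrangian_subspace \<omega> \<Lambda>"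
  shows "\<exists>C\<ge>0. \<forall>z\<in>\<Lambda>. \<bar>Re (herm_inner (mom z) (pos z))\<bar> \<le> C * (norm (pos z))^2"
proof -
  obtain g where g: "g ` UNIV \<subseteq> \<Lambda>" "vlin g" "\<forall>v\<in>pos ` \<Lambda>. pos (g v) = v"
    using vec.linear_exists_right_inverse_on[OF vlin_pos lagrangianD(1)[OF assms]] by blast
  have sq: "sesq (\<lambda>u v. herm_inner (mom (g u)) v)"
    using sesq_compose[OF sesq_herm_inner vlin_compose[OF vlin_mom g(2)], of "\<lambda>v. v"] by (simp add: vlin_iff)
  obtain C where C: "C \<ge> 0" "\<And>u v. cmod (herm_inner (mom (g u)) v) \<le> C * norm u * norm v"
    using sesq_bounded[OF sq] by blast
  have "\<bar>Re (herm_inner (mom z) (pos z))\<bar> \<le> C * (norm (pos z))^2" if z: "z \<in> \<Lambda>" for z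
  proof -
    have gz: "g (pos z) \<in> \<Lambda>" using g(1) by blast
    have p: "pos (g (pos z)) = pos z" using g(3) z by blast
    have "\<omega> (z - g (pos z)) z = 0" by (rule lagrangianD(2)[OF assms vec.subspace_diff[OF lagrangianD(1)[OF assms] z gz] z])
    then have "herm_inner (mom z) (pos z) = herm_inner (mom (g (pos z))) (pos z)"
      unfolding omega_eq by (simp add: p herm_inner_simps)
    then have "\<bar>Re (herm_inner (mom z) (pos z))\<bar> \<le> cmod (herm_inner (mom (g (pos z))) (pos z))"
      by (simp add: abs_Re_le_cmod)
    also have "\<dots> \<le> C * (norm (pos z))^2" using C(2)[of "pos z" "pos z"] by (simp add: power2_eq_square mult_ac)
    finally show ?thesis .
  qed
  then show ?thesis using C(1) by blast
qed

section \<open>Jumps at the eigenvalues\<close>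

context jacobi_bvp
begin

text \<open>The end-point form increases with \<open>\<mu>\<close>: its derivative on the radical is \<open>\<integral> |\<xi>|\<^sup>2\<close>.\<close>

lemma dform_jump:
  assumes tr: "trans_at s \<mu>0 T" and g: "chart s \<Lambda>\<^sub>e g"
  shows "\<exists>d>0. \<forall>\<mu>. \<bar>\<mu> - \<mu>0\<bar> < d \<longrightarrow>
    (\<mu>0 < \<mu> \<longrightarrow> dind s g \<mu> = dind s g \<mu>0 + eig \<mu>0 \<and> eig \<mu> = 0) \<and>
    (\<mu> < \<mu>0 \<longrightarrow> dind s g \<mu> = dind s g \<mu>0 \<and> eig \<mu> = 0)"
proof -
  have TT: "T \<in> {0..T}" using T_pos by simp
  note sy = flow_symplectic[OF TT]
  have "\<forall>a. \<exists>d. ((\<lambda>\<mu>. flow \<mu> T *v a) has_vector_derivative d) (at \<mu>0) \<and>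
    (\<forall>b. \<omega> d (flow \<mu>0 T *v b) = - integral {0..T} (\<lambda>t. herm_inner (pos (flow \<mu>0 t *v a)) (pos (flow \<mu>0 t *v b))))"
    using flow_mu_derivative by blast
  from choice[OF this] obtain D where D: "\<And>a. ((\<lambda>\<mu>. flow \<mu> T *v a) has_vector_derivative D a) (at \<mu>0)"
    "\<And>a b. \<omega> (D a) (flow \<mu>0 T *v b) = - integral {0..T} (\<lambda>t. herm_inner (pos (flow \<mu>0 t *v a)) (pos (flow \<mu>0 t *v b)))"
    by blast
  note vg = chartD(1)[OF g]
  note dp = bounded_linear.has_vector_derivative[OF vlin_bounded_linear[OF vlin_pos] D(1)]
  note dw = bounded_linear.has_vector_derivative[OF vlin_bounded_linear[OF vlin_wmap] D(1)]
  note dg = bounded_linear.has_vector_derivative[OF vlin_bounded_linear[OF vlin_compose[OF vlin_pos vlin_compose[OF vg vlin_wmap]]] D(1)]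
  let ?z = "\<lambda>a. flow \<mu>0 T *v a"
  let ?q' = "\<lambda>a b. (herm_inner (pos (?z a)) (wmap s (D b)) + herm_inner (pos (D a)) (wmap s (?z b)))
     - (herm_inner (pos (g (wmap s (?z a)))) (wmap s (D b)) + herm_inner (pos (g (wmap s (D a)))) (wmap s (?z b)))"
  have der: "((\<lambda>\<mu>. dform s g (flow \<mu> T) a b) has_vector_derivative ?q' a b) (at \<mu>0)" for a b
    unfolding dform_def hform_def rform_def
    by (rule has_vector_derivative_diff[OF bounded_bilinear.has_vector_derivative[OF bounded_bilinear_herm_inner dp dw]
       bounded_bilinear.has_vector_derivative[OF bounded_bilinear_herm_inner dg dw]])
  have q': "sesq ?q'" by (rule sesq_of_derivative[OF sesq_dform[OF vg] der])
  have pos': "Re (?q' x x) > 0" if x: "x \<in> drad s g \<mu>0" "x \<noteq> 0" for x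
  proof -
    have "?z x \<in> \<Lambda>\<^sub>e" using x(1) perp_dform[OF sy start tr endp g] by blast
    then have gz: "g (wmap s (?z x)) = ?z x" by (rule chartD(4)[OF g])
    let ?y = "g (wmap s (D x))"
    have "\<omega> (?z x) ?y = 0" using lagrangianD(2)[OF endp \<open>?z x \<in> \<Lambda>\<^sub>e\<close> chartD(2)[OF g]] .
    from wmap_herm[OF this, of s] have h: "herm_inner (pos ?y) (wmap s (?z x)) = cnj (herm_inner (pos (?z x)) (wmap s (D x)))"
      by (simp add: chartD(3)[OF g])
    \<comment> \<open>The vector lies in \<open>\<Lambda>\<^sub>e\<close>, where the chart map
      reproduces it, so two of the four terms cancel. The remaining chart term is rewritten by
      Hermitian symmetry, and in the result the chart parameter drops out.\<close>
    have "?q' x x = herm_inner (pos (D x)) (wmap s (?z x)) - herm_inner (wmap s (D x)) (pos (?z x))"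
      by (simp add: gz h cnj_herm_inner)
    also have "\<dots> = - \<omega> (D x) (?z x)"
      by (simp add: wmap_def omega_eq herm_inner_simps)
    finally show ?thesis using D(2)[of x x] pos_integral_positive[OF x(2), of \<mu>0] by simp
  qed
  obtain d1 where d1: "d1 > 0" "\<forall>\<mu>\<in>UNIV. \<bar>\<mu> - \<mu>0\<bar> < d1 \<longrightarrow>
    (\<mu>0 < \<mu> \<longrightarrow> dind s g \<mu> = dind s g \<mu>0 + vec.dim (drad s g \<mu>0)
       \<and> drad s g \<mu> = {0}) \<and>
    (\<mu> < \<mu>0 \<longrightarrow> dind s g \<mu> = dind s g \<mu>0 \<and> drad s g \<mu> = {0})"
    using crossing_local[where q = "\<lambda>\<mu>. dform s g (flow \<mu> T)" and S = UNIV, OF sub_s sesq_dform[OF vg] herm_on_dform[OF sy start endp g] q' UNIV_I der pos']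
    by blast
  obtain d2 where d2: "d2 > 0" "\<forall>\<mu>. \<bar>\<mu> - \<mu>0\<bar> < d2 \<longrightarrow> trans_at s \<mu> T"
    using transversal_open_end[OF tr] by blast
  have dim: "vec.dim (drad s g \<mu>) = eig \<mu>" if "\<bar>\<mu> - \<mu>0\<bar> < d2" for \<mu>
    unfolding eig_def using dim_perp_dform[OF sy start _ endp g] d2(2) that by blast
  have zero: "eig \<mu> = 0" if "\<bar>\<mu> - \<mu>0\<bar> < d2" "drad s g \<mu> = {0}" for \<mu>
    using dim[OF that(1)] that(2) by simp
  have dim0: "vec.dim (drad s g \<mu>0) = eig \<mu>0" using dim[of \<mu>0] d2(1) by simp
  show ?thesis
    by (rule exI[of _ "min d1 d2"]) (use d1 d2(1) dim0 zero in auto)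
qed

lemma total_jump:
  "\<exists>d>0. \<forall>\<mu>. \<bar>\<mu> - \<mu>0\<bar> < d \<longrightarrow> (\<mu>0 < \<mu> \<longrightarrow> total \<mu> = total \<mu>0 + eig \<mu>0 \<and> eig \<mu> = 0) \<and>
    (\<mu> < \<mu>0 \<longrightarrow> total \<mu> = total \<mu>0 \<and> eig \<mu> = 0)"
proof -
  obtain s g c where s: "trans_at s \<mu>0 T" "chart s \<Lambda>\<^sub>e g"
    and c: "\<forall>\<^sub>F \<mu> in nhds \<mu>0. int (total \<mu>) = int (dind s g \<mu>) + c"
    using total_local[of \<mu>0] by blast
  obtain d1 where d1: "d1 > 0" "\<And>\<mu>. \<bar>\<mu> - \<mu>0\<bar> < d1 \<Longrightarrow> int (total \<mu>) = int (dind s g \<mu>) + c"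
    using c unfolding eventually_nhds_metric dist_real_def by blast
  obtain d2 where d2: "d2 > 0" "\<And>\<mu>. \<bar>\<mu> - \<mu>0\<bar> < d2 \<Longrightarrow>
    (\<mu>0 < \<mu> \<longrightarrow> dind s g \<mu> = dind s g \<mu>0 + eig \<mu>0 \<and> eig \<mu> = 0) \<and>
    (\<mu> < \<mu>0 \<longrightarrow> dind s g \<mu> = dind s g \<mu>0 \<and> eig \<mu> = 0)"
    using dform_jump[OF s] by blast
  have c0: "int (total \<mu>0) = int (dind s g \<mu>0) + c" using d1 by simp
  have J: "(\<mu>0 < \<mu> \<longrightarrow> total \<mu> = total \<mu>0 + eig \<mu>0 \<and> eig \<mu> = 0) \<and> (\<mu> < \<mu>0 \<longrightarrow> total \<mu> = total \<mu>0 \<and> eig \<mu> = 0)"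
    if "\<bar>\<mu> - \<mu>0\<bar> < min d1 d2" for \<mu>
  proof -
    have a: "int (total \<mu>) = int (dind s g \<mu>) + c" using d1(2) that by simp
    note b = d2(2)[of \<mu>]
    show ?thesis using a b c0 that by auto
  qed
  have p: "min d1 d2 > 0" using d1(1) d2(1) by simp
  show ?thesis by (rule exI, rule conjI[OF p], intro allI, rule impI) (rule J)
qed

lemma total_difference:
  assumes "M \<ge> 0"
  shows "finite {\<mu>\<in>{-M..0}. eig \<mu> \<noteq> 0} \<and> total 0 = total (-M) + (\<Sum>\<mu> | -M \<le> \<mu> \<and> \<mu> < 0 \<and> eig \<mu> \<noteq> 0. eig \<mu>)"
proof (rule jump_sum)
  show "- M \<le> 0" using assms by simp
  fix x :: real assume "x \<in> {-M..0}"
  show "\<exists>d>0. \<forall>s\<in>{-M..0}. \<bar>s - x\<bar> < d \<longrightarrow> (x < s \<longrightarrow> total s = total x + eig x \<and> eig s = 0) \<and> (s < x \<longrightarrow> total s = total x \<and> eig s = 0)"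
    using total_jump[of x] by blast
qed


end

section \<open>Energy estimate for very negative spectral parameter\<close>

context jacobi_system
begin

lemma P_coercive: "\<exists>p>0. \<forall>t\<in>{0..T}. \<forall>v. Re (herm_inner (P t *v v) v) \<ge> p * (norm v)^2"
proof -
  let ?K = "{0..T} \<times> sphere (0 :: complex^'n) 1"
  let ?f = "\<lambda>x. Re (herm_inner (P (fst x) *v snd x) (snd x))"
  have cpt: "compact ?K" by (intro compact_Times) auto
  have "continuous_on ?K (\<lambda>x. P (fst x))"
    by (rule continuous_on_compose2[OF P_cont continuous_on_fst[OF continuous_on_id]]) auto
  then have cont: "continuous_on ?K ?f"
    by (intro continuous_on_Re bounded_bilinear.continuous_on[OF bounded_bilinear_herm_inner]
      matrix_vector_mult_continuous_on continuous_on_snd continuous_on_id)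
  have "axis undefined 1 \<in> sphere (0 :: complex^'n) 1" by (simp add: norm_axis_1)
  then have ne: "?K \<noteq> {}" using T_pos by (auto intro: less_imp_le)
  obtain x0 where x0: "x0 \<in> ?K" "\<And>x. x \<in> ?K \<Longrightarrow> ?f x0 \<le> ?f x"
    using continuous_attains_inf[OF cpt ne cont] by blast
  have p: "?f x0 > 0" using x0(1) by (intro P_pos) auto
  have "Re (herm_inner (P t *v v) v) \<ge> ?f x0 * (norm v)^2" if t: "t \<in> {0..T}" for t v
  proof (cases "v = 0")
    case True then show ?thesis by (simp add: herm_inner_simps)
  next
    case False
    define w where "w = (1 / norm v) *\<^sub>R v"
    have "norm w = 1" using False by (simp add: w_def)
    then have "?f x0 \<le> Re (herm_inner (P t *v w) w)" using x0(2)[of "(t, w)"] t by simp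
    also have "herm_inner (P t *v w) w = complex_of_real ((1 / norm v)^2) * herm_inner (P t *v v) v"
      by (simp add: w_def scaleR_eq_vector_scalar vlinD[OF vlin_matrix] herm_inner_simps power2_eq_square)
    finally have "?f x0 \<le> Re (herm_inner (P t *v v) v) / (norm v)^2" by (simp add: power_divide)
    then show ?thesis using False by (simp add: field_simps)
  qed
  then show ?thesis using p by blast
qed

lemma matrix_form_bound:
  fixes A :: "real \<Rightarrow> complex^'n^'n"
  assumes "continuous_on {0..T} A"
  shows "\<exists>b\<ge>0. \<forall>t\<in>{0..T}. \<forall>x v. cmod (herm_inner (A t *v x) v) \<le> b * norm x * norm v"
proof -
  obtain K1 where K1: "K1 > 0" "\<And>x v :: complex^'n. cmod (herm_inner x v) \<le> norm x * norm v * K1"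
    using bounded_bilinear.pos_bounded[OF bounded_bilinear_herm_inner] by blast
  obtain K2 where K2: "K2 > 0" "\<And>(A :: complex^'n^'n) x. norm (A *v x) \<le> norm A * norm x * K2"
    using bounded_bilinear.pos_bounded[OF bounded_bilinear_matrix_vector_mult] by blast
  have "bounded (A ` {0..T})" by (intro compact_imp_bounded compact_continuous_image assms) auto
  then obtain a where a: "a > 0" "\<And>t. t \<in> {0..T} \<Longrightarrow> norm (A t) \<le> a"
    unfolding bounded_pos by blast
  have "cmod (herm_inner (A t *v x) v) \<le> (a * K2 * K1) * norm x * norm v" if "t \<in> {0..T}" for t x v
  proof -
    have "norm (A t *v x) \<le> a * norm x * K2"
    proof -
      have "norm (A t) * norm x * K2 \<le> a * norm x * K2"
        using a(2)[OF that] K2(1) by (intro mult_right_mono) auto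
      then show ?thesis using K2(2)[of "A t" x] by linarith
    qed
    then have "norm (A t *v x) * (norm v * K1) \<le> a * norm x * K2 * (norm v * K1)"
      using K1(1) by (intro mult_right_mono) auto
    then show ?thesis using K1(2)[of "A t *v x" v] by (simp add: mult_ac)
  qed
  then show ?thesis using a K1 K2 by (intro exI[of _ "a * K2 * K1"]) auto
qed

lemma quadratic_positive:
  fixes p A m x v :: real
  assumes "p > 0" "m > A^2 / p" "x \<noteq> 0 \<or> v \<noteq> 0"
  shows "p * v^2 - 2 * A * x * v + m * x^2 > 0"
proof -
  have e: "p * v^2 - 2 * A * x * v + m * x^2 = (p * v - A * x)^2 / p + (m - A^2 / p) * x^2"
    using assms(1) by (simp add: power2_eq_square field_simps)
  show ?thesis
  proof (cases "x = 0")
    case True then show ?thesis using assms by simp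
  next
    case False
    then have "(m - A^2 / p) * x^2 > 0" using assms by simp
    moreover have "(p * v - A * x)^2 / p \<ge> 0" using assms by simp
    ultimately show ?thesis unfolding e by linarith
  qed
qed

text \<open>For very negative \<open>\<mu>\<close> the energy dominates any prescribed boundary form: \<open>c\<close> interpolates
  linearly between the values prescribed at the two ends.\<close>

lemma energy_monotone:
  "\<exists>M0>0. \<forall>\<mu>\<le>-M0. \<forall>a. a \<noteq> 0 \<longrightarrow> Re (herm_inner (mom a) (pos a)) \<ge> c0 * (norm (pos a))^2 \<longrightarrow>
    (\<forall>t\<in>{0<..T}. Re (herm_inner (mom (flow \<mu> t *v a)) (pos (flow \<mu> t *v a)))
       > (c0 + (c1 - c0) / T * t) * (norm (pos (flow \<mu> t *v a)))^2)"
proof -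
  obtain p where p: "p > 0" "\<And>t v. t \<in> {0..T} \<Longrightarrow> Re (herm_inner (P t *v v) v) \<ge> p * (norm v)^2"
    using P_coercive by blast
  obtain q where q: "q \<ge> 0" "\<And>t x v. t \<in> {0..T} \<Longrightarrow> cmod (herm_inner (Q t *v x) v) \<le> q * norm x * norm v"
    using matrix_form_bound[OF Q_cont] by blast
  obtain r where r: "r \<ge> 0" "\<And>t x v. t \<in> {0..T} \<Longrightarrow> cmod (herm_inner (R t *v x) v) \<le> r * norm x * norm v"
    using matrix_form_bound[OF R_cont] by blast
  obtain k where k: "k > 0" "\<And>x v :: complex^'n. cmod (herm_inner x v) \<le> norm x * norm v * k"
    using bounded_bilinear.pos_bounded[OF bounded_bilinear_herm_inner] by blast
  define d where "d = (c1 - c0) / T"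
  define c where "c t = c0 + d * t" for t
  define cb where "cb = \<bar>c0\<bar> + \<bar>d\<bar> * T"
  have cb: "\<bar>c t\<bar> \<le> cb" if "t \<in> {0..T}" for t
  proof -
    have "\<bar>d * t\<bar> \<le> \<bar>d\<bar> * T" using that by (auto simp: abs_mult intro: mult_left_mono)
    then show ?thesis unfolding c_def cb_def by linarith
  qed
  \<comment> \<open>\<open>A\<close> bounds half the coefficient of the mixed term, and
    \<open>M0\<close> exceeds \<open>r + \<bar>d\<bar>\<close> by more than \<open>A^2 / p\<close>,
    as completing the square requires.\<close>
  define A where "A = q + cb * k"
  define M0 where "M0 = A^2 / p + r + \<bar>d\<bar> + 1"
  have M0: "M0 > 0" unfolding M0_def using p(1) r(1) by (intro add_nonneg_pos add_nonneg_nonneg) auto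
  have main: "Re (herm_inner (mom (flow \<mu> t *v a)) (pos (flow \<mu> t *v a))) > c t * (norm (pos (flow \<mu> t *v a)))^2"
    if \<mu>: "\<mu> \<le> - M0" and a: "a \<noteq> 0" and ini: "Re (herm_inner (mom a) (pos a)) \<ge> c0 * (norm (pos a))^2" and t: "t \<in> {0<..T}" for \<mu> a t
  proof -
    define z where "z t = flow \<mu> t *v a" for t
    \<comment> \<open>The energy relative to the interpolated boundary form; it starts nonnegative
      and has positive derivative.\<close>
    define F where "F t = Re (herm_inner (mom (z t)) (pos (z t)) - complex_of_real (c t) * herm_inner (pos (z t)) (pos (z t)))" for t
    define F' where "F' t = Re (herm_inner (mom (z t)) (pos (field \<mu> t (z t))) + herm_inner (mom (field \<mu> t (z t))) (pos (z t))
       - (complex_of_real (c t) * (herm_inner (pos (z t)) (pos (field \<mu> t (z t))) + herm_inner (pos (field \<mu> t (z t))) (pos (z t)))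
         + complex_of_real d * herm_inner (pos (z t)) (pos (z t))))" for t
    have der: "(F has_vector_derivative F' \<tau>) (at \<tau> within {0..T})" if \<tau>: "\<tau> \<in> {0..T}" for \<tau>
    proof -
      have zd: "(z has_vector_derivative field \<mu> \<tau> (z \<tau>)) (at \<tau> within {0..T})"
        unfolding z_def[abs_def] by (rule flow_derivative[OF \<tau>])
      note zm = bounded_linear.has_vector_derivative[OF vlin_bounded_linear[OF vlin_mom] zd]
      note zp = bounded_linear.has_vector_derivative[OF vlin_bounded_linear[OF vlin_pos] zd]
      have cd: "((\<lambda>t. complex_of_real (c t)) has_vector_derivative complex_of_real d) (at \<tau> within {0..T})"
        unfolding c_def by (auto intro!: derivative_eq_intros)
      show ?thesis unfolding F_def[abs_def] F'_def
        by (rule bounded_linear.has_vector_derivative[OF bounded_linear_Re has_vector_derivative_diff[OF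
           bounded_bilinear.has_vector_derivative[OF bounded_bilinear_herm_inner zm zp]
           has_vector_derivative_mult[OF cd bounded_bilinear.has_vector_derivative[OF bounded_bilinear_herm_inner zp zp]]]])
    qed
    have pos': "F' \<tau> > 0" if \<tau>: "\<tau> \<in> {0..T}" for \<tau>
    proof -
      let ?x = "pos (z \<tau>)" and ?v = "vel \<tau> (z \<tau>)"
      have nz: "?x \<noteq> 0 \<or> ?v \<noteq> 0"
      proof (rule ccontr)
        assume "\<not> (?x \<noteq> 0 \<or> ?v \<noteq> 0)"
        then have "z \<tau> = 0" using mom_eq[OF \<tau>, of "z \<tau>"] by (simp add: block_vec_eq_iff)
        then show False using symplectic_inj[OF flow_symplectic[OF \<tau>]] a unfolding z_def by blast
      qed
      have m: "herm_inner (mom (z \<tau>)) ?v = herm_inner (P \<tau> *v ?v) ?v + herm_inner (Q \<tau> *v ?x) ?v"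
        by (subst mom_eq[OF \<tau>]) (simp add: herm_inner_simps)
      have m': "herm_inner (mom (field \<mu> \<tau> (z \<tau>))) ?x = herm_inner ?v (Q \<tau> *v ?x) + herm_inner (R \<tau> *v ?x) ?x - complex_of_real \<mu> * herm_inner ?x ?x"
        by (simp add: field_def herm_inner_simps Q_adj[OF \<tau>] del: transpose_matrix_vector)
      have qq: "Re (herm_inner ?v (Q \<tau> *v ?x)) = Re (herm_inner (Q \<tau> *v ?x) ?v)"
        using cnj_herm_inner[of "Q \<tau> *v ?x" ?v] by (metis complex_cnj(1) cnj.simps(1))
      have xx: "Re (herm_inner ?v ?x) = Re (herm_inner ?x ?v)"
        using cnj_herm_inner[of ?x ?v] by (metis cnj.simps(1))
      have pf: "pos (field \<mu> \<tau> (z \<tau>)) = ?v" by (simp add: field_def)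
      have "F' \<tau> = Re (herm_inner (P \<tau> *v ?v) ?v) + 2 * Re (herm_inner (Q \<tau> *v ?x) ?v) + Re (herm_inner (R \<tau> *v ?x) ?x)
         - \<mu> * (norm ?x)^2 - 2 * c \<tau> * Re (herm_inner ?x ?v) - d * (norm ?x)^2"
        unfolding F'_def pf m m' by (simp add: qq xx herm_inner_self algebra_simps)
      moreover have "Re (herm_inner (P \<tau> *v ?v) ?v) \<ge> p * (norm ?v)^2" by (rule p(2)[OF \<tau>])
      moreover have "Re (herm_inner (Q \<tau> *v ?x) ?v) \<ge> - (q * norm ?x * norm ?v)"
        using q(2)[OF \<tau>, of ?x ?v] abs_Re_le_cmod[of "herm_inner (Q \<tau> *v ?x) ?v"] by linarith
      moreover have "Re (herm_inner (R \<tau> *v ?x) ?x) \<ge> - (r * (norm ?x)^2)"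
        using r(2)[OF \<tau>, of ?x ?x] abs_Re_le_cmod[of "herm_inner (R \<tau> *v ?x) ?x"] by (simp add: power2_eq_square)
      moreover have "c \<tau> * Re (herm_inner ?x ?v) \<le> cb * k * norm ?x * norm ?v"
      proof -
        have "c \<tau> * Re (herm_inner ?x ?v) \<le> \<bar>c \<tau>\<bar> * \<bar>Re (herm_inner ?x ?v)\<bar>" by (metis abs_ge_self abs_mult)
        also have "\<dots> \<le> cb * (norm ?x * norm ?v * k)"
          using cb[OF \<tau>] k(2)[of ?x ?v] abs_Re_le_cmod[of "herm_inner ?x ?v"] by (intro mult_mono) auto
        finally show ?thesis by (simp add: mult_ac)
      qed
      moreover have "\<mu> * (norm ?x)^2 \<le> - M0 * (norm ?x)^2" using \<mu> by (intro mult_right_mono) auto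
      moreover have "d * (norm ?x)^2 \<le> \<bar>d\<bar> * (norm ?x)^2" by (intro mult_right_mono) auto
      ultimately have "F' \<tau> \<ge> p * (norm ?v)^2 - 2 * A * norm ?x * norm ?v + (M0 - r - \<bar>d\<bar>) * (norm ?x)^2"
        by (simp add: A_def algebra_simps)
      moreover have "p * (norm ?v)^2 - 2 * A * norm ?x * norm ?v + (M0 - r - \<bar>d\<bar>) * (norm ?x)^2 > 0"
        by (rule quadratic_positive[OF p(1)]) (use nz in \<open>auto simp: M0_def\<close>)
      ultimately show ?thesis by linarith
    qed
    have "F 0 < F t"
    proof (rule DERIV_pos_imp_increasing_open[of 0 t F])
      show "0 < t" using t by simp
      show "\<exists>y. (F has_real_derivative y) (at \<tau>) \<and> 0 < y" if "0 < \<tau>" "\<tau> < t" for \<tau>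
      proof -
        have "(F has_real_derivative F' \<tau>) (at \<tau> within {0..T})"
          using der[of \<tau>] that t by (simp add: has_real_derivative_iff_has_vector_derivative)
        moreover have "at \<tau> within {0..T} = at \<tau>" using that t by (intro at_within_Icc_at) auto
        ultimately show ?thesis using pos'[of \<tau>] that t by auto
      qed
      have "continuous_on {0..T} F" by (rule continuous_on_vector_derivative) (rule der)
      then show "continuous_on {0..t} F" by (rule continuous_on_subset) (use t in auto)
    qed
    moreover have "F 0 \<ge> 0" using ini by (simp add: F_def z_def flow_initial c_def herm_inner_self)
    ultimately have "F t > 0" by simp
    then show ?thesis by (simp add: F_def z_def herm_inner_self)
  qed
  show ?thesis by (rule exI, rule conjI[OF M0]) (use main in \<open>auto simp: c_def d_def\<close>)
qed

end

context jacobi_bvp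
begin

text \<open>The interpolation runs from a lower bound for the energy on
  \<open>\<Lambda>\<^sub>s\<close> to an upper bound on \<open>\<Lambda>\<^sub>e\<close>. A crossing
  has zero position and hence zero energy, which is excluded; an eigenfunction would violate the
  strict bound at T; and the form of the triple index compares the energy of a vector with that of
  its component in \<open>\<Lambda>\<^sub>e\<close>, so it has no positive direction.\<close>

lemma total_base:
  "\<exists>M0>0. \<forall>\<mu>\<le>-M0. total \<mu> = 0 \<and> eig \<mu> = 0"
proof -
  have TT: "T \<in> {0..T}" "T \<in> {0<..T}" using T_pos by simp_all
  obtain Cs where Cs: "Cs \<ge> 0" "\<And>z. z \<in> \<Lambda>\<^sub>s \<Longrightarrow> \<bar>Re (herm_inner (mom z) (pos z))\<bar> \<le> Cs * (norm (pos z))^2"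
    using lagrangian_form_bound[OF start] by blast
  obtain Ce where Ce: "Ce \<ge> 0" "\<And>z. z \<in> \<Lambda>\<^sub>e \<Longrightarrow> \<bar>Re (herm_inner (mom z) (pos z))\<bar> \<le> Ce * (norm (pos z))^2"
    using lagrangian_form_bound[OF endp] by blast
  obtain M0 where M0: "M0 > 0" "\<forall>\<mu>\<le>-M0. \<forall>a. a \<noteq> 0 \<longrightarrow> Re (herm_inner (mom a) (pos a)) \<ge> (- Cs) * (norm (pos a))^2 \<longrightarrow>
    (\<forall>t\<in>{0<..T}. Re (herm_inner (mom (flow \<mu> t *v a)) (pos (flow \<mu> t *v a)))
       > (- Cs + (Ce - - Cs) / T * t) * (norm (pos (flow \<mu> t *v a)))^2)"
    using energy_monotone[of "- Cs" Ce] by blast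
  have gt: "Re (herm_inner (mom (flow \<mu> t *v a)) (pos (flow \<mu> t *v a))) > (- Cs + (Ce - - Cs) / T * t) * (norm (pos (flow \<mu> t *v a)))^2"
    if "\<mu> \<le> -M0" "a \<in> \<Lambda>\<^sub>s" "a \<noteq> 0" "t \<in> {0<..T}" for \<mu> a t
    using M0(2) Cs(2)[OF that(2)] that by (auto simp: abs_le_iff)
  have gtT: "Re (herm_inner (mom (flow \<mu> T *v a)) (pos (flow \<mu> T *v a))) > Ce * (norm (pos (flow \<mu> T *v a)))^2"
    if "\<mu> \<le> -M0" "a \<in> \<Lambda>\<^sub>s" "a \<noteq> 0" for \<mu> a
    using gt[OF that TT(2)] T_pos by simp
  have "total \<mu> = 0 \<and> eig \<mu> = 0" if \<mu>: "\<mu> \<le> -M0" for \<mu>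
  proof -
    have cr: "crossing \<mu> t = 0" if t: "t \<in> {0<..T}" for t
    proof -
      have "(*v) (flow \<mu> t) ` \<Lambda>\<^sub>s \<inter> \<Lambda>\<^sub>D \<subseteq> {0}"
      proof
        fix z assume z: "z \<in> (*v) (flow \<mu> t) ` \<Lambda>\<^sub>s \<inter> \<Lambda>\<^sub>D"
        then obtain a where a: "a \<in> \<Lambda>\<^sub>s" "z = flow \<mu> t *v a" "pos z = 0" by (auto simp: Lambda_D_iff)
        then have "a = 0" using gt[OF \<mu> a(1) _ t] by (auto simp: herm_inner_simps)
        then show "z \<in> {0}" using a(2) by (simp add: vlinD(3)[OF vlin_matrix])
      qed
      then show ?thesis unfolding crossing_def by simp
    qed
    have "(*v) (flow \<mu> T) ` \<Lambda>\<^sub>s \<inter> \<Lambda>\<^sub>e \<subseteq> {0}"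
    proof
      fix z assume z: "z \<in> (*v) (flow \<mu> T) ` \<Lambda>\<^sub>s \<inter> \<Lambda>\<^sub>e"
      then obtain a where a: "a \<in> \<Lambda>\<^sub>s" "z = flow \<mu> T *v a" by auto
      have "a = 0" using gtT[OF \<mu> a(1)] Ce(2)[of z] z a(2) by (auto simp: abs_le_iff)
      then show "z \<in> {0}" using a(2) by (simp add: vlinD(3)[OF vlin_matrix])
    qed
    then have e: "eig \<mu> = 0" unfolding eig_def by simp
    let ?\<alpha> = "(*v) (flow \<mu> T) ` \<Lambda>\<^sub>s"
    let ?U = "?\<alpha> \<inter> subspace_sum \<Lambda>\<^sub>e \<Lambda>\<^sub>D"
    have subU: "vec.subspace ?U"
      by (rule vec.subspace_inter[OF subspace_vlin_image[OF vlin_matrix sub_s] subspace_subspace_sum[OF lagrangianD(1)[OF endp] subspace_Lambda_D]])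
    have neg: "Re (Q_form \<omega> \<Lambda>\<^sub>e \<Lambda>\<^sub>D z z) \<le> 0" if z: "z \<in> ?U" for z
    proof -
      obtain a y d where h: "a \<in> \<Lambda>\<^sub>s" "z = flow \<mu> T *v a" "z = y + d" "y \<in> \<Lambda>\<^sub>e" "d \<in> \<Lambda>\<^sub>D"
        using z unfolding subspace_sum_def by blast
      have pd: "pos d = 0" using h(5) by (simp add: Lambda_D_iff)
      have py: "pos z = pos y" using h(3) pd by simp
      have "Q_form \<omega> \<Lambda>\<^sub>e \<Lambda>\<^sub>D z z = \<omega> y d"
        unfolding h(3)
        by (rule Q_form_self[OF sesq_omega lagrangianD(1)[OF endp] lagrangianD(2)[OF endp] subspace_Lambda_D _ h(4,5)])
          (auto simp: omega_eq Lambda_D_iff herm_inner_simps)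
      \<comment> \<open>Both vectors have the same position, so the form is a difference of
        energies.\<close>
      also have "\<dots> = herm_inner (pos y) (mom y) - herm_inner (pos z) (mom z)"
        by (simp add: omega_eq pd h(3) herm_inner_simps)
      finally have "Re (Q_form \<omega> \<Lambda>\<^sub>e \<Lambda>\<^sub>D z z) = Re (herm_inner (mom y) (pos y)) - Re (herm_inner (mom z) (pos z))"
        using cnj_herm_inner[of "mom y" "pos y"] cnj_herm_inner[of "mom z" "pos z"] by (metis cnj.simps(1) minus_complex.simps(1))
      moreover have "Re (herm_inner (mom y) (pos y)) \<le> Ce * (norm (pos z))^2" using Ce(2)[OF h(4)] py by simp
      moreover have "Re (herm_inner (mom z) (pos z)) \<ge> Ce * (norm (pos z))^2"
      proof (cases "a = 0")
        case True then show ?thesis using h(2) by (simp add: vlinD(3)[OF vlin_matrix] herm_inner_simps)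
      next
        case False then show ?thesis using gtT[OF \<mu> h(1)] h(2) by simp
      qed
      ultimately show ?thesis by linarith
    qed
    obtain W where W: "vec.subspace W" "W \<subseteq> ?U" "\<And>x. x \<in> W \<Longrightarrow> x \<noteq> 0 \<Longrightarrow> Re (Q_form \<omega> \<Lambda>\<^sub>e \<Lambda>\<^sub>D x x) > 0"
      "vec.dim W = m_plus (Q_form \<omega> \<Lambda>\<^sub>e \<Lambda>\<^sub>D) ?U"
      using m_plus_attained[OF subU, of "Q_form \<omega> \<Lambda>\<^sub>e \<Lambda>\<^sub>D"] by blast
    have "W \<subseteq> {0}"
    proof
      fix x assume "x \<in> W"
      then show "x \<in> {0}" using W(3)[of x] neg[of x] W(2) by force
    qed
    then have "vec.dim W = 0" by simp
    then have m0: "m_plus (Q_form \<omega> \<Lambda>\<^sub>e \<Lambda>\<^sub>D) ?U = 0" using W(4) by (rule trans[OF sym, rotated])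
    have c0: "vec.dim (?\<alpha> \<inter> \<Lambda>\<^sub>D) = 0" using cr[OF TT(2)] unfolding crossing_def .
    have "triple_index \<omega> ?\<alpha> \<Lambda>\<^sub>e \<Lambda>\<^sub>D = 0"
      unfolding triple_index_def by (simp only: m0 c0 add_0 diff_0_eq_0)
    moreover have "{t. 0 < t \<and> t < T \<and> crossing \<mu> t \<noteq> 0} = {}" using cr by auto
    ultimately have "total \<mu> = 0" unfolding total_def by simp
    then show ?thesis using e by blast
  qed
  then show ?thesis using M0(1) by blast
qed

end

section \<open>Eigenfunctions\<close>

lemma L2_on_continuous:
  assumes "continuous_on {0..T} g" shows "L2_on T g"
  unfolding L2_on_def
proof
  show "g \<in> borel_measurable (lebesgue_on {0..T})"
    by (rule borel_measurable_integrable[OF continuous_imp_integrable_real[OF assms]])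
  show "integrable (lebesgue_on {0..T}) (\<lambda>t. (norm (g t))\<^sup>2)"
    by (intro continuous_imp_integrable_real continuous_intros assms)
qed

lemma W12_deriv_of_derivative:
  fixes f :: "real \<Rightarrow> complex^'n::finite"
  assumes T: "0 \<le> T" and der: "\<And>t. t \<in> {0..T} \<Longrightarrow> (f has_vector_derivative g t) (at t within {0..T})"
    and g: "continuous_on {0..T} g" and eq: "\<And>t. t \<in> {0..T} \<Longrightarrow> f' t = f t"
  shows "W12_deriv T f' g"
  unfolding W12_deriv_def
proof (intro conjI ballI)
  show "L2_on T g" by (rule L2_on_continuous[OF g])
  fix t assume t: "t \<in> {0..T}"
  have "(g has_integral (f t - f 0)) {0..t}"
    by (rule fundamental_theorem_of_calculus)
      (use t der in \<open>auto intro: has_vector_derivative_within_subset[of f _ _ "{0..T}"]\<close>)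
  then show "(g has_integral (f' t - f' 0)) {0..t}" using eq t T by simp
qed

lemma W12_deriv_continuous:
  assumes "W12_deriv T f g" "0 \<le> T" shows "continuous_on {0..T} f"
proof -
  have h: "(g has_integral (f t - f 0)) {0..t}" if "t \<in> {0..T}" for t
    using assms(1) that unfolding W12_deriv_def by blast
  have "g integrable_on {0..T}" using h[of T] assms(2) by auto
  then have "continuous_on {0..T} (\<lambda>t. f 0 + integral {0..t} g)"
    by (intro continuous_intros indefinite_integral_continuous_1)
  moreover have "f 0 + integral {0..t} g = f t" if "t \<in> {0..T}" for t
    using integral_unique[OF h[OF that]] by simp
  ultimately show ?thesis by (metis (no_types, lifting) continuous_on_cong)
qed

text \<open>The link between the measure-theoretic formulation of the operator and gauge integrals,
  which ignore negligible sets.\<close>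

lemma AE_lebesgue_on_Icc_iff:
  "(AE t in lebesgue_on {a..b::real}. Pr t) \<longleftrightarrow> (\<exists>N. negligible N \<and> (\<forall>t\<in>{a..b} - N. Pr t))"
proof
  assume "AE t in lebesgue_on {a..b}. Pr t"
  then obtain N where N: "N \<in> null_sets (lebesgue_on {a..b})" "{x \<in> space (lebesgue_on {a..b}). \<not> Pr x} \<subseteq> N"
    unfolding eventually_ae_filter by blast
  then have "negligible N" by (simp add: null_sets_restrict_space negligible_iff_null_sets)
  moreover have "\<forall>t\<in>{a..b} - N. Pr t" using N(2) by auto
  ultimately show "\<exists>N. negligible N \<and> (\<forall>t\<in>{a..b} - N. Pr t)" by blast
next
  assume "\<exists>N. negligible N \<and> (\<forall>t\<in>{a..b} - N. Pr t)"
  then obtain N where N: "negligible N" "\<forall>t\<in>{a..b} - N. Pr t" by blast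
  have "negligible (N \<inter> {a..b})" using N(1) by (rule negligible_subset) blast
  then have "N \<inter> {a..b} \<in> null_sets (lebesgue_on {a..b})"
    by (simp add: null_sets_restrict_space negligible_iff_null_sets)
  then show "AE t in lebesgue_on {a..b}. Pr t"
    by (rule AE_I') (use N(2) in auto)
qed

text \<open>A weak derivative that agrees almost everywhere with a continuous function has the same
  integrals, so the fundamental theorem of calculus makes it classical at every point.\<close>

lemma W12_deriv_regularity:
  fixes f :: "real \<Rightarrow> complex^'n::finite"
  assumes W: "W12_deriv T f g" and T: "0 \<le> T" and h: "continuous_on {0..T} h"
    and N: "negligible N" "\<And>t. t \<in> {0..T} - N \<Longrightarrow> g t = h t"
    and t: "t \<in> {0..T}"
  shows "(f has_vector_derivative h t) (at t within {0..T})"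
proof -
  have eq: "f t = f 0 + integral {0..t} h" if t: "t \<in> {0..T}" for t
  proof -
    have "(g has_integral (f t - f 0)) {0..t}" using W t unfolding W12_deriv_def by blast
    then have "(h has_integral (f t - f 0)) {0..t}"
      by (rule has_integral_spike[OF N(1), rotated]) (use N(2) t in auto)
    from integral_unique[OF this] show ?thesis by simp
  qed
  have "((\<lambda>t. f 0 + integral {0..t} h) has_vector_derivative h t) (at t within {0..T})"
    using has_vector_derivative_add[OF has_vector_derivative_const integral_has_vector_derivative[OF h t], of "f 0"] by simp
  from has_vector_derivative_transform[OF t eq this] show ?thesis .
qed

section \<open>Eigenspaces and the Morse index\<close>

context jacobi_bvp
begin

definition sol :: "real \<Rightarrow> complex^('n + 'n) \<Rightarrow> real \<Rightarrow> complex^'n" where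
  "sol \<mu> a t = (if t \<in> {0..T} then pos (flow \<mu> t *v a) else 0)"

definition initial :: "real \<Rightarrow> (complex^('n + 'n)) set" where
  "initial \<mu> = {a\<in>\<Lambda>\<^sub>s. flow \<mu> T *v a \<in> \<Lambda>\<^sub>e}"

lemma subspace_initial: "vec.subspace (initial \<mu>)"
  unfolding vec.subspace_def initial_def
  using vec.subspace_0[OF sub_s] vec.subspace_add[OF sub_s] vec.subspace_scale[OF sub_s]
    vec.subspace_0[OF lagrangianD(1)[OF endp]] vec.subspace_add[OF lagrangianD(1)[OF endp]] vec.subspace_scale[OF lagrangianD(1)[OF endp]]
  by (simp add: vlinD[OF vlin_matrix])

lemma dim_initial: "vec.dim (initial \<mu>) = eig \<mu>"
proof -
  have "(*v) (flow \<mu> T) ` initial \<mu> = (*v) (flow \<mu> T) ` \<Lambda>\<^sub>s \<inter> \<Lambda>\<^sub>e" unfolding initial_def by auto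
  moreover have "symplectic (flow \<mu> T)" using flow_symplectic T_pos by simp
  ultimately show ?thesis unfolding eig_def using dim_symplectic_image[OF _ subspace_initial, of "flow \<mu> T" \<mu>] by simp
qed

lemma vel_continuous:
  assumes "continuous_on {0..T} z" shows "continuous_on {0..T} (\<lambda>t. vel t (z t))"
  unfolding vel_def
  by (intro matrix_vector_mult_continuous_on continuous_on_matrix_inv P_cont Q_cont P_invertible continuous_on_diff
    bounded_linear.continuous_on[OF vlin_bounded_linear[OF vlin_mom]] bounded_linear.continuous_on[OF vlin_bounded_linear[OF vlin_pos]] assms)

lemma field_continuous:
  assumes "continuous_on {0..T} z" shows "continuous_on {0..T} (\<lambda>t. mom (field \<mu> t (z t)))"
proof -
  have tr: "continuous_on {0..T} (\<lambda>t. transpose (Q t))"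
    unfolding transpose_def by (intro continuous_on_vec_lambda continuous_on_component Q_cont)
  have p: "continuous_on {0..T} (\<lambda>t. pos (z t))"
    by (rule bounded_linear.continuous_on[OF vlin_bounded_linear[OF vlin_pos] assms])
  have s: "continuous_on {0..T} (\<lambda>t. complex_of_real \<mu> *s pos (z t))"
    unfolding scaleR_eq_vector_scalar[symmetric] by (intro continuous_intros p)
  show ?thesis unfolding field_def mom_block
    by (intro continuous_on_diff continuous_on_add matrix_vector_mult_continuous_on tr R_cont p s vel_continuous assms)
qed

lemma sol_in_eigenspace:
  assumes a: "a \<in> initial \<mu>"
  shows "sol \<mu> a \<in> eigenspace T P Q R (\<Lambda>\<^sub>s \<times> \<Lambda>\<^sub>e) \<mu>"
proof -
  define z where "z t = flow \<mu> t *v a" for t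
  have zd: "(z has_vector_derivative field \<mu> t (z t)) (at t within {0..T})" if "t \<in> {0..T}" for t
    unfolding z_def[abs_def] by (rule flow_derivative[OF that])
  have zc: "continuous_on {0..T} z" by (rule continuous_on_vector_derivative) (rule zd)
  have sol: "sol \<mu> a t = pos (z t)" if "t \<in> {0..T}" for t using that by (simp add: sol_def z_def)
  have pd: "((\<lambda>t. pos (z t)) has_vector_derivative vel t (z t)) (at t within {0..T})" if "t \<in> {0..T}" for t
    using bounded_linear.has_vector_derivative[OF vlin_bounded_linear[OF vlin_pos] zd[OF that]] by (simp add: field_def)
  have md: "((\<lambda>t. mom (z t)) has_vector_derivative mom (field \<mu> t (z t))) (at t within {0..T})" if "t \<in> {0..T}" for t
    by (rule bounded_linear.has_vector_derivative[OF vlin_bounded_linear[OF vlin_mom] zd[OF that]])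
  note T0 = less_imp_le[OF T_pos]
  have W1: "W12_deriv T (sol \<mu> a) (\<lambda>t. vel t (z t))"
    by (rule W12_deriv_of_derivative[OF T0 pd vel_continuous[OF zc] sol])
  have W2: "W12_deriv T (\<lambda>t. mom (z t)) (\<lambda>t. mom (field \<mu> t (z t)))"
    by (rule W12_deriv_of_derivative[OF T0 md field_continuous[OF zc] refl])
  have A1: "AE t in lebesgue_on {0..T}. mom (z t) = P t *v vel t (z t) + Q t *v sol \<mu> a t"
    by (rule AE_I2) (auto simp: sol mom_eq[symmetric])
  have A2: "AE t in lebesgue_on {0..T}. complex_of_real \<mu> *s sol \<mu> a t =
      - mom (field \<mu> t (z t)) + transpose (Q t) *v vel t (z t) + R t *v sol \<mu> a t"
    by (rule AE_I2) (auto simp: sol field_def simp del: transpose_matrix_vector)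
  have bc: "(block_vec (mom (z 0)) (sol \<mu> a 0), block_vec (mom (z T)) (sol \<mu> a T)) \<in> \<Lambda>\<^sub>s \<times> \<Lambda>\<^sub>e"
    using a T_pos sol[of 0] sol[of T] by (simp add: initial_def z_def flow_initial)
  have "operator_graph T P Q R (\<Lambda>\<^sub>s \<times> \<Lambda>\<^sub>e) (sol \<mu> a) (\<lambda>t. complex_of_real \<mu> *s sol \<mu> a t)"
    unfolding operator_graph_def using W1 W2 A1 A2 bc by blast
  moreover have "\<forall>t. t \<notin> {0..T} \<longrightarrow> sol \<mu> a t = 0" by (simp add: sol_def)
  ultimately show ?thesis unfolding eigenspace_def by blast
qed

text \<open>Bootstrapping: \<xi> and y are continuous as integrals, so their weak derivatives agree
  almost everywhere with continuous expressions in them. Hence (y, \<xi>) is a classical solution,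
  to which \<open>flow_unique\<close> applies.\<close>

lemma eigenfunction_is_sol:
  assumes \<xi>: "\<xi> \<in> eigenspace T P Q R (\<Lambda>\<^sub>s \<times> \<Lambda>\<^sub>e) \<mu>"
  shows "\<exists>a\<in>initial \<mu>. \<xi> = sol \<mu> a"
proof -
  note T0 = less_imp_le[OF T_pos]
  have out: "\<xi> t = 0" if "t \<notin> {0..T}" for t using \<xi> that unfolding eigenspace_def by blast
  have "operator_graph T P Q R (\<Lambda>\<^sub>s \<times> \<Lambda>\<^sub>e) \<xi> (\<lambda>t. complex_of_real \<mu> *s \<xi> t)"
    using \<xi> unfolding eigenspace_def by blast
  then obtain \<xi>' y y' where W: "W12_deriv T \<xi> \<xi>'" "W12_deriv T y y'"
    and A1: "AE t in lebesgue_on {0..T}. y t = P t *v \<xi>' t + Q t *v \<xi> t"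
    and bc: "(block_vec (y 0) (\<xi> 0), block_vec (y T) (\<xi> T)) \<in> \<Lambda>\<^sub>s \<times> \<Lambda>\<^sub>e"
    and A2: "AE t in lebesgue_on {0..T}. complex_of_real \<mu> *s \<xi> t = - y' t + transpose (Q t) *v \<xi>' t + R t *v \<xi> t"
    unfolding operator_graph_def by blast
  obtain N1 where N1: "negligible N1" "\<And>t. t \<in> {0..T} - N1 \<Longrightarrow> y t = P t *v \<xi>' t + Q t *v \<xi> t"
    using A1 unfolding AE_lebesgue_on_Icc_iff by blast
  obtain N2 where N2: "negligible N2" "\<And>t. t \<in> {0..T} - N2 \<Longrightarrow> complex_of_real \<mu> *s \<xi> t = - y' t + transpose (Q t) *v \<xi>' t + R t *v \<xi> t"
    using A2 unfolding AE_lebesgue_on_Icc_iff by blast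
  define z where "z t = block_vec (y t) (\<xi> t)" for t
  have f: "vlin (\<lambda>a::complex^'n. block_vec a 0)" and g: "vlin (\<lambda>b::complex^'n. block_vec 0 b)"
    by (simp_all add: vlin_iff block_vec_add block_vec_scale)
  have z_sum: "z = (\<lambda>t. block_vec (y t) 0 + block_vec 0 (\<xi> t))" by (simp add: z_def fun_eq_iff block_vec_add)
  have zc: "continuous_on {0..T} z"
    unfolding z_sum
    by (intro continuous_on_add bounded_linear.continuous_on[OF vlin_bounded_linear[OF f]] bounded_linear.continuous_on[OF vlin_bounded_linear[OF g]]
      W12_deriv_continuous[OF W(1) T0] W12_deriv_continuous[OF W(2) T0])
  have v: "\<xi>' t = vel t (z t)" if "t \<in> {0..T} - N1" for t
  proof -
    have "mom (z t) - Q t *v pos (z t) = P t *v \<xi>' t" using N1(2)[OF that] by (simp add: z_def)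
    then show ?thesis using that by (simp add: vel_def matrix_inv_works(4)[OF P_invertible])
  qed
  have y': "y' t = mom (field \<mu> t (z t))" if t: "t \<in> {0..T} - (N1 \<union> N2)" for t
  proof -
    have "complex_of_real \<mu> *s \<xi> t = - y' t + transpose (Q t) *v \<xi>' t + R t *v \<xi> t" using N2(2) t by blast
    then have "y' t = transpose (Q t) *v \<xi>' t + R t *v \<xi> t - complex_of_real \<mu> *s \<xi> t" by (simp add: algebra_simps)
    moreover have "\<xi>' t = vel t (z t)" using v t by blast
    ultimately show ?thesis by (simp add: field_def z_def)
  qed
  have "(z has_vector_derivative field \<mu> t (z t)) (at t within {0..T})" if t: "t \<in> {0..T}" for t
  proof -
    have 1: "(\<xi> has_vector_derivative vel t (z t)) (at t within {0..T})"
      by (rule W12_deriv_regularity[OF W(1) T0 vel_continuous[OF zc] N1(1) v t])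
    have 2: "(y has_vector_derivative mom (field \<mu> t (z t))) (at t within {0..T})"
      by (rule W12_deriv_regularity[OF W(2) T0 field_continuous[OF zc] negligible_Un[OF N1(1) N2(1)] y' t])
    have "(z has_vector_derivative block_vec (mom (field \<mu> t (z t))) 0 + block_vec 0 (vel t (z t))) (at t within {0..T})"
      unfolding z_sum
      by (rule has_vector_derivative_add[OF bounded_linear.has_vector_derivative[OF vlin_bounded_linear[OF f] 2[unfolded z_sum]]
        bounded_linear.has_vector_derivative[OF vlin_bounded_linear[OF g] 1[unfolded z_sum]]])
    moreover have "block_vec (mom (field \<mu> t (z t))) 0 + block_vec 0 (vel t (z t)) = field \<mu> t (z t)"
      by (simp add: block_vec_add block_vec_eq_iff field_def)
    ultimately show ?thesis by simp
  qed
  from flow_unique[OF this] have zt: "z t = flow \<mu> t *v z 0" if "t \<in> {0..T}" for t using that by blast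
  have "z 0 \<in> initial \<mu>" using bc zt[of T] T_pos unfolding initial_def z_def by auto
  moreover have "\<xi> = sol \<mu> (z 0)"
  proof
    fix t show "\<xi> t = sol \<mu> (z 0) t"
      using out[of t] zt[of t] unfolding sol_def by (auto simp: z_def) (metis pos_block)
  qed
  ultimately show ?thesis by blast
qed

lemma eigenspace_eq: "eigenspace T P Q R (\<Lambda>\<^sub>s \<times> \<Lambda>\<^sub>e) \<mu> = sol \<mu> ` initial \<mu>"
  using sol_in_eigenspace eigenfunction_is_sol by blast

text \<open>\<open>sol \<mu>\<close> is linear and, by \<open>pos_flow_zero\<close>, injective; it
  carries a basis of \<open>initial \<mu>\<close> to a basis of the eigenspace.\<close>

lemma cfun_dim_eigenspace: "cfun_dim (eigenspace T P Q R (\<Lambda>\<^sub>s \<times> \<Lambda>\<^sub>e) \<mu>) = enat (eig \<mu>)"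
proof -
  interpret vector_space_pair "(*s) :: complex \<Rightarrow> complex^('n + 'n) \<Rightarrow> complex^('n + 'n)" "\<lambda>c (f :: real \<Rightarrow> complex^'n) t. c *s f t"
    by unfold_locales
  have lin: "Vector_Spaces.linear (*s) (\<lambda>c f t. c *s f t) (sol \<mu>)"
    unfolding Vector_Spaces.linear_iff
    using vec.vector_space_axioms cfun.vector_space_axioms
    by (auto simp: fun_eq_iff sol_def vlinD[OF vlin_matrix])
  have inj: "a = 0" if "sol \<mu> a = 0" for a
  proof (rule pos_flow_zero[of \<mu>])
    fix t assume "t \<in> {0..T}"
    then show "pos (flow \<mu> t *v a) = 0" using fun_cong[OF that, of t] by (simp add: sol_def)
  qed
  obtain B where B: "B \<subseteq> initial \<mu>" "vec.independent B" "initial \<mu> \<subseteq> vec.span B" "card B = vec.dim (initial \<mu>)"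
    using vec.basis_exists by blast
  have fin: "finite B" using B(2) vec.finiteI_independent by blast
  have injB: "inj_on (sol \<mu>) (vec.span B)"
  proof (rule inj_onI)
    fix a b assume "sol \<mu> a = sol \<mu> b"
    then have "sol \<mu> (a - b) = 0" using linear_diff[OF lin, of a b] by simp
    then show "a = b" using inj[of "a - b"] by simp
  qed
  have ind: "cfun.independent (sol \<mu> ` B)" by (rule linear_independent_injective_image[OF lin B(2) injB])
  have span: "sol \<mu> ` initial \<mu> \<subseteq> cfun.span (sol \<mu> ` B)"
    unfolding linear_span_image[OF lin] using B(3) by blast
  have sub: "sol \<mu> ` B \<subseteq> sol \<mu> ` initial \<mu>" using B(1) by blast
  have "card (sol \<mu> ` B) = card B"
    using inj_on_subset[OF injB, of B] vec.span_superset[of B] by (intro card_image) blast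
  then have "cfun.dim (sol \<mu> ` initial \<mu>) = eig \<mu>"
    using cfun.basis_card_eq_dim[OF sub span ind] B(4) dim_initial by simp
  moreover have "\<exists>B. finite B \<and> sol \<mu> ` initial \<mu> \<subseteq> cfun.span B" using span fin by blast
  ultimately show ?thesis unfolding cfun_dim_def eigenspace_eq by simp
qed

text \<open>By \<open>total_base\<close> all negative eigenvalues lie above -M0, and
  \<open>total_difference\<close> makes them finite in number. The supremum over finite sets is
  attained at this set \<open>S\<close>.\<close>

theorem morse_index_eq: "morse_index T P Q R (\<Lambda>\<^sub>s \<times> \<Lambda>\<^sub>e) = enat (total 0)"
proof -
  obtain M0 where M0: "M0 > 0" "\<And>\<mu>. \<mu> \<le> -M0 \<Longrightarrow> total \<mu> = 0 \<and> eig \<mu> = 0"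
    using total_base by blast
  define S where "S = {\<mu>. -M0 \<le> \<mu> \<and> \<mu> < 0 \<and> eig \<mu> \<noteq> 0}"
  have fin: "finite S" and tot: "total 0 = (\<Sum>\<mu>\<in>S. eig \<mu>)"
  proof -
    have f: "finite {\<mu>\<in>{-M0..0}. eig \<mu> \<noteq> 0}" and t: "total 0 = total (-M0) + (\<Sum>\<mu>\<in>S. eig \<mu>)"
      using total_difference[of M0] M0(1) unfolding S_def by auto
    show "finite S" by (rule finite_subset[OF _ f]) (auto simp: S_def)
    show "total 0 = (\<Sum>\<mu>\<in>S. eig \<mu>)" using t M0(2)[of "-M0"] by simp
  qed
  have sum: "(\<Sum>\<mu>\<in>F. cfun_dim (eigenspace T P Q R (\<Lambda>\<^sub>s \<times> \<Lambda>\<^sub>e) \<mu>)) = enat (\<Sum>\<mu>\<in>F. eig \<mu>)" for F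
    unfolding cfun_dim_eigenspace
  proof (induction F rule: infinite_finite_induct)
    case (insert x F) then show ?case by simp
  qed (simp_all add: zero_enat_def)
  show ?thesis unfolding morse_index_def sum
  proof (rule antisym)
    show "(SUP F\<in>{F. finite F \<and> F \<subseteq> {..<0}}. enat (\<Sum>\<mu>\<in>F. eig \<mu>)) \<le> enat (total 0)"
    proof (rule SUP_least)
      fix F :: "real set" assume F: "F \<in> {F. finite F \<and> F \<subseteq> {..<0}}"
      have "(\<Sum>\<mu>\<in>F. eig \<mu>) = (\<Sum>\<mu>\<in>F \<inter> S. eig \<mu>)"
      proof (rule sum.mono_neutral_right)
        show "\<forall>\<mu>\<in>F - F \<inter> S. eig \<mu> = 0"
        proof
          fix \<mu> assume m: "\<mu> \<in> F - F \<inter> S"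
          then have "\<mu> < 0" using F by auto
          then show "eig \<mu> = 0" using m M0(2)[of \<mu>] unfolding S_def by (cases "\<mu> \<le> -M0") auto
        qed
      qed (use F in auto)
      also have "\<dots> \<le> (\<Sum>\<mu>\<in>S. eig \<mu>)" by (rule sum_mono2[OF fin]) auto
      finally show "enat (\<Sum>\<mu>\<in>F. eig \<mu>) \<le> enat (total 0)" using tot by simp
    qed
    show "enat (total 0) \<le> (SUP F\<in>{F. finite F \<and> F \<subseteq> {..<0}}. enat (\<Sum>\<mu>\<in>F. eig \<mu>))"
      unfolding tot by (rule SUP_upper2[of S]) (use fin in \<open>auto simp: S_def\<close>)
  qed
qed

theorem morse_index_formula:
  "finite {t. 0 < t \<and> t < T \<and> (*v) (\<gamma> t) ` \<Lambda>\<^sub>s \<inter> \<Lambda>\<^sub>D \<noteq> {0}} \<and>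
    morse_index T P Q R (\<Lambda>\<^sub>s \<times> \<Lambda>\<^sub>e) =
      enat ((\<Sum>t | 0 < t \<and> t < T \<and> (*v) (\<gamma> t) ` \<Lambda>\<^sub>s \<inter> \<Lambda>\<^sub>D \<noteq> {0}. vec.dim ((*v) (\<gamma> t) ` \<Lambda>\<^sub>s \<inter> \<Lambda>\<^sub>D)) +
            triple_index \<omega> ((*v) (\<gamma> T) ` \<Lambda>\<^sub>s) \<Lambda>\<^sub>e \<Lambda>\<^sub>D)"
proof -
  have c: "crossing 0 t = vec.dim ((*v) (\<gamma> t) ` \<Lambda>\<^sub>s \<inter> \<Lambda>\<^sub>D)" if "t \<in> {0..T}" for t
    unfolding crossing_def flow_zero[OF that] ..
  have iff: "crossing 0 t \<noteq> 0 \<longleftrightarrow> (*v) (\<gamma> t) ` \<Lambda>\<^sub>s \<inter> \<Lambda>\<^sub>D \<noteq> {0}" if "t \<in> {0..T}" for t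
  proof -
    have "0 \<in> (*v) (\<gamma> t) ` \<Lambda>\<^sub>s \<inter> \<Lambda>\<^sub>D"
      using vec.subspace_0[OF subspace_vlin_image[OF vlin_matrix sub_s]] vec.subspace_0[OF subspace_Lambda_D] by blast
    then show ?thesis unfolding c[OF that] by auto
  qed
  have set: "{t. 0 < t \<and> t < T \<and> (*v) (\<gamma> t) ` \<Lambda>\<^sub>s \<inter> \<Lambda>\<^sub>D \<noteq> {0}} = {t. 0 < t \<and> t < T \<and> crossing 0 t \<noteq> 0}"
  proof (rule Collect_cong)
    fix t
    have "0 < t \<Longrightarrow> t < T \<Longrightarrow> t \<in> {0..T}" by simp
    then show "(0 < t \<and> t < T \<and> (*v) (\<gamma> t) ` \<Lambda>\<^sub>s \<inter> \<Lambda>\<^sub>D \<noteq> {0}) = (0 < t \<and> t < T \<and> crossing 0 t \<noteq> 0)"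
      using iff[of t] by blast
  qed
  have "finite {t. 0 < t \<and> t < T \<and> crossing 0 t \<noteq> 0}"
    by (rule finite_subset[OF _ finite_crossings[of 0]]) auto
  moreover have "(\<Sum>t | 0 < t \<and> t < T \<and> crossing 0 t \<noteq> 0. vec.dim ((*v) (\<gamma> t) ` \<Lambda>\<^sub>s \<inter> \<Lambda>\<^sub>D)) =
      (\<Sum>t | 0 < t \<and> t < T \<and> crossing 0 t \<noteq> 0. crossing 0 t)"
    by (rule sum.cong) (auto simp: c)
  moreover have "flow 0 T = \<gamma> T" using flow_zero T_pos by simp
  ultimately show ?thesis unfolding set morse_index_eq total_def by simp
qed

end

section \<open>Coefficients along a critical point\<close>

text \<open>The line stays in \<open>S\<close>, so the derivative within \<open>S\<close> restricts
  to an ordinary two-sided derivative along it, even at boundary points.\<close>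

lemma slice_derivative:
  fixes F :: "'a::real_normed_vector \<Rightarrow> real"
  assumes "(F has_derivative A) (at (z + s *\<^sub>R w) within S)" "\<And>r. z + r *\<^sub>R w \<in> S"
  shows "((\<lambda>s. F (z + s *\<^sub>R w)) has_real_derivative A w) (at s)"
proof -
  have "((\<lambda>s. z + s *\<^sub>R w) has_derivative (\<lambda>h. h *\<^sub>R w)) (at s)"
    by (auto intro!: derivative_eq_intros)
  moreover have "(F has_derivative A) (at (z + s *\<^sub>R w) within range (\<lambda>s. z + s *\<^sub>R w))"
    by (rule has_derivative_subset[OF assms(1)]) (use assms(2) in auto)
  ultimately have "((\<lambda>s. F (z + s *\<^sub>R w)) has_derivative (\<lambda>h. A (h *\<^sub>R w))) (at s)"
    by (rule has_derivative_in_compose)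
  moreover have "(\<lambda>h. A (h *\<^sub>R w)) = (\<lambda>h. A w * h)"
    using linear_scale[OF has_derivative_linear[OF assms(1)]] by (simp add: fun_eq_iff mult.commute)
  ultimately show ?thesis by (simp add: has_field_derivative_def)
qed

text \<open>\<open>V\<close> consists of directions in which \<open>S\<close> is invariant. In the
  application \<open>S\<close> is a slab bounded in time and \<open>V\<close> holds the directions
  in position and velocity; second derivatives are compared in these directions only.\<close>

locale C2_function =
  fixes S V :: "'a::real_normed_vector set" and L :: "'a \<Rightarrow> real"
    and L' :: "'a \<Rightarrow> 'a \<Rightarrow>\<^sub>L real" and L'' :: "'a \<Rightarrow> 'a \<Rightarrow>\<^sub>L 'a \<Rightarrow>\<^sub>L real"
  assumes L': "\<And>z. z \<in> S \<Longrightarrow> (L has_derivative blinfun_apply (L' z)) (at z within S)"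
    and L'': "\<And>z. z \<in> S \<Longrightarrow> (L' has_derivative blinfun_apply (L'' z)) (at z within S)"
    and cont: "continuous_on S L''"
    and V: "subspace V" "\<And>z w. z \<in> S \<Longrightarrow> w \<in> V \<Longrightarrow> z + w \<in> S"
begin

lemma line_in: "z \<in> S \<Longrightarrow> w \<in> V \<Longrightarrow> z + r *\<^sub>R w \<in> S"
  using V by (simp add: subspace_scale)

lemma derivative_line:
  "z \<in> S \<Longrightarrow> w \<in> V \<Longrightarrow> ((\<lambda>s. L (z + s *\<^sub>R w)) has_real_derivative L' (z + s *\<^sub>R w) w) (at s)"
  by (rule slice_derivative[OF L']) (auto intro: line_in)

lemma derivative_line2:
  assumes "z \<in> S" "w \<in> V"
  shows "((\<lambda>s. L' (z + s *\<^sub>R w) v) has_real_derivative L'' (z + s *\<^sub>R w) w v) (at s)"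
proof -
  have "((\<lambda>z. blinfun_apply (L' z) v) has_derivative (\<lambda>h. L'' y h v)) (at y within S)" if "y \<in> S" for y
    using bounded_linear.has_derivative[OF blinfun.bounded_linear_left L''[OF that]] by simp
  then show ?thesis
    by (intro slice_derivative[where F = "\<lambda>z. blinfun_apply (L' z) v" and S = S]) (auto intro: line_in assms)
qed

text \<open>The mean value theorem, once in direction \<open>a\<close> and once in direction
  \<open>b\<close>.\<close>

lemma second_difference:
  assumes z: "z \<in> S" and ab: "a \<in> V" "b \<in> V" and h: "h > 0"
  shows "\<exists>\<theta> \<eta>. 0 < \<theta> \<and> \<theta> < h \<and> 0 < \<eta> \<and> \<eta> < h \<and>
    L (z + h *\<^sub>R a + h *\<^sub>R b) - L (z + h *\<^sub>R a) - L (z + h *\<^sub>R b) + L z = h * (h * L'' (z + \<theta> *\<^sub>R a + \<eta> *\<^sub>R b) b a)"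
proof -
  define g where "g s = L ((z + h *\<^sub>R b) + s *\<^sub>R a) - L (z + s *\<^sub>R a)" for s
  have "(g has_real_derivative L' ((z + h *\<^sub>R b) + s *\<^sub>R a) a - L' (z + s *\<^sub>R a) a) (at s)" for s
    unfolding g_def by (intro DERIV_diff derivative_line line_in z ab)
  then obtain \<theta> where \<theta>: "0 < \<theta>" "\<theta> < h" "g h - g 0 = (h - 0) * (L' ((z + h *\<^sub>R b) + \<theta> *\<^sub>R a) a - L' (z + \<theta> *\<^sub>R a) a)"
    using MVT2[OF h, of g "\<lambda>s. L' ((z + h *\<^sub>R b) + s *\<^sub>R a) a - L' (z + s *\<^sub>R a) a"] by blast
  define k where "k r = L' ((z + \<theta> *\<^sub>R a) + r *\<^sub>R b) a" for r
  have "(k has_real_derivative L'' ((z + \<theta> *\<^sub>R a) + r *\<^sub>R b) b a) (at r)" for r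
    unfolding k_def by (intro derivative_line2 line_in z ab)
  then obtain \<eta> where \<eta>: "0 < \<eta>" "\<eta> < h" "k h - k 0 = (h - 0) * L'' ((z + \<theta> *\<^sub>R a) + \<eta> *\<^sub>R b) b a"
    using MVT2[OF h, of k "\<lambda>r. L'' ((z + \<theta> *\<^sub>R a) + r *\<^sub>R b) b a"] by blast
  have "L (z + h *\<^sub>R a + h *\<^sub>R b) - L (z + h *\<^sub>R a) - L (z + h *\<^sub>R b) + L z = g h - g 0"
    by (simp add: g_def add_ac)
  also have "\<dots> = h * (k h - k 0)" unfolding \<theta>(3) by (simp add: k_def add_ac)
  finally show ?thesis using \<theta>(1,2) \<eta> by auto
qed

lemma second_derivative_limit:
  assumes z: "z \<in> S" and ab: "a \<in> V" "b \<in> V" and e: "e > 0"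
  shows "\<exists>d>0. \<forall>\<theta> \<eta>. 0 < \<theta> \<and> \<theta> < d \<and> 0 < \<eta> \<and> \<eta> < d \<longrightarrow> \<bar>L'' (z + \<theta> *\<^sub>R a + \<eta> *\<^sub>R b) b a - L'' z b a\<bar> < e"
proof -
  have "continuous_on S (\<lambda>y. L'' y b a)" by (intro continuous_intros cont)
  then obtain d where d: "d > 0" "\<And>y. y \<in> S \<Longrightarrow> dist y z < d \<Longrightarrow> dist (L'' y b a) (L'' z b a) < e"
    unfolding continuous_on_iff using z e by blast
  \<comment> \<open>\<open>N\<close> exceeds the sum of the norms, so steps below d / N move the
    point by less than \<open>d\<close>.\<close>
  define N where "N = norm a + norm b + 1"
  have N: "N > 0" unfolding N_def by (intro add_nonneg_pos add_nonneg_nonneg) auto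
  have "\<bar>L'' (z + \<theta> *\<^sub>R a + \<eta> *\<^sub>R b) b a - L'' z b a\<bar> < e" if h: "0 < \<theta>" "\<theta> < d / N" "0 < \<eta>" "\<eta> < d / N" for \<theta> \<eta>
  proof -
    have "norm (\<theta> *\<^sub>R a + \<eta> *\<^sub>R b) \<le> \<theta> * norm a + \<eta> * norm b"
      using norm_triangle_ineq[of "\<theta> *\<^sub>R a" "\<eta> *\<^sub>R b"] h by simp
    also have "\<dots> \<le> d / N * norm a + d / N * norm b" using h by (intro add_mono mult_right_mono) auto
    also have "\<dots> = d / N * (N - 1)" by (simp only: distrib_left[symmetric]) (simp add: N_def)
    also have "\<dots> < d" using d(1) N by (simp add: field_simps)
    finally have "dist (z + \<theta> *\<^sub>R a + \<eta> *\<^sub>R b) z < d" by (simp add: dist_norm add.assoc)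
    then show ?thesis using d(2)[of "z + \<theta> *\<^sub>R a + \<eta> *\<^sub>R b"] z ab by (simp add: dist_real_def line_in)
  qed
  then show ?thesis using d(1) N by (intro exI[of _ "d / N"]) auto
qed

text \<open>The second difference is symmetric in \<open>a\<close> and \<open>b\<close>, and both
  mixed derivatives are its limit after division by h^2.\<close>

theorem second_derivative_symmetric:
  assumes z: "z \<in> S" and ab: "a \<in> V" "b \<in> V"
  shows "L'' z a b = L'' z b a"
proof (rule ccontr)
  assume ne: "L'' z a b \<noteq> L'' z b a"
  define e where "e = \<bar>L'' z a b - L'' z b a\<bar> / 2"
  have e: "e > 0" using ne by (simp add: e_def)
  obtain d1 where d1: "d1 > 0" "\<And>\<theta> \<eta>. 0 < \<theta> \<Longrightarrow> \<theta> < d1 \<Longrightarrow> 0 < \<eta> \<Longrightarrow> \<eta> < d1 \<Longrightarrow> \<bar>L'' (z + \<theta> *\<^sub>R a + \<eta> *\<^sub>R b) b a - L'' z b a\<bar> < e"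
    using second_derivative_limit[OF z ab e] by blast
  obtain d2 where d2: "d2 > 0" "\<And>\<theta> \<eta>. 0 < \<theta> \<Longrightarrow> \<theta> < d2 \<Longrightarrow> 0 < \<eta> \<Longrightarrow> \<eta> < d2 \<Longrightarrow> \<bar>L'' (z + \<theta> *\<^sub>R b + \<eta> *\<^sub>R a) a b - L'' z a b\<bar> < e"
    using second_derivative_limit[OF z ab(2,1) e] by blast
  define h where "h = min d1 d2 / 2"
  have h: "h > 0" "h < d1" "h < d2" using d1(1) d2(1) unfolding h_def by auto
  obtain \<theta> \<eta> where 1: "0 < \<theta>" "\<theta> < h" "0 < \<eta>" "\<eta> < h"
    "L (z + h *\<^sub>R a + h *\<^sub>R b) - L (z + h *\<^sub>R a) - L (z + h *\<^sub>R b) + L z = h * (h * L'' (z + \<theta> *\<^sub>R a + \<eta> *\<^sub>R b) b a)"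
    using second_difference[OF z ab h(1)] by blast
  obtain \<theta>' \<eta>' where 2: "0 < \<theta>'" "\<theta>' < h" "0 < \<eta>'" "\<eta>' < h"
    "L (z + h *\<^sub>R b + h *\<^sub>R a) - L (z + h *\<^sub>R b) - L (z + h *\<^sub>R a) + L z = h * (h * L'' (z + \<theta>' *\<^sub>R b + \<eta>' *\<^sub>R a) a b)"
    using second_difference[OF z ab(2,1) h(1)] by blast
  have swap: "z + h *\<^sub>R b + h *\<^sub>R a = z + h *\<^sub>R a + h *\<^sub>R b" by (simp add: add_ac)
  have "h * (h * L'' (z + \<theta> *\<^sub>R a + \<eta> *\<^sub>R b) b a) = h * (h * L'' (z + \<theta>' *\<^sub>R b + \<eta>' *\<^sub>R a) a b)"
    using 1(5) 2(5)[unfolded swap] by linarith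
  then have "L'' (z + \<theta> *\<^sub>R a + \<eta> *\<^sub>R b) b a = L'' (z + \<theta>' *\<^sub>R b + \<eta>' *\<^sub>R a) a b" using h(1) by simp
  moreover have "\<bar>L'' (z + \<theta> *\<^sub>R a + \<eta> *\<^sub>R b) b a - L'' z b a\<bar> < e" using d1(2) 1 h by simp
  moreover have "\<bar>L'' (z + \<theta>' *\<^sub>R b + \<eta>' *\<^sub>R a) a b - L'' z a b\<bar> < e" using d2(2) 2 h by simp
  ultimately have "\<bar>L'' z a b - L'' z b a\<bar> < 2 * e" by simp
  then show False unfolding e_def by simp
qed

end

text \<open>A real matrix acts on real and imaginary parts separately, and the mixed terms are
  purely imaginary.\<close>

lemma herm_inner_complexify_real:
  "Re (herm_inner (complexify M *v w) w) = (M *v (\<chi> i. Re (w $ i))) \<bullet> (\<chi> i. Re (w $ i)) + (M *v (\<chi> i. Im (w $ i))) \<bullet> (\<chi> i. Im (w $ i))"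
  for M :: "real^'n::finite^'n"
  by (simp add: herm_inner_def complexify_def matrix_vector_mult_def inner_vec_def sum_distrib_right sum.distrib[symmetric] algebra_simps)

lemma herm_inner_complexify_adj:
  fixes M :: "real^'n::finite^'n"
  shows "herm_inner (transpose (complexify M) *v a) b = herm_inner a (complexify M *v b)"
proof -
  have "herm_inner (transpose (complexify M) *v a) b = (\<Sum>i\<in>UNIV. \<Sum>j\<in>UNIV. complex_of_real (M $ j $ i) * a $ j * cnj (b $ i))"
    by (simp add: herm_inner_def complexify_def transpose_def matrix_vector_mult_def sum_distrib_right del: transpose_matrix_vector)
  also have "\<dots> = (\<Sum>j\<in>UNIV. \<Sum>i\<in>UNIV. complex_of_real (M $ j $ i) * a $ j * cnj (b $ i))" by (rule sum.swap)
  also have "\<dots> = herm_inner a (complexify M *v b)"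
    by (simp add: herm_inner_def complexify_def matrix_vector_mult_def sum_distrib_left mult_ac)
  finally show ?thesis .
qed

lemma transpose_complexify: "transpose M = M \<Longrightarrow> transpose (complexify M) = complexify M"
  by (simp add: transpose_def complexify_def vec_eq_iff)

locale critical_lagrangian =
  fixes T :: real and L :: "'n::finite lagrangian_fun" and x :: "real \<Rightarrow> real^'n"
  assumes T: "0 < T" and C2: "C2_on ({0..T} \<times> UNIV \<times> UNIV) (\<lambda>(t, u, v). L t u v)"
    and legendre: "legendre_condition T L" and crit: "critical_point T L x"
begin

definition dom :: "(real \<times> (real^'n) \<times> (real^'n)) set" where "dom = {0..T} \<times> UNIV \<times> UNIV"
definition space_dirs :: "(real \<times> (real^'n) \<times> (real^'n)) set" where "space_dirs = {0} \<times> UNIV \<times> UNIV"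

text \<open>The iterated one-variable derivatives are entries of one continuous second derivative.
  This transfers continuity to all three Hessians and symmetry to the two pure ones.\<close>

lemma hessian_exists:
  "\<exists>D. continuous_on dom D \<and>
    (\<forall>z\<in>dom. \<forall>a\<in>space_dirs. \<forall>b\<in>space_dirs. blinfun_apply (blinfun_apply (D z) a) b = D z b a) \<and>
    (\<forall>t\<in>{0..T}. \<forall>u v. \<forall>i j. hess_vv L t u v $ i $ j = D (t, u, v) (0, 0, axis i 1) (0, 0, axis j 1) \<and>
       hess_vu L t u v $ i $ j = D (t, u, v) (0, 0, axis i 1) (0, axis j 1, 0) \<and>
       hess_uu L t u v $ i $ j = D (t, u, v) (0, axis i 1, 0) (0, axis j 1, 0))"
proof -
  let ?L = "\<lambda>(t, u, v). L t u v"
  obtain L' where L': "\<And>z. z \<in> dom \<Longrightarrow> (?L has_derivative blinfun_apply (L' z)) (at z within dom)" "C1_on dom L'"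
    using C2 unfolding C2_on_def dom_def by blast
  obtain D where D: "\<And>z. z \<in> dom \<Longrightarrow> (L' has_derivative blinfun_apply (D z)) (at z within dom)" "continuous_on dom D"
    using L'(2) unfolding C1_on_def by blast
  interpret C2_function dom space_dirs ?L L' D
  proof
    show "subspace space_dirs" unfolding space_dirs_def subspace_def by (auto simp: zero_prod_def)
    show "z + w \<in> dom" if "z \<in> dom" "w \<in> space_dirs" for z w
      using that unfolding dom_def space_dirs_def by auto
  qed (use L' D in auto)
  have dirs: "(0, u, v) \<in> space_dirs" for u v unfolding space_dirs_def by simp
  have in_dom: "(t, u, v) \<in> dom" if "t \<in> {0..T}" for t u v using that unfolding dom_def by simp
  have pu: "partial_u i L t u v = L' (t, u, v) (0, axis i 1, 0)" if "t \<in> {0..T}" for i t u v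
    using DERIV_imp_deriv[OF derivative_line[where z = "(t, u, v)" and w = "(0, axis i 1, 0)" and s = 0, OF in_dom[OF that] dirs]]
    by (simp add: partial_u_def)
  have pv: "partial_v i L t u v = L' (t, u, v) (0, 0, axis i 1)" if "t \<in> {0..T}" for i t u v
    using DERIV_imp_deriv[OF derivative_line[where z = "(t, u, v)" and w = "(0, 0, axis i 1)" and s = 0, OF in_dom[OF that] dirs]]
    by (simp add: partial_v_def)
  have pvv: "partial_v i (partial_v j L) t u v = D (t, u, v) (0, 0, axis i 1) (0, 0, axis j 1)" if "t \<in> {0..T}" for i j t u v
    using DERIV_imp_deriv[OF derivative_line2[where z = "(t, u, v)" and w = "(0, 0, axis i 1)" and v = "(0, 0, axis j 1)" and s = 0, OF in_dom[OF that] dirs]]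
    unfolding partial_v_def[of i] pv[OF that] by simp
  have pvu: "partial_v i (partial_u j L) t u v = D (t, u, v) (0, 0, axis i 1) (0, axis j 1, 0)" if "t \<in> {0..T}" for i j t u v
    using DERIV_imp_deriv[OF derivative_line2[where z = "(t, u, v)" and w = "(0, 0, axis i 1)" and v = "(0, axis j 1, 0)" and s = 0, OF in_dom[OF that] dirs]]
    unfolding partial_v_def[of i] pu[OF that] by simp
  have puu: "partial_u i (partial_u j L) t u v = D (t, u, v) (0, axis i 1, 0) (0, axis j 1, 0)" if "t \<in> {0..T}" for i j t u v
    using DERIV_imp_deriv[OF derivative_line2[where z = "(t, u, v)" and w = "(0, axis i 1, 0)" and v = "(0, axis j 1, 0)" and s = 0, OF in_dom[OF that] dirs]]
    unfolding partial_u_def[of i] pu[OF that] by simp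
  show ?thesis
    by (intro exI[of _ D] conjI ballI allI)
      (simp_all add: D(2) second_derivative_symmetric hess_vv_def hess_vu_def hess_uu_def pvv pvu puu)
qed

lemma critical_continuous: "continuous_on {0..T} x" "continuous_on {0..T} (velocity T x)"
proof -
  have "C1_on {0..T} x" using crit unfolding critical_point_def by blast
  then obtain x' where x': "\<And>t. t \<in> {0..T} \<Longrightarrow> (x has_derivative blinfun_apply (x' t)) (at t within {0..T})" "continuous_on {0..T} x'"
    unfolding C1_on_def by blast
  have d: "(x has_vector_derivative x' t 1) (at t within {0..T})" if "t \<in> {0..T}" for t
  proof -
    have "blinfun_apply (x' t) h = h *\<^sub>R x' t 1" for h
      using blinfun.scaleR_right[of "x' t" h 1] by simp
    then show ?thesis unfolding has_vector_derivative_def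
      by (intro has_derivative_eq_rhs[OF x'(1)[OF that]] ext)
  qed
  then show "continuous_on {0..T} x" by (rule continuous_on_vector_derivative)
  have "velocity T x t = x' t 1" if "t \<in> {0..T}" for t
    unfolding velocity_def by (rule vector_derivative_within_closed_interval[OF T that d[OF that]])
  moreover have "continuous_on {0..T} (\<lambda>t. x' t 1)" by (intro continuous_intros x'(2))
  ultimately show "continuous_on {0..T} (velocity T x)" by (metis (no_types, lifting) continuous_on_cong)
qed

text \<open>The Legendre condition concerns real vectors; positivity on complex ones follows by
  splitting into real and imaginary parts, of which at least one is nonzero.\<close>

lemma jacobi_system_along:
  assumes fund: "fundamental_solution T (\<lambda>t. B_mat (P_along T L x t) (Q_along T L x t) (R_along T L x t)) \<gamma>"
  shows "jacobi_system T (P_along T L x) (Q_along T L x) (R_along T L x) \<gamma>"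
proof -
  obtain D where Dc: "continuous_on dom D"
    and Ds: "\<And>z a b. z \<in> dom \<Longrightarrow> a \<in> space_dirs \<Longrightarrow> b \<in> space_dirs \<Longrightarrow> blinfun_apply (blinfun_apply (D z) a) b = D z b a"
    and H: "\<And>t u v i j. t \<in> {0..T} \<Longrightarrow> hess_vv L t u v $ i $ j = D (t, u, v) (0, 0, axis i 1) (0, 0, axis j 1)"
       "\<And>t u v i j. t \<in> {0..T} \<Longrightarrow> hess_vu L t u v $ i $ j = D (t, u, v) (0, 0, axis i 1) (0, axis j 1, 0)"
       "\<And>t u v i j. t \<in> {0..T} \<Longrightarrow> hess_uu L t u v $ i $ j = D (t, u, v) (0, axis i 1, 0) (0, axis j 1, 0)"
    using hessian_exists by blast
  have dirs: "(0, u, v) \<in> space_dirs" for u v unfolding space_dirs_def by simp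
  have in_dom: "(t, u, v) \<in> dom" if "t \<in> {0..T}" for t u v using that unfolding dom_def by simp
  have Dx: "continuous_on {0..T} (\<lambda>t. D (t, x t, velocity T x t) a b)" for a b
    by (intro blinfun.continuous_on continuous_on_const continuous_on_compose2[OF Dc] continuous_on_Pair
      continuous_on_id critical_continuous) (auto simp: dom_def)
  have cont: "continuous_on {0..T} (\<lambda>t. complexify (A t))"
    if "\<And>i j. continuous_on {0..T} (\<lambda>t. A t $ i $ j)" for A :: "real \<Rightarrow> real^'n^'n"
    unfolding complexify_def by (intro continuous_on_vec_lambda continuous_on_of_real that)
  have cP: "continuous_on {0..T} (\<lambda>t. hess_vv L t (x t) (velocity T x t) $ i $ j)" for i j
    by (rule continuous_on_eq[OF Dx[of "(0, 0, axis i 1)" "(0, 0, axis j 1)"]]) (simp add: H)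
  have cQ: "continuous_on {0..T} (\<lambda>t. hess_vu L t (x t) (velocity T x t) $ i $ j)" for i j
    by (rule continuous_on_eq[OF Dx[of "(0, 0, axis i 1)" "(0, axis j 1, 0)"]]) (simp add: H)
  have cR: "continuous_on {0..T} (\<lambda>t. hess_uu L t (x t) (velocity T x t) $ i $ j)" for i j
    by (rule continuous_on_eq[OF Dx[of "(0, axis i 1, 0)" "(0, axis j 1, 0)"]]) (simp add: H)
  have sP: "transpose (hess_vv L t u v) = hess_vv L t u v" and sR: "transpose (hess_uu L t u v) = hess_uu L t u v"
    if "t \<in> {0..T}" for t u v
    unfolding vec_eq_iff transpose_def
    by (simp_all only: vec_lambda_beta H(1,3)[OF that]) (intro allI Ds in_dom[OF that] dirs)+
  show ?thesis
  proof
    show "continuous_on {0..T} (P_along T L x)" unfolding P_along_def[abs_def] by (rule cont[OF cP])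
    show "continuous_on {0..T} (Q_along T L x)" unfolding Q_along_def[abs_def] by (rule cont[OF cQ])
    show "continuous_on {0..T} (R_along T L x)" unfolding R_along_def[abs_def] by (rule cont[OF cR])
    fix t a b assume t: "t \<in> {0..T}"
    show "herm_inner (P_along T L x t *v a) b = herm_inner a (P_along T L x t *v b)"
      unfolding P_along_def using herm_inner_complexify_adj[of "hess_vv L t (x t) (velocity T x t)" a b]
      unfolding transpose_complexify[OF sP[OF t]] .
    show "herm_inner (R_along T L x t *v a) b = herm_inner a (R_along T L x t *v b)"
      unfolding R_along_def using herm_inner_complexify_adj[of "hess_uu L t (x t) (velocity T x t)" a b]
      unfolding transpose_complexify[OF sR[OF t]] .
    show "herm_inner (transpose (Q_along T L x t) *v a) b = herm_inner a (Q_along T L x t *v b)"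
      unfolding Q_along_def by (rule herm_inner_complexify_adj)
  next
    fix t and a :: "complex^'n" assume t: "t \<in> {0..T}" and a: "a \<noteq> 0"
    let ?M = "hess_vv L t (x t) (velocity T x t)"
    have pos': "(?M *v w) \<bullet> w > 0" if "w \<noteq> 0" for w
      using legendre t that unfolding legendre_condition_def by blast
    have nn: "(?M *v w) \<bullet> w \<ge> 0" for w using pos'[of w] by (cases "w = 0") auto
    have "(\<chi> i. Re (a $ i)) \<noteq> 0 \<or> (\<chi> i. Im (a $ i)) \<noteq> 0"
      using a by (auto simp: vec_eq_iff complex_eq_iff)
    then show "Re (herm_inner (P_along T L x t *v a) a) > 0"
      unfolding P_along_def herm_inner_complexify_real
      using pos'[of "\<chi> i. Re (a $ i)"] pos'[of "\<chi> i. Im (a $ i)"] nn[of "\<chi> i. Re (a $ i)"] nn[of "\<chi> i. Im (a $ i)"] by auto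
  qed (use T fund in auto)
qed

end

theorem theorem1p4:
  fixes T :: real
    and L :: "real \<Rightarrow> real^'n \<Rightarrow> real^'n \<Rightarrow> real"
    and x :: "real \<Rightarrow> real^'n"
    and \<gamma> :: "real \<Rightarrow> complex^('n + 'n)^('n + 'n)"
    and P Q R :: "real \<Rightarrow> complex^'n^'n"
    and \<Lambda>\<^sub>s \<Lambda>\<^sub>e :: "(complex^('n + 'n)) set"
  assumes "0 < T"
    and "C2_on ({0..T} \<times> UNIV \<times> UNIV) (\<lambda>(t, u, v). L t u v)"
    and "legendre_condition T L"
    and "critical_point T L x"
    and "P = P_along T L x" and "Q = Q_along T L x" and "R = R_along T L x"
    and "fundamental_solution T (\<lambda>t. B_mat (P t) (Q t) (R t)) \<gamma>"
    and "lagrangian_subspace (\<lambda>a b. - \<omega> a b) \<Lambda>\<^sub>s"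
    and "lagrangian_subspace \<omega> \<Lambda>\<^sub>e"
  shows "finite {t. 0 < t \<and> t < T \<and> (*v) (\<gamma> t) ` \<Lambda>\<^sub>s \<inter> \<Lambda>\<^sub>D \<noteq> {0}} \<and>
    morse_index T P Q R (\<Lambda>\<^sub>s \<times> \<Lambda>\<^sub>e) =
      enat ((\<Sum>t | 0 < t \<and> t < T \<and> (*v) (\<gamma> t) ` \<Lambda>\<^sub>s \<inter> \<Lambda>\<^sub>D \<noteq> {0}. vec.dim ((*v) (\<gamma> t) ` \<Lambda>\<^sub>s \<inter> \<Lambda>\<^sub>D)) +
            triple_index \<omega> ((*v) (\<gamma> T) ` \<Lambda>\<^sub>s) \<Lambda>\<^sub>e \<Lambda>\<^sub>D)"
proof -
  interpret critical_lagrangian T L x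
    using assms(1-4) by unfold_locales
  have "jacobi_system T P Q R \<gamma>"
    using jacobi_system_along assms(5-8) by blast
  \<comment> \<open>The sign of the form at the initial end point does not change which subspaces
    are Lagrangian.\<close>
  then interpret jacobi_bvp T P Q R \<gamma> \<Lambda>\<^sub>s \<Lambda>\<^sub>e
    using assms(9,10) by (simp add: jacobi_bvp_def jacobi_bvp_axioms_def lagrangian_uminus)
  show ?thesis by (rule morse_index_formula)
qed

end
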